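(* Let $G$ be a standard reductive group over $\Bbbk$ with Lie algebra $\mathfrak g$, let $m>0$ and $0\le k\le m$. Let $\chi\in\mathfrak g_m^*$ be supported in degree less than or equal to $k$, i.e. $\chi(\mathfrak g_m^{(>k)})=0$, and let $\psi=\chi|_{\mathfrak g_k}\in\mathfrak g_k^*$, where $\mathfrak g_k$ is identified with $\mathfrak g_m^{(\le k)}\subseteq\mathfrak g_m$ as a vector space via $xt^i\mapsto xt^i$. Then: (1) The full subcategory of $U_\chi(\mathfrak g_m)\text{-mod}$ whose objects are the modules annihilated by $\mathfrak g_m^{(>k)}$ is equivalent to $U_\psi(\mathfrak g_k)\text{-mod}$. This full subcategory contains all simple $U_\chi(\mathfrak g_m)$-modules. (2) $\dim\mathfrak g_m-\dim\mathfrak g_m^\chi=\dim\mathfrak g_k-\dim\mathfrak g_k^\psi$.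
   Context: $\Bbbk$ is an algebraically closed field of characteristic $p>0$. A standard reductive group $G$ is a connected reductive algebraic group over $\Bbbk$ such that (H1) the derived subgroup of $G$ is simply connected, (H2) $p$ is good for the root system of $G$, (H3) there is a non-degenerate $G$-invariant bilinear form $\kappa$ on $\mathfrak g=\operatorname{Lie}(G)$. For $n\ge0$ the truncated current algebra $\mathfrak g_n=\mathfrak g\otimes\Bbbk[t]/(t^{n+1})$ is a Lie algebra over $\Bbbk$ with bracket $[xt^i,yt^j]=[x,y]t^{i+j}$ where $xt^i:=x\otimes t^i$; it is restricted, with $p$-map determined by $(xt^i)^{[p]}=x^{[p]}t^{pi}$. Put $\mathfrak g_m^{(i)}=\mathfrak gt^i$, $\mathfrak g_m^{(>k)}=\bigoplus_{i>k}\mathfrak g_m^{(i)}$, $\mathfrak g_m^{(\le k)}=\bigoplus_{i\le k}\mathfrak g_m^{(i)}$. For a restricted Lie algebra $\mathfrak l$ and $\chi\in\mathfrak l^*$, $U_\chi(\mathfrak l)$ is the quotient of $U(\mathfrak l)$ by the ideal generated by $x^p-x^{[p]}-\chi(x)^p$, $x\in\mathfrak l$; $U_\chi(\mathfrak l)\text{-mod}$ is its category of finite-dimensional modules; and $\mathfrak l^\chi=\{x\in\mathfrak l\mid\chi([x,\mathfrak l])=0\}$. *)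

theory Defs
  imports
    "HOL-Analysis.Analysis"
    "HOL-Algebra.QuotRing"
    "HOL-Algebra.Generated_Groups"
    "HOL-Algebra.Module"
    "HOL-Library.Function_Algebras"
begin

section \<open>Linear algebraic groups over an algebraically closed field\<close>

text \<open>Affine algebraic groups over an algebraically closed field are realised, as varieties, as
  Zariski closed subgroups of some general linear group. Since the field is infinite, polynomials
  in the matrix entries are identified with the functions they induce.\<close>

definition mscale :: "'k::field \<Rightarrow> 'k^'n^'n \<Rightarrow> 'k^'n^'n" where
  "mscale c A = (\<chi> i j. c * A $ i $ j)"

definition GL :: "('k::field^'n^'n) monoid" where
  "GL = \<lparr>carrier = {A. invertible A}, monoid.mult = (**), one = mat 1\<rparr>"

inductive_set polyfuns :: "('k::field^'n^'n \<Rightarrow> 'k) set" where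
  const: "(\<lambda>_. c) \<in> polyfuns"
| entry: "(\<lambda>A. A $ i $ j) \<in> polyfuns"
| add: "f \<in> polyfuns \<Longrightarrow> g \<in> polyfuns \<Longrightarrow> (\<lambda>A. f A + g A) \<in> polyfuns"
| mult: "f \<in> polyfuns \<Longrightarrow> g \<in> polyfuns \<Longrightarrow> (\<lambda>A. f A * g A) \<in> polyfuns"

definition zariski_closed :: "('k::field^'n^'n) set \<Rightarrow> bool" where
  "zariski_closed Z \<longleftrightarrow> (\<exists>F \<subseteq> polyfuns. Z = {A. invertible A \<and> (\<forall>f\<in>F. f A = 0)})"

definition zariski_connected :: "('k::field^'n^'n) set \<Rightarrow> bool" where
  "zariski_connected Z \<longleftrightarrow>
     \<not> (\<exists>A B. zariski_closed A \<and> zariski_closed B \<and> A \<noteq> {} \<and> B \<noteq> {} \<and> A \<inter> B = {} \<and> Z = A \<union> B)"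

definition identity_component :: "('k::field^'n^'n) set \<Rightarrow> ('k^'n^'n) set" where
  "identity_component H =
     \<Union>{C. C \<subseteq> H \<and> zariski_closed C \<and> zariski_connected C \<and> mat 1 \<in> C}"

definition closed_subgroup :: "('k::field^'n^'n) set \<Rightarrow> bool" where
  "closed_subgroup H \<longleftrightarrow> subgroup H GL \<and> zariski_closed H"

definition unipotent :: "'k::field^'n^'n \<Rightarrow> bool" where
  "unipotent A \<longleftrightarrow> (\<exists>r. (((**) (A - mat 1)) ^^ r) (mat 1) = 0)"

text \<open>The last clause says that the unipotent radical is trivial.\<close>

definition connected_reductive :: "('k::field^'n^'n) set \<Rightarrow> bool" where
  "connected_reductive G \<longleftrightarrow>
     closed_subgroup G \<and> zariski_connected G \<and>
     (\<forall>U. closed_subgroup U \<and> zariski_connected U \<and> U \<lhd> GL\<lparr>carrier := G\<rparr> \<and> (\<forall>u\<in>U. unipotent u)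
        \<longrightarrow> U = {mat 1})"

text \<open>The Lie algebra is the tangent space at the identity, inside the space of all matrices:
  the coefficient of \<open>s\<close> in \<open>f (1 + s X)\<close> is the differential of \<open>f\<close> at \<open>1\<close> applied to \<open>X\<close>.\<close>

definition lie_of :: "('k::field^'n^'n) set \<Rightarrow> ('k^'n^'n) set" where
  "lie_of G = {X. \<forall>f\<in>polyfuns. (\<forall>A\<in>G. f A = 0) \<longrightarrow>
     (\<exists>q. (\<forall>s. f (mat 1 + mscale s X) = poly q s) \<and> coeff q 1 = 0)}"

definition Ad :: "'k::field^'n^'n \<Rightarrow> 'k^'n^'n \<Rightarrow> 'k^'n^'n" where
  "Ad g X = g ** X ** matrix_inv g"

section \<open>Tori, roots and coroots\<close>

definition torus :: "('k::field^'n^'n) set \<Rightarrow> bool" where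
  "torus T \<longleftrightarrow> closed_subgroup T \<and> zariski_connected T \<and>
     (\<exists>P. invertible P \<and> (\<forall>t\<in>T. \<forall>i j. i \<noteq> j \<longrightarrow> Ad P t $ i $ j = 0))"

definition maximal_torus :: "('k::field^'n^'n) set \<Rightarrow> ('k^'n^'n) set \<Rightarrow> bool" where
  "maximal_torus G T \<longleftrightarrow> torus T \<and> T \<subseteq> G \<and> (\<forall>T'. torus T' \<and> T \<subseteq> T' \<and> T' \<subseteq> G \<longrightarrow> T' = T)"

definition characters :: "('k::field^'n^'n) set \<Rightarrow> ('k^'n^'n \<Rightarrow> 'k) set" where
  "characters T = {a \<in> extensional T.
     (\<exists>f\<in>polyfuns. \<exists>r::nat. \<forall>t\<in>T. a t = f t / det t ^ r) \<and>
     (\<forall>t\<in>T. a t \<noteq> 0) \<and> (\<forall>s\<in>T. \<forall>t\<in>T. a (s ** t) = a s * a t)}"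

definition cocharacters :: "('k::field^'n^'n) set \<Rightarrow> ('k \<Rightarrow> 'k^'n^'n) set" where
  "cocharacters T = {l \<in> (- {0}) \<rightarrow>\<^sub>E T.
     (\<forall>i j. \<exists>q. \<exists>r::nat. \<forall>s. s \<noteq> 0 \<longrightarrow> l s $ i $ j = poly q s / s ^ r) \<and>
     (\<forall>s t. s \<noteq> 0 \<and> t \<noteq> 0 \<longrightarrow> l (s * t) = l s ** l t)}"

definition cocharacter_group :: "('k::field^'n^'n) set \<Rightarrow> ('k \<Rightarrow> 'k^'n^'n) monoid" where
  "cocharacter_group T =
     \<lparr>carrier = cocharacters T,
      monoid.mult = (\<lambda>l l'. \<lambda>s\<in>- {0}. l s ** l' s),
      one = (\<lambda>s\<in>- {0}. mat 1)\<rparr>"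

definition roots :: "('k::field^'n^'n) set \<Rightarrow> ('k^'n^'n) set \<Rightarrow> ('k^'n^'n \<Rightarrow> 'k) set" where
  "roots G T = {a \<in> characters T. (\<exists>t\<in>T. a t \<noteq> 1) \<and>
     (\<exists>X\<in>lie_of G. X \<noteq> 0 \<and> (\<forall>t\<in>T. Ad t X = mscale (a t) X))}"

text \<open>The coroot of a root \<open>a\<close> is the unique cocharacter \<open>l\<close> with values in the derived subgroup
  of \<open>C\<^sub>G((ker a)\<^sup>0)\<close> such that \<open>\<langle>a, l\<rangle> = 2\<close>, that is, \<open>a (l s) = s\<^sup>2\<close>.\<close>

definition centralizer :: "('k::field^'n^'n) set \<Rightarrow> ('k^'n^'n) set \<Rightarrow> ('k^'n^'n) set" where
  "centralizer G S = {g \<in> G. \<forall>s\<in>S. g ** s = s ** g}"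

definition coroots :: "('k::field^'n^'n) set \<Rightarrow> ('k^'n^'n) set \<Rightarrow> ('k \<Rightarrow> 'k^'n^'n) set" where
  "coroots G T = {l \<in> cocharacters T. \<exists>a\<in>roots G T. \<forall>s. s \<noteq> 0 \<longrightarrow>
     a (l s) = s ^ 2 \<and>
     l s \<in> derived GL (centralizer G (identity_component {t \<in> T. a t = 1}))}"

text \<open>For a connected semisimple group: the coroots generate the cocharacter lattice of a maximal
  torus.\<close>

definition group_simply_connected :: "('k::field^'n^'n) set \<Rightarrow> bool" where
  "group_simply_connected H \<longleftrightarrow>
     (\<exists>T. maximal_torus H T \<and> generate (cocharacter_group T) (coroots H T) = cocharacters T)"

text \<open>The character group of \<open>T\<close> is written multiplicatively, so \<open>\<Sum>\<alpha>. n \<alpha> \<cdot> \<alpha>\<close> becomes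
  \<open>\<lambda>t. \<Prod>\<alpha>. \<alpha> t powi n \<alpha>\<close>.\<close>

definition char_comb ::
    "('k::field^'n^'n) set \<Rightarrow> ('k^'n^'n \<Rightarrow> 'k) set \<Rightarrow> (('k^'n^'n \<Rightarrow> 'k) \<Rightarrow> int) \<Rightarrow> 'k^'n^'n \<Rightarrow> 'k" where
  "char_comb T D n = (\<lambda>t\<in>T. \<Prod>\<alpha>\<in>D. \<alpha> t powi n \<alpha>)"

definition root_base :: "('k::field^'n^'n) set \<Rightarrow> ('k^'n^'n) set \<Rightarrow> ('k^'n^'n \<Rightarrow> 'k) set \<Rightarrow> bool" where
  "root_base G T D \<longleftrightarrow> finite D \<and> D \<subseteq> roots G T \<and>
     (\<forall>n. char_comb T D n = (\<lambda>t\<in>T. 1) \<longrightarrow> (\<forall>\<alpha>\<in>D. n \<alpha> = 0)) \<and>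
     (\<forall>\<beta>\<in>roots G T. \<exists>n. \<beta> = char_comb T D n \<and> ((\<forall>\<alpha>\<in>D. 0 \<le> n \<alpha>) \<or> (\<forall>\<alpha>\<in>D. n \<alpha> \<le> 0)))"

text \<open>A prime is good if it divides none of the nonzero coefficients of the roots when these are
  expressed in a base.\<close>

definition good_prime :: "nat \<Rightarrow> ('k::field^'n^'n) set \<Rightarrow> bool" where
  "good_prime p G \<longleftrightarrow> (\<exists>T D. maximal_torus G T \<and> root_base G T D \<and>
     (\<forall>n. char_comb T D n \<in> roots G T \<longrightarrow> (\<forall>\<alpha>\<in>D. n \<alpha> \<noteq> 0 \<longrightarrow> \<not> int p dvd n \<alpha>)))"

definition nondegenerate_invariant_form ::
    "('k::field^'n^'n) set \<Rightarrow> ('k^'n^'n \<Rightarrow> 'k^'n^'n \<Rightarrow> 'k) \<Rightarrow> bool" where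
  "nondegenerate_invariant_form G \<kappa> \<longleftrightarrow>
     (\<forall>x\<in>lie_of G. \<forall>y\<in>lie_of G. \<forall>z\<in>lie_of G. \<forall>c.
        \<kappa> (x + y) z = \<kappa> x z + \<kappa> y z \<and> \<kappa> (mscale c x) z = c * \<kappa> x z \<and>
        \<kappa> z (x + y) = \<kappa> z x + \<kappa> z y \<and> \<kappa> z (mscale c x) = c * \<kappa> z x) \<and>
     (\<forall>g\<in>G. \<forall>x\<in>lie_of G. \<forall>y\<in>lie_of G. \<kappa> (Ad g x) (Ad g y) = \<kappa> x y) \<and>
     (\<forall>x\<in>lie_of G. (\<forall>y\<in>lie_of G. \<kappa> x y = 0) \<longrightarrow> x = 0) \<and>
     (\<forall>y\<in>lie_of G. (\<forall>x\<in>lie_of G. \<kappa> x y = 0) \<longrightarrow> y = 0)"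

definition standard_reductive :: "('k::alg_closed_field^'n^'n) set \<Rightarrow> bool" where
  "standard_reductive G \<longleftrightarrow>
     connected_reductive G \<and>
     group_simply_connected (derived GL G) \<and>
     good_prime (CHAR('k)) G \<and>
     (\<exists>\<kappa>. nondegenerate_invariant_form G \<kappa>)"

section \<open>Restricted Lie algebras and truncated current algebras\<close>

text \<open>The carrier is a subspace of the ambient type, whose addition is used.\<close>

record ('k, 'a) restricted_lie =
  lcarrier :: "'a set"
  lscale :: "'k \<Rightarrow> 'a \<Rightarrow> 'a"
  lbracket :: "'a \<Rightarrow> 'a \<Rightarrow> 'a"
  lpmap :: "'a \<Rightarrow> 'a"

definition lie_dual :: "('k::field, 'a::ab_group_add) restricted_lie \<Rightarrow> ('a \<Rightarrow> 'k) set" where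
  "lie_dual L = {f. \<forall>x\<in>lcarrier L. \<forall>y\<in>lcarrier L. \<forall>c.
     f (x + y) = f x + f y \<and> f (lscale L c x) = c * f x}"

definition lie_stabilizer :: "('k::field, 'a::ab_group_add) restricted_lie \<Rightarrow> ('a \<Rightarrow> 'k) \<Rightarrow> 'a set" where
  "lie_stabilizer L f = {x \<in> lcarrier L. \<forall>y\<in>lcarrier L. f (lbracket L x y) = 0}"

definition ldim :: "('k::field, 'a::ab_group_add) restricted_lie \<Rightarrow> 'a set \<Rightarrow> nat" where
  "ldim L S = vector_space.dim (lscale L) S"

text \<open>The sequence \<open>x\<close> stands for \<open>\<Sum>i\<le>m. x i t\<^sup>i\<close>. All products are computed in the
  associative algebra of matrices over \<open>k[t]/(t\<^sup>m\<^sup>+\<^sup>1)\<close>: the bracket is the commutator and the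
  \<open>p\<close>-map is the \<open>p\<close>-th power, as they are for the Lie algebra of a closed subgroup of the
  general linear group.\<close>

definition tmult :: "nat \<Rightarrow> (nat \<Rightarrow> 'k::field^'n^'n) \<Rightarrow> (nat \<Rightarrow> 'k^'n^'n) \<Rightarrow> nat \<Rightarrow> 'k^'n^'n" where
  "tmult m x y = (\<lambda>r. if r \<le> m then \<Sum>i\<le>r. x i ** y (r - i) else 0)"

definition tmonom :: "'k::field^'n^'n \<Rightarrow> nat \<Rightarrow> nat \<Rightarrow> 'k^'n^'n" where
  "tmonom X i = (\<lambda>r. if r = i then X else 0)"

definition current_lie ::
    "('k::field^'n^'n) set \<Rightarrow> nat \<Rightarrow> ('k, nat \<Rightarrow> 'k^'n^'n) restricted_lie" where
  "current_lie \<gg> m =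
     \<lparr>lcarrier = {x. (\<forall>i\<le>m. x i \<in> \<gg>) \<and> (\<forall>i>m. x i = 0)},
      lscale = (\<lambda>c x i. mscale c (x i)),
      lbracket = (\<lambda>x y. tmult m x y - tmult m y x),
      lpmap = (\<lambda>x. ((tmult m x) ^^ CHAR('k)) (tmonom (mat 1) 0))\<rparr>"

definition current_above :: "('k::field^'n^'n) set \<Rightarrow> nat \<Rightarrow> nat \<Rightarrow> (nat \<Rightarrow> 'k^'n^'n) set" where
  "current_above \<gg> m k = {x \<in> lcarrier (current_lie \<gg> m). \<forall>i\<le>k. x i = 0}"

definition current_upto :: "('k::field^'n^'n) set \<Rightarrow> nat \<Rightarrow> nat \<Rightarrow> (nat \<Rightarrow> 'k^'n^'n) set" where
  "current_upto \<gg> m k = {x \<in> lcarrier (current_lie \<gg> m). \<forall>i>k. x i = 0}"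

text \<open>The defining formulas on the elements \<open>x t\<^sup>i\<close>; the last lemma is the identification of the
  carrier for \<open>k\<close> with the part of degree at most \<open>k\<close>, which makes the restriction of a linear
  form literal.\<close>

lemma tmult_tmonom:
  fixes X :: "'k::field^'n^'n"
  shows "tmult m (tmonom X i) (tmonom Y j) = (if i + j \<le> m then tmonom (X ** Y) (i + j) else 0)"
proof
  fix r
  have "(\<Sum>a\<le>r. tmonom X i a ** tmonom Y j (r - a))
      = (\<Sum>a\<le>r. if a = i then (if r - i = j then X ** Y else 0) else 0)"
    by (rule sum.cong) (auto simp: tmonom_def)
  also have "\<dots> = (if r = i + j then X ** Y else 0)"
    by (auto simp: sum.delta)
  finally show "tmult m (tmonom X i) (tmonom Y j) r =
      (if i + j \<le> m then tmonom (X ** Y) (i + j) else 0) r"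
    by (auto simp: tmult_def tmonom_def)
qed

lemma lbracket_tmonom:
  fixes X :: "'k::field^'n^'n"
  shows "lbracket (current_lie \<gg> m) (tmonom X i) (tmonom Y j) =
    (if i + j \<le> m then tmonom (X ** Y - Y ** X) (i + j) else 0)"
proof -
  have "lbracket (current_lie \<gg> m) (tmonom X i) (tmonom Y j) =
      (if i + j \<le> m then tmonom (X ** Y) (i + j) - tmonom (Y ** X) (i + j) else 0)"
    by (simp add: current_lie_def tmult_tmonom add.commute)
  then show ?thesis
    by (auto simp: tmonom_def fun_eq_iff)
qed

lemma lpmap_tmonom:
  fixes X :: "'k::field^'n^'n"
  shows "lpmap (current_lie \<gg> m) (tmonom X i) =
    (if CHAR('k) * i \<le> m then tmonom (((**) X ^^ CHAR('k)) (mat 1)) (CHAR('k) * i) else 0)"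
proof -
  have zero: "tmult m x 0 = 0" for x :: "nat \<Rightarrow> 'k^'n^'n"
    by (rule ext) (simp add: tmult_def)
  have "((tmult m (tmonom X i)) ^^ a) (tmonom (mat 1) 0) =
      (if a * i \<le> m then tmonom (((**) X ^^ a) (mat 1)) (a * i) else 0)" for a
    by (induction a) (auto simp: tmult_tmonom zero)
  then show ?thesis
    by (simp add: current_lie_def)
qed

lemma lcarrier_current_lie_upto:
  assumes "k \<le> m" and "0 \<in> \<gg>"
  shows "lcarrier (current_lie \<gg> k) = current_upto \<gg> m k"
  using assms by (auto simp: current_lie_def current_upto_def) (metis not_le)

section \<open>Reduced enveloping algebras\<close>

definition word :: "'a list \<Rightarrow> 'a list \<Rightarrow> 'k::field" where
  "word w = (\<lambda>v. if v = w then 1 else 0)"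

definition scalar :: "'k::field \<Rightarrow> 'a list \<Rightarrow> 'k" where
  "scalar c = (\<lambda>v. if v = [] then c else 0)"

definition free_algebra :: "'a set \<Rightarrow> ('a list \<Rightarrow> 'k::field) ring" where
  "free_algebra A =
     \<lparr>carrier = {f. finite {w. f w \<noteq> 0} \<and> (\<forall>w. f w \<noteq> 0 \<longrightarrow> set w \<subseteq> A)},
      monoid.mult = (\<lambda>f g w. \<Sum>i\<le>length w. f (take i w) * g (drop i w)),
      one = word [],
      ring.zero = (\<lambda>_. 0),
      ring.add = (\<lambda>f g w. f w + g w)\<rparr>"

definition env_ideal :: "('k::field, 'a::ab_group_add) restricted_lie \<Rightarrow> ('a list \<Rightarrow> 'k) set" where
  "env_ideal L = (let T = free_algebra (lcarrier L) in
     Idl\<^bsub>T\<^esub>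
      ({word [x + y] \<ominus>\<^bsub>T\<^esub> (word [x] \<oplus>\<^bsub>T\<^esub> word [y]) | x y. x \<in> lcarrier L \<and> y \<in> lcarrier L} \<union>
       {word [lscale L c x] \<ominus>\<^bsub>T\<^esub> (scalar c \<otimes>\<^bsub>T\<^esub> word [x]) | c x. x \<in> lcarrier L} \<union>
       {(word [x] \<otimes>\<^bsub>T\<^esub> word [y] \<ominus>\<^bsub>T\<^esub> word [y] \<otimes>\<^bsub>T\<^esub> word [x]) \<ominus>\<^bsub>T\<^esub> word [lbracket L x y]
          | x y. x \<in> lcarrier L \<and> y \<in> lcarrier L}))"

definition env :: "('k::field, 'a::ab_group_add) restricted_lie \<Rightarrow> ('a list \<Rightarrow> 'k) set ring" where
  "env L = free_algebra (lcarrier L) Quot env_ideal L"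

definition env_class ::
    "('k::field, 'a::ab_group_add) restricted_lie \<Rightarrow> ('a list \<Rightarrow> 'k) \<Rightarrow> ('a list \<Rightarrow> 'k) set" where
  "env_class L f = env_ideal L +>\<^bsub>free_algebra (lcarrier L)\<^esub> f"

definition red_ideal ::
    "('k::field, 'a::ab_group_add) restricted_lie \<Rightarrow> ('a \<Rightarrow> 'k) \<Rightarrow> ('a list \<Rightarrow> 'k) set set" where
  "red_ideal L f = (let U = env L; \<iota> = (\<lambda>x. env_class L (word [x])) in
     Idl\<^bsub>U\<^esub> {(\<iota> x [^]\<^bsub>U\<^esub> CHAR('k) \<ominus>\<^bsub>U\<^esub> \<iota> (lpmap L x)) \<ominus>\<^bsub>U\<^esub> env_class L (scalar (f x ^ CHAR('k)))
             | x. x \<in> lcarrier L})"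

definition red_env ::
    "('k::field, 'a::ab_group_add) restricted_lie \<Rightarrow> ('a \<Rightarrow> 'k) \<Rightarrow> ('a list \<Rightarrow> 'k) set set ring" where
  "red_env L f = env L Quot red_ideal L f"

definition red_class ::
    "('k::field, 'a::ab_group_add) restricted_lie \<Rightarrow> ('a \<Rightarrow> 'k) \<Rightarrow> ('a list \<Rightarrow> 'k) \<Rightarrow>
       ('a list \<Rightarrow> 'k) set set" where
  "red_class L f u = red_ideal L f +>\<^bsub>env L\<^esub> env_class L u"

definition red_incl ::
    "('k::field, 'a::ab_group_add) restricted_lie \<Rightarrow> ('a \<Rightarrow> 'k) \<Rightarrow> 'a \<Rightarrow> ('a list \<Rightarrow> 'k) set set" where
  "red_incl L f x = red_class L f (word [x])"

definition red_scalar ::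
    "('k::field, 'a::ab_group_add) restricted_lie \<Rightarrow> ('a \<Rightarrow> 'k) \<Rightarrow> 'k \<Rightarrow> ('a list \<Rightarrow> 'k) set set" where
  "red_scalar L f c = red_class L f (scalar c)"

section \<open>Modules over a noncommutative ring\<close>

text \<open>The library locale \<open>module\<close> requires a commutative ring; only its record type is used here.\<close>

locale left_module = R?: ring R + M?: abelian_group M
  for R :: "('r, 'x) ring_scheme" (structure) and M :: "('r, 'v) module" (structure) +
  assumes lm_closed: "\<lbrakk>a \<in> carrier R; x \<in> carrier M\<rbrakk> \<Longrightarrow> a \<odot>\<^bsub>M\<^esub> x \<in> carrier M"
    and lm_add_left: "\<lbrakk>a \<in> carrier R; b \<in> carrier R; x \<in> carrier M\<rbrakk> \<Longrightarrow>
          (a \<oplus>\<^bsub>R\<^esub> b) \<odot>\<^bsub>M\<^esub> x = a \<odot>\<^bsub>M\<^esub> x \<oplus>\<^bsub>M\<^esub> b \<odot>\<^bsub>M\<^esub> x"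
    and lm_add_right: "\<lbrakk>a \<in> carrier R; x \<in> carrier M; y \<in> carrier M\<rbrakk> \<Longrightarrow>
          a \<odot>\<^bsub>M\<^esub> (x \<oplus>\<^bsub>M\<^esub> y) = a \<odot>\<^bsub>M\<^esub> x \<oplus>\<^bsub>M\<^esub> a \<odot>\<^bsub>M\<^esub> y"
    and lm_mult: "\<lbrakk>a \<in> carrier R; b \<in> carrier R; x \<in> carrier M\<rbrakk> \<Longrightarrow>
          (a \<otimes>\<^bsub>R\<^esub> b) \<odot>\<^bsub>M\<^esub> x = a \<odot>\<^bsub>M\<^esub> (b \<odot>\<^bsub>M\<^esub> x)"
    and lm_one: "x \<in> carrier M \<Longrightarrow> \<one>\<^bsub>R\<^esub> \<odot>\<^bsub>M\<^esub> x = x"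

definition simple_left_module :: "'r ring \<Rightarrow> ('r, 'v) module \<Rightarrow> bool" where
  "simple_left_module R M \<longleftrightarrow> left_module R M \<and> carrier M \<noteq> {\<zero>\<^bsub>M\<^esub>} \<and>
     (\<forall>N. submodule N R M \<longrightarrow> N = {\<zero>\<^bsub>M\<^esub>} \<or> N = carrier M)"

text \<open>Here \<open>\<iota>\<close> is the structure map of an algebra over the field of scalars.\<close>

definition finite_dim_module :: "('k \<Rightarrow> 'r) \<Rightarrow> ('r, 'v) module \<Rightarrow> bool" where
  "finite_dim_module \<iota> M \<longleftrightarrow> (\<exists>B. finite B \<and> B \<subseteq> carrier M \<and>
     (\<forall>v\<in>carrier M. \<exists>c. v = finsum M (\<lambda>b. \<iota> (c b) \<odot>\<^bsub>M\<^esub> b) B))"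

definition left_module_homs :: "'r ring \<Rightarrow> ('r, 'v) module \<Rightarrow> ('r, 'v) module \<Rightarrow> ('v \<Rightarrow> 'v) set" where
  "left_module_homs R M N = {h \<in> carrier M \<rightarrow>\<^sub>E carrier N.
     (\<forall>x\<in>carrier M. \<forall>y\<in>carrier M. h (x \<oplus>\<^bsub>M\<^esub> y) = h x \<oplus>\<^bsub>N\<^esub> h y) \<and>
     (\<forall>a\<in>carrier R. \<forall>x\<in>carrier M. h (a \<odot>\<^bsub>M\<^esub> x) = a \<odot>\<^bsub>N\<^esub> h x)}"

section \<open>Categories\<close>

text \<open>Hom-sets of different pairs of objects may overlap, so composition takes the three objects
  as arguments: \<open>cat_comp C a b c g f\<close> is \<open>g \<circ> f\<close> for \<open>f: a \<rightarrow> b\<close> and \<open>g: b \<rightarrow> c\<close>.\<close>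

record ('o, 'm) category =
  obj :: "'o set"
  hom_set :: "'o \<Rightarrow> 'o \<Rightarrow> 'm set"
  ident :: "'o \<Rightarrow> 'm"
  cat_comp :: "'o \<Rightarrow> 'o \<Rightarrow> 'o \<Rightarrow> 'm \<Rightarrow> 'm \<Rightarrow> 'm"

definition full_subcategory :: "('o, 'm) category \<Rightarrow> 'o set \<Rightarrow> ('o, 'm) category" where
  "full_subcategory C S = C\<lparr>obj := obj C \<inter> S\<rparr>"

record ('o, 'm, 'p, 'q) cat_functor =
  on_obj :: "'o \<Rightarrow> 'p"
  on_hom :: "'o \<Rightarrow> 'o \<Rightarrow> 'm \<Rightarrow> 'q"

definition is_functor ::
    "('o, 'm) category \<Rightarrow> ('p, 'q) category \<Rightarrow> ('o, 'm, 'p, 'q) cat_functor \<Rightarrow> bool" where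
  "is_functor C D F \<longleftrightarrow>
     (\<forall>a\<in>obj C. on_obj F a \<in> obj D \<and> on_hom F a a (ident C a) = ident D (on_obj F a)) \<and>
     (\<forall>a\<in>obj C. \<forall>b\<in>obj C. \<forall>f\<in>hom_set C a b.
        on_hom F a b f \<in> hom_set D (on_obj F a) (on_obj F b)) \<and>
     (\<forall>a\<in>obj C. \<forall>b\<in>obj C. \<forall>c\<in>obj C. \<forall>f\<in>hom_set C a b. \<forall>g\<in>hom_set C b c.
        on_hom F a c (cat_comp C a b c g f) =
          cat_comp D (on_obj F a) (on_obj F b) (on_obj F c) (on_hom F b c g) (on_hom F a b f))"

definition id_functor :: "('o, 'm, 'o, 'm) cat_functor" where
  "id_functor = \<lparr>on_obj = (\<lambda>a. a), on_hom = (\<lambda>a b f. f)\<rparr>"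

definition comp_functor ::
    "('p, 'q, 'r, 's) cat_functor \<Rightarrow> ('o, 'm, 'p, 'q) cat_functor \<Rightarrow> ('o, 'm, 'r, 's) cat_functor" where
  "comp_functor F E =
     \<lparr>on_obj = (\<lambda>a. on_obj F (on_obj E a)),
      on_hom = (\<lambda>a b f. on_hom F (on_obj E a) (on_obj E b) (on_hom E a b f))\<rparr>"

definition isomorphism :: "('o, 'm) category \<Rightarrow> 'o \<Rightarrow> 'o \<Rightarrow> 'm \<Rightarrow> bool" where
  "isomorphism C a b f \<longleftrightarrow> f \<in> hom_set C a b \<and>
     (\<exists>g\<in>hom_set C b a. cat_comp C a b a g f = ident C a \<and> cat_comp C b a b f g = ident C b)"

definition naturally_isomorphic ::
    "('o, 'm) category \<Rightarrow> ('p, 'q) category \<Rightarrow> ('o, 'm, 'p, 'q) cat_functor \<Rightarrow>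
       ('o, 'm, 'p, 'q) cat_functor \<Rightarrow> bool" where
  "naturally_isomorphic C D E F \<longleftrightarrow> (\<exists>\<eta>.
     (\<forall>a\<in>obj C. isomorphism D (on_obj E a) (on_obj F a) (\<eta> a)) \<and>
     (\<forall>a\<in>obj C. \<forall>b\<in>obj C. \<forall>f\<in>hom_set C a b.
        cat_comp D (on_obj E a) (on_obj E b) (on_obj F b) (\<eta> b) (on_hom E a b f) =
        cat_comp D (on_obj E a) (on_obj F a) (on_obj F b) (on_hom F a b f) (\<eta> a)))"

definition equivalent_categories :: "('o, 'm) category \<Rightarrow> ('p, 'q) category \<Rightarrow> bool" where
  "equivalent_categories C D \<longleftrightarrow> (\<exists>F E. is_functor C D F \<and> is_functor D C E \<and>
     naturally_isomorphic C C (comp_functor E F) id_functor \<and>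
     naturally_isomorphic D D (comp_functor F E) id_functor)"

text \<open>Finite-dimensional modules over the reduced enveloping algebra whose underlying set is a
  subset of the type \<open>'v\<close>.\<close>

definition red_mod ::
    "'v itself \<Rightarrow> ('k::field, 'a::ab_group_add) restricted_lie \<Rightarrow> ('a \<Rightarrow> 'k) \<Rightarrow>
       ((('a list \<Rightarrow> 'k) set set, 'v) module, 'v \<Rightarrow> 'v) category" where
  "red_mod _ L f =
     \<lparr>obj = {M. left_module (red_env L f) M \<and> finite_dim_module (red_scalar L f) M},
      hom_set = left_module_homs (red_env L f),
      ident = (\<lambda>M. \<lambda>x\<in>carrier M. x),
      cat_comp = (\<lambda>M N P g h. compose (carrier M) g h)\<rparr>"

definition annihilated_by ::
    "('k::field, 'a::ab_group_add) restricted_lie \<Rightarrow> ('a \<Rightarrow> 'k) \<Rightarrow> 'a set \<Rightarrow>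
       (('a list \<Rightarrow> 'k) set set, 'v) module set" where
  "annihilated_by L f S = {M. \<forall>x\<in>S. \<forall>v\<in>carrier M. red_incl L f x \<odot>\<^bsub>M\<^esub> v = \<zero>\<^bsub>M\<^esub>}"

end

theory Submission
  imports Defs
begin

text \<open>
  Write \<open>g\<close> for the Lie algebra of \<open>G\<close>, \<open>g\<^sub>m\<close> for its truncated current algebra and \<open>n\<close> for the part of
  \<open>g\<^sub>m\<close> of degree above \<open>k\<close>. Truncation in degree \<open>k\<close> is a surjective homomorphism of restricted Lie
  algebras \<open>g\<^sub>m \<rightarrow> g\<^sub>k\<close> with kernel \<open>n\<close>, and since \<open>\<chi>\<close> vanishes on \<open>n\<close> it is the pullback of \<open>\<psi>\<close>.

  The equivalence. Truncation of letters maps the relations of \<open>U\<^sub>\<chi>(g\<^sub>m)\<close> to those of \<open>U\<^sub>\<psi>(g\<^sub>k)\<close> and so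
  induces a surjection \<open>\<phi>\<close> between these algebras. On a module killed by \<open>n\<close> a letter and its truncation
  act in the same way, hence the relations of \<open>U\<^sub>\<psi>(g\<^sub>k)\<close> hold there and the whole kernel of \<open>\<phi>\<close> acts by
  zero (\<open>kernel_annihilates\<close>). Modules over the target of a surjective ring homomorphism are the same as
  modules over its source that are killed by its kernel (\<open>inflation_equivalence\<close>).

  Simple modules. Suppose that the part of degree above \<open>j + 1\<close> acts by zero on a simple module, where
  \<open>j \<ge> k\<close>. Brackets and \<open>p\<close>-th powers of elements of degree above \<open>j\<close> have degree above \<open>j + 1\<close>, and \<open>\<chi>\<close>
  vanishes on these elements, so they act by commuting nilpotent operators. Their common kernel is nonzero,
  and it is a submodule because they form an ideal; so the part of degree above \<open>j\<close> acts by zero too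
  (\<open>simple_killed_step\<close>). Descending from \<open>j = m\<close> to \<open>j = k\<close> shows that \<open>n\<close> acts by zero. A simple module is
  generated by one vector, and it is finite-dimensional because long words in a finite spanning set of the
  Lie algebra can be shortened: some letter occurs \<open>p\<close> times, the letter can be gathered at the cost of shorter
  words, and its \<open>p\<close>-th power is a letter plus a scalar (\<open>bounded_words_suffice\<close>).

  The dimension formula. The form \<open>\<chi>([x, y])\<close> depends only on the truncations of \<open>x\<close> and \<open>y\<close>, so \<open>g\<^sub>m\<close> and
  the stabilizer of \<open>\<chi>\<close> are the preimages of \<open>g\<^sub>k\<close> and of the stabilizer of \<open>\<psi>\<close>, and both dimensions exceed
  their counterparts by \<open>dim n\<close>.

  All this presupposes that \<open>g\<^sub>m\<close> is closed under brackets and \<open>p\<close>-th powers. The tangent space of \<open>G\<close> at the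
  identity consists of the matrices \<open>X\<close> whose left-invariant derivation preserves the ideal of \<open>G\<close>;
  commutators and, in characteristic \<open>p\<close>, \<open>p\<close>-th powers of derivations are derivations, which makes \<open>g\<close>
  closed. For \<open>x(t)\<close> in \<open>g\<^sub>m\<close> the matrix \<open>x(t)\<^sup>p\<close> lies in \<open>g\<close> for every scalar \<open>t\<close>, and over an infinite field
  this forces the coefficients of \<open>x(t)\<^sup>p\<close> to lie in \<open>g\<close>.
\<close>

section \<open>Polynomial functions and left-invariant derivations\<close>

text \<open>Over a finite field, \<open>\<Prod>a. (X - a)\<close> plus \<open>1\<close> would have no root.\<close>

lemma infinite_alg_closed_field: "infinite (UNIV :: 'a::alg_closed_field set)"
proof
  assume fin: "finite (UNIV :: 'a set)"
  define p where "p = (\<Prod>a\<in>(UNIV::'a set). [:- a, 1:]) + 1"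
  have deg: "degree (\<Prod>a\<in>(UNIV::'a set). [:- a, 1:]) = card (UNIV :: 'a set)"
    by (subst degree_prod_eq_sum_degree) auto
  have "card (UNIV :: 'a set) > 0" using fin by (simp add: card_gt_0_iff)
  then have "degree p > 0"
    unfolding p_def by (subst degree_add_eq_left) (auto simp: deg)
  then obtain x where "poly p x = 0" using alg_closed_imp_poly_has_root by blast
  moreover have "poly (\<Prod>a\<in>(UNIV::'a set). [:- a, 1:]) x = 0"
    using fin by (simp add: poly_prod prod_zero_iff)
  ultimately show False by (simp add: p_def)
qed

lemma poly_fun_inject:
  fixes p q :: "'a::alg_closed_field poly"
  assumes "\<And>s. poly p s = poly q s"
  shows "p = q"
proof (rule ccontr)
  assume "p \<noteq> q"
  then have "finite {s. poly (p - q) s = 0}" by (intro poly_roots_finite) simp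
  moreover have "{s. poly (p - q) s = 0} = UNIV" using assms by auto
  ultimately show False using infinite_alg_closed_field[where 'a='a] by simp
qed

lemma polyfun_on_line:
  fixes f :: "'k::field^'n^'n \<Rightarrow> 'k"
  assumes "f \<in> polyfuns"
  shows "\<exists>q. \<forall>s. f (A + mscale s B) = poly q s"
  using assms
proof induction
  case (const c)
  then show ?case by (intro exI[of _ "[:c:]"]) simp
next
  case (entry i j)
  then show ?case by (intro exI[of _ "[:A $ i $ j, B $ i $ j:]"]) (simp add: mscale_def)
next
  case (add f g)
  then obtain q r where "\<forall>s. f (A + mscale s B) = poly q s" "\<forall>s. g (A + mscale s B) = poly r s" by blast
  then show ?case by (intro exI[of _ "q + r"]) simp
next
  case (mult f g)
  then obtain q r where "\<forall>s. f (A + mscale s B) = poly q s" "\<forall>s. g (A + mscale s B) = poly r s" by blast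
  then show ?case by (intro exI[of _ "q * r"]) simp
qed

text \<open>The linear coefficient of \<open>f\<close> along the line through \<open>A\<close> in direction \<open>B\<close>. The choice is unique over an
  infinite field.\<close>

definition dir_deriv :: "('k::field^'n^'n \<Rightarrow> 'k) \<Rightarrow> 'k^'n^'n \<Rightarrow> 'k^'n^'n \<Rightarrow> 'k" where
  "dir_deriv f A B = coeff (SOME q. \<forall>s. f (A + mscale s B) = poly q s) 1"

lemma dir_deriv_eq:
  fixes f :: "'k::alg_closed_field^'n^'n \<Rightarrow> 'k"
  assumes "\<And>s. f (A + mscale s B) = poly q s"
  shows "dir_deriv f A B = coeff q 1"
proof -
  have "\<forall>s. f (A + mscale s B) = poly (SOME q. \<forall>s. f (A + mscale s B) = poly q s) s"
    by (rule someI[where x = q]) (use assms in simp)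
  then have "(SOME q. \<forall>s. f (A + mscale s B) = poly q s) = q"
    using assms by (intro poly_fun_inject) metis
  then show ?thesis by (simp add: dir_deriv_def)
qed

lemma mscale_zero [simp]: "mscale 0 A = 0" and mscale_one [simp]: "mscale 1 A = A"
  by (simp_all add: mscale_def vec_eq_iff)

lemma dir_deriv_const [simp]: "dir_deriv (\<lambda>_. c :: 'k::alg_closed_field) A B = 0"
  by (subst dir_deriv_eq[where q = "[:c:]"]) auto

lemma dir_deriv_entry [simp]:
  "dir_deriv (\<lambda>A. A $ i $ j) A B = (B $ i $ j :: 'k::alg_closed_field)"
  by (subst dir_deriv_eq[where q = "[:A $ i $ j, B $ i $ j:]"]) (auto simp: mscale_def)

lemma dir_deriv_add:
  fixes f g :: "'k::alg_closed_field^'n^'n \<Rightarrow> 'k"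
  assumes "f \<in> polyfuns" "g \<in> polyfuns"
  shows "dir_deriv (\<lambda>A. f A + g A) A B = dir_deriv f A B + dir_deriv g A B"
proof -
  obtain q r where q: "\<And>s. f (A + mscale s B) = poly q s" and r: "\<And>s. g (A + mscale s B) = poly r s"
    using assms polyfun_on_line by metis
  have "dir_deriv (\<lambda>A. f A + g A) A B = coeff (q + r) 1" by (rule dir_deriv_eq) (simp add: q r)
  then show ?thesis using dir_deriv_eq[OF q] dir_deriv_eq[OF r] by simp
qed

lemma dir_deriv_mult:
  fixes f g :: "'k::alg_closed_field^'n^'n \<Rightarrow> 'k"
  assumes "f \<in> polyfuns" "g \<in> polyfuns"
  shows "dir_deriv (\<lambda>A. f A * g A) A B = dir_deriv f A B * g A + f A * dir_deriv g A B"
proof -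
  obtain q r where q: "\<And>s. f (A + mscale s B) = poly q s" and r: "\<And>s. g (A + mscale s B) = poly r s"
    using assms polyfun_on_line by metis
  have "dir_deriv (\<lambda>A. f A * g A) A B = coeff (q * r) 1" by (rule dir_deriv_eq) (simp add: q r)
  moreover have "coeff q 0 = f A" "coeff r 0 = g A" using q[of 0] r[of 0] by (simp_all add: poly_0_coeff_0)
  ultimately show ?thesis using dir_deriv_eq[OF q] dir_deriv_eq[OF r] by (simp add: coeff_mult)
qed

lemma polyfuns_sum:
  assumes "finite I" "\<And>i. i \<in> I \<Longrightarrow> f i \<in> polyfuns"
  shows "(\<lambda>A. \<Sum>i\<in>I. f i A) \<in> polyfuns"
  using assms by (induction I rule: finite_induct) (auto intro: polyfuns.intros)

lemma polyfuns_lmult: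
  assumes "f \<in> polyfuns"
  shows "(\<lambda>A. f (B ** A)) \<in> polyfuns"
  using assms
proof induction
  case (entry i j)
  show ?case unfolding matrix_matrix_mult_def
    by (auto intro!: polyfuns_sum polyfuns.intros)
qed (auto intro: polyfuns.intros)

definition derivation :: "(('k::field^'n^'n \<Rightarrow> 'k) \<Rightarrow> ('k^'n^'n \<Rightarrow> 'k)) \<Rightarrow> bool" where
  "derivation D \<longleftrightarrow> (\<forall>f\<in>polyfuns. D f \<in> polyfuns) \<and> (\<forall>c. D (\<lambda>_. c) = (\<lambda>_. 0)) \<and>
     (\<forall>f\<in>polyfuns. \<forall>g\<in>polyfuns. D (\<lambda>A. f A + g A) = (\<lambda>A. D f A + D g A)) \<and>
     (\<forall>f\<in>polyfuns. \<forall>g\<in>polyfuns. D (\<lambda>A. f A * g A) = (\<lambda>A. D f A * g A + f A * D g A))"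

text \<open>The left-invariant vector field on the space of matrices whose value at the identity is \<open>X\<close>.\<close>

definition inv_deriv :: "'k::field^'n^'n \<Rightarrow> ('k^'n^'n \<Rightarrow> 'k) \<Rightarrow> ('k^'n^'n \<Rightarrow> 'k)" where
  "inv_deriv X f = (\<lambda>A. dir_deriv f A (A ** X))"

text \<open>A derivation is determined by its symbol, because the coordinates generate the polynomial functions.\<close>

definition symbol :: "(('k::field^'n^'n \<Rightarrow> 'k) \<Rightarrow> ('k^'n^'n \<Rightarrow> 'k)) \<Rightarrow> 'k^'n^'n \<Rightarrow> bool" where
  "symbol D X \<longleftrightarrow> (\<forall>i j. D (\<lambda>A. A $ i $ j) = (\<lambda>A. (A ** X) $ i $ j))"

lemma derivationD:
  assumes "derivation D"
  shows "f \<in> polyfuns \<Longrightarrow> D f \<in> polyfuns" "D (\<lambda>_. c) = (\<lambda>_. 0)"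
    "f \<in> polyfuns \<Longrightarrow> g \<in> polyfuns \<Longrightarrow> D (\<lambda>A. f A + g A) = (\<lambda>A. D f A + D g A)"
    "f \<in> polyfuns \<Longrightarrow> g \<in> polyfuns \<Longrightarrow> D (\<lambda>A. f A * g A) = (\<lambda>A. D f A * g A + f A * D g A)"
  using assms unfolding derivation_def by blast+

lemma derivation_inv_deriv:
  fixes X :: "'k::alg_closed_field^'n^'n"
  shows "derivation (inv_deriv X)"
proof -
  have "inv_deriv X f \<in> polyfuns" if "f \<in> polyfuns" for f
    using that
  proof induction
    case (entry i j)
    show ?case unfolding inv_deriv_def
      by (auto simp: matrix_matrix_mult_def intro!: polyfuns_sum polyfuns.intros)
  qed (auto simp: inv_deriv_def dir_deriv_add dir_deriv_mult intro: polyfuns.intros)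
  then show ?thesis
    by (auto simp: derivation_def inv_deriv_def dir_deriv_add dir_deriv_mult)
qed

lemma symbol_inv_deriv: "symbol (inv_deriv X) (X :: 'k::alg_closed_field^'n^'n)"
  by (simp add: symbol_def inv_deriv_def)

lemma derivation_eqI:
  assumes "derivation D" "derivation D'" "symbol D X" "symbol D' X" "f \<in> polyfuns"
  shows "D f = D' f"
  using assms(5)
proof induction
  case (entry i j)
  then show ?case using assms(3,4) by (simp add: symbol_def)
qed (use assms(1,2) in \<open>simp_all add: derivationD[OF assms(1)] derivationD[OF assms(2)]\<close>)

lemma derivation_sum:
  assumes "derivation D" "finite I" "\<And>i. i \<in> I \<Longrightarrow> f i \<in> polyfuns"
  shows "D (\<lambda>A. \<Sum>i\<in>I. f i A) = (\<lambda>A. \<Sum>i\<in>I. D (f i) A)"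
  using assms(2,3)
proof (induction I rule: finite_induct)
  case (insert x F)
  have "D (\<lambda>A. f x A + (\<Sum>i\<in>F. f i A)) = (\<lambda>A. D (f x) A + D (\<lambda>A. \<Sum>i\<in>F. f i A) A)"
    using insert by (intro derivationD[OF assms(1)]) (auto intro: polyfuns_sum)
  then show ?case using insert by simp
qed (simp add: derivationD[OF assms(1)])

lemma derivation_cmult:
  assumes "derivation D" "f \<in> polyfuns"
  shows "D (\<lambda>A. c * f A) = (\<lambda>A. c * D f A)"
  using derivationD(4)[OF assms(1) polyfuns.const assms(2)] by (simp add: derivationD(2)[OF assms(1)])

text \<open>The coordinates of \<open>A ** Y\<close> are constant linear combinations of those of \<open>A\<close>. Consequently symbols are
  multiplied when derivations are composed.\<close>

lemma symbol_row:
  assumes "derivation D" "symbol D X"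
  shows "D (\<lambda>A. (A ** Y) $ i $ j) = (\<lambda>A. (A ** (X ** Y)) $ i $ j)"
proof -
  have "D (\<lambda>A. (A ** Y) $ i $ j) = D (\<lambda>A. \<Sum>l\<in>UNIV. Y $ l $ j * A $ i $ l)"
    by (simp add: matrix_matrix_mult_def mult.commute)
  also have "\<dots> = (\<lambda>A. \<Sum>l\<in>UNIV. D (\<lambda>A. Y $ l $ j * A $ i $ l) A)"
    by (rule derivation_sum[OF assms(1)]) (auto intro: polyfuns.intros)
  also have "\<dots> = (\<lambda>A. \<Sum>l\<in>UNIV. Y $ l $ j * (A ** X) $ i $ l)"
    using assms(2) by (simp add: derivation_cmult[OF assms(1) polyfuns.entry] symbol_def)
  also have "\<dots> = (\<lambda>A. ((A ** X) ** Y) $ i $ j)"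
    by (simp add: matrix_matrix_mult_def[of _ Y] mult.commute)
  finally show ?thesis by (simp add: matrix_mul_assoc)
qed

lemma symbol_comp:
  assumes "derivation D" "symbol D X" "symbol E Y"
  shows "D (E (\<lambda>A. A $ i $ j)) = (\<lambda>A. (A ** (X ** Y)) $ i $ j)"
  using assms symbol_row[OF assms(1,2)] by (simp add: symbol_def)

lemma derivation_commutator:
  assumes D: "derivation D" and E: "derivation E"
  shows "derivation (\<lambda>f A. D (E f) A - E (D f) A)"
proof -
  have m: "(\<lambda>A. f A - g A) \<in> polyfuns" if "f \<in> polyfuns" "g \<in> polyfuns" for f g :: "'a^'b^'b \<Rightarrow> 'a"
    using polyfuns.add[OF that(1) polyfuns.mult[OF polyfuns.const[of "-1"] that(2)]] by simp
  note s = derivationD[OF D] derivationD[OF E] polyfuns.intros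
  show ?thesis
    unfolding derivation_def
    by (auto simp: s m fun_eq_iff algebra_simps)
qed

lemma funpow_polyfuns: "derivation D \<Longrightarrow> f \<in> polyfuns \<Longrightarrow> (D ^^ a) f \<in> polyfuns"
  by (induction a) (auto intro: derivationD(1))

lemma leibniz:
  assumes D: "derivation D" and f: "f \<in> polyfuns" and g: "g \<in> polyfuns"
  shows "(D ^^ a) (\<lambda>A. f A * g A) =
    (\<lambda>A. \<Sum>i\<le>a. of_nat (a choose i) * ((D ^^ i) f A * (D ^^ (a - i)) g A))"
proof (induction a)
  case (Suc a)
  note p = funpow_polyfuns[OF D]
  define t where "t i j = (\<lambda>A. (D ^^ i) f A * (D ^^ j) g A)" for i j
  have tp: "t i j \<in> polyfuns" for i j unfolding t_def using p f g by (auto intro: polyfuns.intros)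
  have Dt: "D (t i j) = (\<lambda>A. t (Suc i) j A + t i (Suc j) A)" for i j
    unfolding t_def using p f g by (simp add: derivationD[OF D])
  have "(D ^^ Suc a) (\<lambda>A. f A * g A) = D (\<lambda>A. \<Sum>i\<le>a. of_nat (a choose i) * t i (a - i) A)"
    using Suc by (simp add: t_def)
  also have "\<dots> = (\<lambda>A. \<Sum>i\<le>a. of_nat (a choose i) * (t (Suc i) (a - i) A + t i (Suc (a - i)) A))"
    by (subst derivation_sum[OF D]) (auto simp: derivation_cmult[OF D tp] Dt intro: polyfuns.intros tp)
  also have "\<dots> = (\<lambda>A. \<Sum>i\<le>Suc a. of_nat (Suc a choose i) * t i (Suc a - i) A)"
  proof
    fix A
    have "(\<Sum>i\<le>Suc a. of_nat (Suc a choose i) * t i (Suc a - i) A)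
       = t 0 (Suc a) A + (\<Sum>i\<le>a. of_nat (Suc a choose Suc i) * t (Suc i) (a - i) A)"
      by (subst sum.atMost_Suc_shift) simp
    also have "\<dots> = t 0 (Suc a) A + (\<Sum>i\<le>a. of_nat (a choose Suc i) * t (Suc i) (a - i) A)
         + (\<Sum>i\<le>a. of_nat (a choose i) * t (Suc i) (a - i) A)"
      by (simp add: sum.distrib algebra_simps)
    also have "t 0 (Suc a) A + (\<Sum>i\<le>a. of_nat (a choose Suc i) * t (Suc i) (a - i) A)
         = (\<Sum>i\<le>Suc a. of_nat (a choose i) * t i (Suc a - i) A)"
      by (subst sum.atMost_Suc_shift) simp
    also have "\<dots> = (\<Sum>i\<le>a. of_nat (a choose i) * t i (Suc (a - i)) A)"
      by (simp add: binomial_eq_0 Suc_diff_le)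
    finally show "(\<Sum>i\<le>a. of_nat (a choose i) * (t (Suc i) (a - i) A + t i (Suc (a - i)) A))
       = (\<Sum>i\<le>Suc a. of_nat (Suc a choose i) * t i (Suc a - i) A)"
      by (simp add: sum.distrib algebra_simps)
  qed
  finally show ?case by (simp add: t_def)
qed simp

text \<open>In characteristic \<open>p\<close> all mixed terms of the Leibniz formula for \<open>D\<^sup>p\<close> carry a binomial coefficient
  divisible by \<open>p\<close>.\<close>

lemma derivation_funpow_CHAR:
  assumes "CHAR('k::field) > 0" and D: "derivation (D :: ('k^'n^'n \<Rightarrow> 'k) \<Rightarrow> _)"
  shows "derivation (D ^^ CHAR('k))"
proof -
  define p where "p = CHAR('k)"
  have pr: "prime p" unfolding p_def using assms(1) prime_CHAR_semidom by blast
  then obtain p' where p': "p = Suc p'" by (metis not0_implies_Suc not_prime_0)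
  have c: "(D ^^ Suc a) (\<lambda>_. c) = (\<lambda>_. 0)" for a c
    by (induction a) (auto simp: derivationD[OF D])
  have add: "(D ^^ a) (\<lambda>A. f A + g A) = (\<lambda>A. (D ^^ a) f A + (D ^^ a) g A)"
    if "f \<in> polyfuns" "g \<in> polyfuns" for f g a
    by (induction a) (auto simp: derivationD[OF D] funpow_polyfuns[OF D] that)
  have "(D ^^ p) (\<lambda>A. f A * g A) = (\<lambda>A. (D ^^ p) f A * g A + f A * (D ^^ p) g A)"
    if "f \<in> polyfuns" "g \<in> polyfuns" for f g
  proof -
    have z: "(of_nat (p choose i) :: 'k) = 0" if "i \<in> {..p} - {0, p}" for i
      using that dvd_choose_prime[of i p] pr unfolding p_def by (auto simp: of_nat_eq_0_iff_char_dvd)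
    have "(\<Sum>i\<le>p. of_nat (p choose i) * ((D ^^ i) f A * (D ^^ (p - i)) g A))
       = (\<Sum>i\<in>{0, p}. of_nat (p choose i) * ((D ^^ i) f A * (D ^^ (p - i)) g A))" for A
      using z by (intro sum.mono_neutral_right) auto
    then show ?thesis unfolding leibniz[OF D that] using p' by (auto simp: add.commute)
  qed
  with add c show ?thesis
    unfolding derivation_def p_def[symmetric] using p' funpow_polyfuns[OF D] by (simp del: funpow.simps)
qed

lemma symbol_funpow:
  assumes "derivation D" "symbol D X"
  shows "symbol (D ^^ a) (((**) X ^^ a) (mat 1))"
proof -
  have "(D ^^ a) (\<lambda>A. A $ i $ j) = (\<lambda>A. (A ** ((**) X ^^ a) (mat 1)) $ i $ j)" for i j
    by (induction a) (auto simp: symbol_row[OF assms(1,2)])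
  then show ?thesis by (simp add: symbol_def)
qed

section \<open>The Lie algebra of a closed subgroup\<close>

lemma mat_one_in_subgroup: "subgroup G GL \<Longrightarrow> mat 1 \<in> G"
  using subgroup.one_closed[of G GL] by (simp add: GL_def)

lemma mult_in_subgroup: "subgroup G GL \<Longrightarrow> A \<in> G \<Longrightarrow> B \<in> G \<Longrightarrow> A ** B \<in> G"
  using subgroup.m_closed[of G GL A B] by (simp add: GL_def)

lemma matrix_mult_mscale [simp]: "A ** mscale s X = mscale s (A ** X)" "mscale s A ** X = mscale s (A ** X)"
  by (simp_all add: mscale_def matrix_matrix_mult_def vec_eq_iff sum_distrib_left mult_ac)

lemma matrix_diff_ldistrib: "A ** (B - C) = A ** B - A ** (C :: 'a::ring_1^'n^'m)"
  by (simp_all add: matrix_matrix_mult_def vec_eq_iff sum_subtractf algebra_simps)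

text \<open>Left translation by \<open>g\<close> preserves the ideal of \<open>G\<close>, so tangency at the identity gives tangency at \<open>g\<close>.\<close>

lemma inv_deriv_vanishes:
  fixes G :: "('k::alg_closed_field^'n^'n) set"
  assumes G: "subgroup G GL" and X: "X \<in> lie_of G"
    and f: "f \<in> polyfuns" "\<And>A. A \<in> G \<Longrightarrow> f A = 0" and g: "g \<in> G"
  shows "inv_deriv X f g = 0"
proof -
  have "\<exists>q. (\<forall>s. f (g ** (mat 1 + mscale s X)) = poly q s) \<and> coeff q 1 = 0"
    using X[unfolded lie_of_def, THEN CollectD, rule_format, of "\<lambda>A. f (g ** A)"]
      polyfuns_lmult[OF f(1)] f(2) mult_in_subgroup[OF G g] by simp
  then obtain q where "\<And>s. f (g ** (mat 1 + mscale s X)) = poly q s" "coeff q 1 = 0"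
    by blast
  then show ?thesis
    using dir_deriv_eq[of f g "g ** X" q] by (simp add: inv_deriv_def matrix_add_ldistrib)
qed

text \<open>Evaluating at the identity a derivation that preserves the ideal of \<open>G\<close> gives a tangent vector. Together with
  the previous lemma this reduces the closure properties of the tangent space to operations on derivations.\<close>

lemma lie_of_memI:
  fixes G :: "('k::alg_closed_field^'n^'n) set"
  assumes G: "subgroup G GL" and D: "derivation D" "symbol D Z"
    and van: "\<And>f A. f \<in> polyfuns \<Longrightarrow> (\<And>A. A \<in> G \<Longrightarrow> f A = 0) \<Longrightarrow> A \<in> G \<Longrightarrow> D f A = 0"
  shows "Z \<in> lie_of G"
  unfolding lie_of_def
proof (intro CollectI ballI impI)
  fix f assume f: "f \<in> polyfuns" "\<forall>A\<in>G. f A = 0"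
  obtain q where q: "\<And>s. f (mat 1 + mscale s Z) = poly q s" using polyfun_on_line f(1) by metis
  have "coeff q 1 = inv_deriv Z f (mat 1)" using dir_deriv_eq[OF q] by (simp add: inv_deriv_def)
  also have "\<dots> = D f (mat 1)"
    using derivation_eqI[OF derivation_inv_deriv D(1) symbol_inv_deriv D(2) f(1)] by simp
  also have "\<dots> = 0" using van[OF f(1)] f(2) mat_one_in_subgroup[OF G] by blast
  finally show "\<exists>q. (\<forall>s. f (mat 1 + mscale s Z) = poly q s) \<and> coeff q 1 = 0" using q by blast
qed

text \<open>Sums, multiples, commutators and \<open>p\<close>-th powers of left-invariant derivations are derivations with symbols
  \<open>X + Y\<close>, \<open>c X\<close>, \<open>X Y - Y X\<close> and \<open>X\<^sup>p\<close>.\<close>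

lemma
  fixes G :: "('k::alg_closed_field^'n^'n) set"
  assumes G: "subgroup G GL"
  shows lie_of_add: "X \<in> lie_of G \<Longrightarrow> Y \<in> lie_of G \<Longrightarrow> X + Y \<in> lie_of G"
    and lie_of_scale: "X \<in> lie_of G \<Longrightarrow> mscale c X \<in> lie_of G"
    and lie_of_bracket: "X \<in> lie_of G \<Longrightarrow> Y \<in> lie_of G \<Longrightarrow> X ** Y - Y ** X \<in> lie_of G"
    and lie_of_pmap: "CHAR('k) > 0 \<Longrightarrow> X \<in> lie_of G \<Longrightarrow> ((**) X ^^ CHAR('k)) (mat 1) \<in> lie_of G"
proof -
  note s = derivationD[OF derivation_inv_deriv] polyfuns.intros
  note van = inv_deriv_vanishes[OF G]
  show "X + Y \<in> lie_of G" if X: "X \<in> lie_of G" and Y: "Y \<in> lie_of G"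
  proof (rule lie_of_memI[OF G, where D = "\<lambda>f A. inv_deriv X f A + inv_deriv Y f A"])
    show "derivation (\<lambda>f A. inv_deriv X f A + inv_deriv Y f A)"
      unfolding derivation_def by (auto simp: s fun_eq_iff algebra_simps)
    show "symbol (\<lambda>f A. inv_deriv X f A + inv_deriv Y f A) (X + Y)"
      using symbol_inv_deriv[of X] symbol_inv_deriv[of Y] by (simp add: symbol_def matrix_add_ldistrib)
  qed (simp add: van X Y)
  show "mscale c X \<in> lie_of G" if X: "X \<in> lie_of G"
  proof (rule lie_of_memI[OF G, where D = "\<lambda>f A. c * inv_deriv X f A"])
    show "derivation (\<lambda>f A. c * inv_deriv X f A)"
      unfolding derivation_def by (auto simp: s fun_eq_iff algebra_simps)
    show "symbol (\<lambda>f A. c * inv_deriv X f A) (mscale c X)"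
      using symbol_inv_deriv[of X] by (simp add: symbol_def) (simp add: mscale_def)
  qed (simp add: van X)
  show "X ** Y - Y ** X \<in> lie_of G" if X: "X \<in> lie_of G" and Y: "Y \<in> lie_of G"
  proof (rule lie_of_memI[OF G, OF derivation_commutator[OF derivation_inv_deriv[of X] derivation_inv_deriv[of Y]]])
    show "symbol (\<lambda>f A. inv_deriv X (inv_deriv Y f) A - inv_deriv Y (inv_deriv X f) A) (X ** Y - Y ** X)"
      unfolding symbol_def symbol_comp[OF derivation_inv_deriv symbol_inv_deriv symbol_inv_deriv]
      by (simp add: matrix_diff_ldistrib)
  qed (simp add: van X Y s)
  show "((**) X ^^ CHAR('k)) (mat 1) \<in> lie_of G" if p: "CHAR('k) > 0" and X: "X \<in> lie_of G"
  proof (rule lie_of_memI[OF G derivation_funpow_CHAR[OF p derivation_inv_deriv]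
         symbol_funpow[OF derivation_inv_deriv symbol_inv_deriv]])
    fix f :: "'k^'n^'n \<Rightarrow> 'k" and A
    assume f: "f \<in> polyfuns" "\<And>A. A \<in> G \<Longrightarrow> f A = 0" and A: "A \<in> G"
    have "\<forall>A\<in>G. (inv_deriv X ^^ a) f A = 0" for a
    proof (induction a)
      case (Suc a)
      have "(inv_deriv X ^^ a) f \<in> polyfuns" by (rule funpow_polyfuns[OF derivation_inv_deriv f(1)])
      then show ?case using van[OF X] Suc by simp
    qed (use f in simp)
    then show "(inv_deriv X ^^ CHAR('k)) f A = 0" using A by blast
  qed
qed

section \<open>Truncated current algebras\<close>

lemma matrix_mult_sum_right: "A ** (\<Sum>i\<in>I. f i) = (\<Sum>i\<in>I. A ** (f i :: 'a::semiring_1^'n^'m))"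
  by (induction I rule: infinite_finite_induct) (auto simp: matrix_add_ldistrib)

lemma matrix_add_rdistrib: "(A + B) ** C = A ** C + B ** (C :: 'a::semiring_1^'n^'m)"
  by (simp add: matrix_matrix_mult_def vec_eq_iff sum.distrib distrib_right)

lemma matrix_mult_sum_left: "(\<Sum>i\<in>I. f i :: 'a::semiring_1^'n^'m) ** A = (\<Sum>i\<in>I. f i ** A)"
  by (induction I rule: infinite_finite_induct) (auto simp: matrix_add_rdistrib)

lemma sum_fun_apply: "(\<Sum>i\<in>I. f i) s = (\<Sum>i\<in>I. f i s)"
  by (induction I rule: infinite_finite_induct) auto

lemma mscale_sum: "mscale c (\<Sum>i\<in>I. f i) = (\<Sum>i\<in>I. mscale c (f i))"
  by (simp add: mscale_def vec_eq_iff sum_distrib_left)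

lemma mscale_right_zero [simp]: "mscale c 0 = 0"
  by (simp add: mscale_def vec_eq_iff)

lemma mscale_mscale [simp]: "mscale c (mscale d A) = mscale (c * d) A"
  by (simp add: mscale_def vec_eq_iff)

locale matrix_restricted_lie =
  fixes \<gg> :: "('k::field^'n^'n) set"
  assumes add_mem: "X \<in> \<gg> \<Longrightarrow> Y \<in> \<gg> \<Longrightarrow> X + Y \<in> \<gg>"
    and scale_mem: "X \<in> \<gg> \<Longrightarrow> mscale c X \<in> \<gg>"
    and bracket_mem: "X \<in> \<gg> \<Longrightarrow> Y \<in> \<gg> \<Longrightarrow> X ** Y - Y ** X \<in> \<gg>"
    and pmap_mem: "X \<in> \<gg> \<Longrightarrow> ((**) X ^^ CHAR('k)) (mat 1) \<in> \<gg>"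
    and zero_mem: "0 \<in> \<gg>"
    and infinite_field: "infinite (UNIV :: 'k set)"
    and CHAR_pos: "CHAR('k) > 0"
begin

lemma diff_mem: "X \<in> \<gg> \<Longrightarrow> Y \<in> \<gg> \<Longrightarrow> X - Y \<in> \<gg>"
  using add_mem[of X "mscale (-1) Y"] scale_mem[of Y "-1"] 
  by (simp add: mscale_def vec_eq_iff plus_vec_def minus_vec_def)

lemma sum_mem: "(\<And>i. i \<in> I \<Longrightarrow> f i \<in> \<gg>) \<Longrightarrow> (\<Sum>i\<in>I. f i) \<in> \<gg>"
  by (induction I rule: infinite_finite_induct) (auto simp: zero_mem add_mem)

text \<open>Replacing \<open>t\<close> by \<open>a t\<close> and subtracting \<open>a\<^sup>N\<close> times the original curve removes the top coefficient
  and rescales the others by nonzero factors, provided \<open>a\<close> is not a root of unity of small order.\<close>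

lemma coefficients_of_curve_mem:
  fixes c :: "nat \<Rightarrow> 'k^'n^'n"
  assumes "\<And>t. (\<Sum>r\<le>N. mscale (t ^ r) (c r)) \<in> \<gg>" and "r \<le> N"
  shows "c r \<in> \<gg>"
  using assms
proof (induction N arbitrary: c r)
  case 0
  then show ?case using "0.prems"(1)[of 1] by simp
next
  case (Suc N)
  define P where "P t = (\<Sum>r\<le>Suc N. mscale (t ^ r) (c r))" for t
  have fin: "finite {a::'k. a ^ j = 1}" if "j > 0" for j
  proof -
    have "monom 1 j - 1 \<noteq> (0 :: 'k poly)"
    proof
      assume "monom 1 j - 1 = (0 :: 'k poly)"
      then have "coeff (monom 1 j - 1 :: 'k poly) j = 0" by simp
      then show False using that by (simp add: coeff_1)
    qed
    then have "finite {a. poly (monom 1 j - 1) a = (0::'k)}" by (rule poly_roots_finite)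
    then show ?thesis by (simp add: poly_monom)
  qed
  then have "finite ({0::'k} \<union> (\<Union>j\<in>{1..Suc N}. {a. a ^ j = 1}))" by auto
  then obtain a where a: "a \<notin> {0::'k} \<union> (\<Union>j\<in>{1..Suc N}. {a. a ^ j = 1})"
    using infinite_field ex_new_if_finite by blast
  define d where "d r = mscale (a ^ r - a ^ Suc N) (c r)" for r
  have "(\<Sum>r\<le>N. mscale (t ^ r) (d r)) \<in> \<gg>" for t
  proof -
    have "(\<Sum>r\<le>N. mscale (t ^ r) (d r)) = (\<Sum>r\<le>Suc N. mscale (t ^ r) (d r))" by (simp add: d_def)
    also have "\<dots> = P (a * t) - mscale (a ^ Suc N) (P t)"
      unfolding P_def d_def mscale_sum sum_subtractf[symmetric]
      by (rule sum.cong) (auto simp: mscale_def vec_eq_iff power_mult_distrib algebra_simps)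
    also have "\<dots> \<in> \<gg>" using Suc.prems(1) by (intro diff_mem scale_mem) (auto simp: P_def)
    finally show ?thesis .
  qed
  then have "d r \<in> \<gg>" if "r \<le> N" for r using Suc.IH that by blast
  moreover have "c r = mscale (inverse (a ^ r - a ^ Suc N)) (d r)" if "r \<le> N" for r
  proof -
    have "a ^ Suc N = a ^ r * a ^ (Suc N - r)" using that by (simp add: power_add[symmetric])
    moreover have "a ^ (Suc N - r) \<noteq> 1" using a that by auto
    ultimately have "a ^ r - a ^ Suc N \<noteq> 0" using a by simp
    then show ?thesis by (simp add: d_def)
  qed
  ultimately have low: "c r \<in> \<gg>" if "r \<le> N" for r using that scale_mem by metis
  have "c (Suc N) = P 1 - (\<Sum>r\<le>N. c r)" by (simp add: P_def)
  also have "\<dots> \<in> \<gg>" using Suc.prems(1)[of 1] low by (intro diff_mem sum_mem) (auto simp: P_def)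
  finally show ?case using low Suc.prems(2) le_Suc_eq by metis
qed

end

text \<open>The coefficients of the \<open>a\<close>-th power of \<open>\<Sum>i. x i t\<^sup>i\<close> before truncation, so that \<open>t\<close> can be specialised.\<close>

primrec tpow :: "(nat \<Rightarrow> 'k::field^'n^'n) \<Rightarrow> nat \<Rightarrow> nat \<Rightarrow> 'k^'n^'n" where
  "tpow x 0 = tmonom (mat 1) 0"
| "tpow x (Suc a) = (\<lambda>r. \<Sum>i\<le>r. x i ** tpow x a (r - i))"

lemma tmult_funpow: "(tmult m x ^^ a) (tmonom (mat 1) 0) = (\<lambda>r. if r \<le> m then tpow x a r else 0)"
proof (induction a)
  case 0
  then show ?case by (auto simp: tmonom_def)
next
  case (Suc a)
  then show ?case by (auto simp: tmult_def fun_eq_iff intro!: sum.cong)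
qed

lemma tpow_eq_0:
  assumes "\<And>i. i > m \<Longrightarrow> x i = 0" "r > m * a"
  shows "tpow x a r = 0"
  using assms(2)
proof (induction a arbitrary: r)
  case (Suc a)
  have "x i ** tpow x a (r - i) = 0" if "i \<le> r" for i
    using Suc assms(1)[of i] by (cases "i \<le> m") auto
  then show ?case by simp
qed (simp add: tmonom_def)

lemma tpow_low_eq_0:
  assumes "\<And>i. i \<le> j \<Longrightarrow> x i = 0" "r < a * Suc j"
  shows "tpow x a r = 0"
  using assms(2)
proof (induction a arbitrary: r)
  case (Suc a)
  have "x i ** tpow x a (r - i) = 0" if "i \<le> r" for i
    using Suc assms(1)[of i] that by (cases "i \<le> j") (auto simp: less_diff_conv2)
  then show ?case by simp
qed simp

lemma tpow_cong:
  assumes "\<And>i. i \<le> r \<Longrightarrow> x i = y i"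
  shows "tpow x a r = tpow y a r"
  using assms
proof (induction a arbitrary: r)
  case (Suc a)
  then show ?case by (auto intro!: sum.cong arg_cong2[where f = "(**)"])
qed simp

lemma power_of_curve:
  assumes "\<And>i. i > m \<Longrightarrow> x i = 0"
  shows "((**) (\<Sum>i\<le>m. mscale (t ^ i) (x i)) ^^ a) (mat 1) = (\<Sum>r\<le>m * a. mscale (t ^ r) (tpow x a r))"
proof (induction a)
  case 0
  then show ?case by (simp add: tmonom_def)
next
  case (Suc a)
  define g where "g i j = mscale (t ^ (i + j)) (x i ** tpow x a j)" for i j
  have z: "g i j = 0" if "i > m \<or> j > m * a" for i j
  proof -
    have "x i = 0 \<or> tpow x a j = 0" using that assms tpow_eq_0[of m x a j] by blast
    then have "x i ** tpow x a j = 0" by auto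
    then show ?thesis by (simp add: g_def mscale_def vec_eq_iff)
  qed
  have "((**) (\<Sum>i\<le>m. mscale (t ^ i) (x i)) ^^ Suc a) (mat 1)
      = (\<Sum>i\<le>m. \<Sum>j\<le>m * a. g i j)"
    by (simp add: Suc matrix_mult_sum_right matrix_mult_sum_left g_def power_add mscale_sum mult_ac)
      (subst sum.swap, simp add: mult_ac)
  also have "\<dots> = (\<Sum>(i,j)\<in>{..m} \<times> {..m * a}. g i j)" by (simp add: sum.cartesian_product)
  also have "\<dots> = (\<Sum>(i,j)\<in>{(i,j). i + j \<le> m * Suc a}. g i j)"
  proof (rule sum.mono_neutral_left)
    have "{(i, j). i + j \<le> m * Suc a} \<subseteq> {..m * Suc a} \<times> {..m * Suc a}" by auto
    then show "finite {(i, j). i + j \<le> m * Suc a}" by (rule finite_subset) simp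
  qed (use z in \<open>auto simp: not_le[symmetric]\<close>)
  also have "\<dots> = (\<Sum>r\<le>m * Suc a. \<Sum>i\<le>r. g i (r - i))" by (rule sum.triangle_reindex_eq)
  also have "\<dots> = (\<Sum>r\<le>m * Suc a. mscale (t ^ r) (tpow x (Suc a) r))"
    by (simp add: g_def mscale_sum)
  finally show ?case .
qed

definition trunc :: "nat \<Rightarrow> (nat \<Rightarrow> 'a::zero) \<Rightarrow> nat \<Rightarrow> 'a" where
  "trunc k x = (\<lambda>i. if i \<le> k then x i else 0)"

context matrix_restricted_lie
begin

abbreviation "cur m \<equiv> current_lie \<gg> m"

lemma cur_mem_iff: "x \<in> lcarrier (cur m) \<longleftrightarrow> (\<forall>i\<le>m. x i \<in> \<gg>) \<and> (\<forall>i>m. x i = 0)"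
  by (simp add: current_lie_def)

lemma cur_add: "x \<in> lcarrier (cur m) \<Longrightarrow> y \<in> lcarrier (cur m) \<Longrightarrow> x + y \<in> lcarrier (cur m)"
  by (auto simp: cur_mem_iff add_mem)

lemma cur_diff: "x \<in> lcarrier (cur m) \<Longrightarrow> y \<in> lcarrier (cur m) \<Longrightarrow> x - y \<in> lcarrier (cur m)"
  by (auto simp: cur_mem_iff diff_mem)

lemma cur_zero: "0 \<in> lcarrier (cur m)"
  by (auto simp: cur_mem_iff zero_mem)

lemma cur_scale: "x \<in> lcarrier (cur m) \<Longrightarrow> lscale (cur m) c x \<in> lcarrier (cur m)"
  by (auto simp: current_lie_def scale_mem)

lemma cur_bracket:
  assumes "x \<in> lcarrier (cur m)" "y \<in> lcarrier (cur m)"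
  shows "lbracket (cur m) x y \<in> lcarrier (cur m)"
proof -
  have "lbracket (cur m) x y r \<in> \<gg>" if "r \<le> m" for r
  proof -
    have "(\<Sum>i\<le>r. y i ** x (r - i)) = (\<Sum>i\<le>r. y (r - i) ** x i)"
      using sum.nat_diff_reindex[of "\<lambda>i. y i ** x (r - i)" "Suc r"] by (simp add: lessThan_Suc_atMost)
    then have "lbracket (cur m) x y r = (\<Sum>i\<le>r. x i ** y (r - i) - y (r - i) ** x i)"
      using that by (simp add: current_lie_def tmult_def sum_subtractf)
    also have "\<dots> \<in> \<gg>" using assms that by (intro sum_mem bracket_mem) (auto simp: cur_mem_iff)
    finally show ?thesis .
  qed
  then show ?thesis by (auto simp: cur_mem_iff) (simp add: current_lie_def tmult_def)
qed

lemma cur_lpmap_eq: "lpmap (cur m) x = (\<lambda>r. if r \<le> m then tpow x CHAR('k) r else 0)"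
  by (simp add: current_lie_def tmult_funpow)

text \<open>Specialising \<open>t\<close> to a scalar turns the \<open>p\<close>-th power of \<open>x\<close> into the \<open>p\<close>-th power of an element of \<open>\<gg>\<close>; the
  coefficients are recovered from these values.\<close>

lemma cur_pmap:
  assumes "x \<in> lcarrier (cur m)"
  shows "lpmap (cur m) x \<in> lcarrier (cur m)"
proof -
  have "tpow x CHAR('k) r \<in> \<gg>" if "r \<le> m" for r
  proof (rule coefficients_of_curve_mem)
    fix t
    have "(\<Sum>i\<le>m. mscale (t ^ i) (x i)) \<in> \<gg>"
      using assms by (intro sum_mem scale_mem) (auto simp: cur_mem_iff)
    from pmap_mem[OF this] show "(\<Sum>r\<le>m * CHAR('k). mscale (t ^ r) (tpow x CHAR('k) r)) \<in> \<gg>"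
      using assms by (subst (asm) power_of_curve) (auto simp: cur_mem_iff)
    show "r \<le> m * CHAR('k)" using that CHAR_pos by (metis dual_order.trans le_simps(3) mult.commute mult_le_mono1 mult_1 One_nat_def)
  qed
  then show ?thesis by (auto simp: cur_mem_iff cur_lpmap_eq)
qed

lemma trunc_mem: "k \<le> m \<Longrightarrow> x \<in> lcarrier (cur m) \<Longrightarrow> trunc k x \<in> lcarrier (cur k)"
  by (auto simp: cur_mem_iff trunc_def)

lemma cur_mono: "k \<le> m \<Longrightarrow> lcarrier (cur k) \<subseteq> lcarrier (cur m)"
  using lcarrier_current_lie_upto[OF _ zero_mem] by (auto simp: current_upto_def)

lemma trunc_id: "x \<in> lcarrier (cur k) \<Longrightarrow> trunc k x = x"
  by (auto simp: cur_mem_iff trunc_def fun_eq_iff)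

lemma above_iff_trunc: "x \<in> current_above \<gg> m k \<longleftrightarrow> x \<in> lcarrier (cur m) \<and> trunc k x = 0"
  by (auto simp: current_above_def trunc_def fun_eq_iff)

lemma trunc_add: "trunc k (x + y) = trunc k x + trunc k (y :: nat \<Rightarrow> 'k^'n^'n)"
  and trunc_diff: "trunc k (x - y) = trunc k x - trunc k (y :: nat \<Rightarrow> 'k^'n^'n)"
  and trunc_scale: "trunc k (lscale (cur m) c x) = lscale (cur k) c (trunc k x)"
  by (auto simp: trunc_def fun_eq_iff current_lie_def)

lemma trunc_trunc: "trunc k (trunc k x) = trunc k (x :: nat \<Rightarrow> 'k^'n^'n)"
  by (auto simp: trunc_def)

lemma trunc_bracket: "k \<le> m \<Longrightarrow> trunc k (lbracket (cur m) x y) = lbracket (cur k) (trunc k x) (trunc k y)"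
  by (auto simp: trunc_def fun_eq_iff current_lie_def tmult_def intro!: arg_cong2[where f = "(-)"] sum.cong)

lemma trunc_pmap: "k \<le> m \<Longrightarrow> trunc k (lpmap (cur m) x) = lpmap (cur k) (trunc k x)"
  by (auto simp: trunc_def fun_eq_iff cur_lpmap_eq intro!: tpow_cong)

text \<open>Degrees above \<open>k\<close> are at least \<open>k + 1\<close>, so products of two or more such elements have degree at least
  \<open>2 k + 2\<close>.\<close>

lemma bracket_above:
  assumes "x \<in> current_above \<gg> m k" "y \<in> current_above \<gg> m k"
  shows "lbracket (cur m) x y \<in> current_above \<gg> m (Suc k)"
proof -
  have "x i ** y (r - i) = 0" "y i ** x (r - i) = 0" if "r \<le> Suc k" "i \<le> r" for r i
    using assms that by (cases "i \<le> k"; cases "r - i \<le> k"; auto simp: current_above_def)+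
  then have "lbracket (cur m) x y r = 0" if "r \<le> Suc k" for r
    using that by (auto simp: current_lie_def tmult_def)
  then show ?thesis using assms cur_bracket by (auto simp: current_above_def)
qed

lemma pmap_above:
  assumes "x \<in> current_above \<gg> m k"
  shows "lpmap (cur m) x \<in> current_above \<gg> m (Suc k)"
proof -
  have "prime CHAR('k)" using CHAR_pos prime_CHAR_semidom by blast
  then have p: "CHAR('k) \<ge> 2" by (rule prime_ge_2_nat)
  have "tpow x CHAR('k) r = 0" if "r \<le> Suc k" for r
  proof (rule tpow_low_eq_0)
    have "r < 2 * Suc k" using that by simp
    also have "\<dots> \<le> CHAR('k) * Suc k" using p by (rule mult_le_mono1)
    finally show "r < CHAR('k) * Suc k" .
  qed (use assms in \<open>auto simp: current_above_def\<close>)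
  then show ?thesis using assms cur_pmap by (auto simp: current_above_def cur_lpmap_eq)
qed

lemma cur_vector_space: "vector_space (lscale (cur m))"
  by unfold_locales (auto simp: current_lie_def mscale_def vec_eq_iff fun_eq_iff algebra_simps)

lemma cur_finitely_spanned:
  "\<exists>B. finite B \<and> lcarrier (cur m) \<subseteq> module.span (lscale (cur m)) B"
proof -
  interpret vs: vector_space "lscale (cur m)" by (rule cur_vector_space)
  define E :: "'n \<Rightarrow> 'n \<Rightarrow> nat \<Rightarrow> nat \<Rightarrow> 'k^'n^'n" where
    "E i j r = tmonom (\<chi> a b. if a = i \<and> b = j then 1 else 0) r" for i j r
  define B where "B = (\<lambda>(i, j, r). E i j r) ` (UNIV \<times> UNIV \<times> {..m})"
  have "x \<in> vs.span B" if "x \<in> lcarrier (cur m)" for x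
  proof -
    have "x = (\<Sum>i\<in>UNIV. \<Sum>j\<in>UNIV. \<Sum>r\<le>m. lscale (cur m) (x r $ i $ j) (E i j r))"
    proof (rule ext, unfold vec_eq_iff, intro allI)
      fix s a b
      have "(\<Sum>i\<in>UNIV. \<Sum>j\<in>UNIV. \<Sum>r\<le>m. lscale (cur m) (x r $ i $ j) (E i j r)) s $ a $ b
        = (\<Sum>i\<in>UNIV. \<Sum>j\<in>UNIV. \<Sum>r\<le>m. if r = s then (if j = b then (if i = a then x r $ i $ j else 0) else 0) else 0)"
        unfolding sum_fun_apply sum_component
        by (intro sum.cong refl) (simp add: E_def current_lie_def tmonom_def mscale_def)
      also have "\<dots> = (if s \<le> m then x s $ a $ b else 0)"
        by (simp add: sum.delta')
      also have "\<dots> = x s $ a $ b" using that by (auto simp: cur_mem_iff)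
      finally show "x s $ a $ b = (\<Sum>i\<in>UNIV. \<Sum>j\<in>UNIV. \<Sum>r\<le>m. lscale (cur m) (x r $ i $ j) (E i j r)) s $ a $ b" ..
    qed
    also have "\<dots> \<in> vs.span B"
      by (intro vs.span_sum vs.span_scale vs.span_base) (force simp: B_def)
    finally show ?thesis .
  qed
  moreover have "finite B" by (simp add: B_def)
  ultimately show ?thesis by blast
qed

end

lemma matrix_restricted_lie_lie_of:
  fixes G :: "('k::alg_closed_field^'n^'n) set"
  assumes "subgroup G GL" "CHAR('k) > 0"
  shows "matrix_restricted_lie (lie_of G)"
proof
  have "mat 1 \<in> G" using assms(1) by (rule mat_one_in_subgroup)
  then show "0 \<in> lie_of G"
    by (auto simp: lie_of_def intro!: exI[of _ 0])
qed (use assms in \<open>simp_all add: lie_of_add lie_of_scale lie_of_bracket lie_of_pmap infinite_alg_closed_field\<close>)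

section \<open>The free algebra\<close>

definition monomial :: "'k::field \<Rightarrow> 'a list \<Rightarrow> 'a list \<Rightarrow> 'k" where
  "monomial c w = (\<lambda>v. if v = w then c else 0)"

lemma word_eq_monomial: "word w = monomial 1 w"
  and scalar_eq_monomial: "scalar c = monomial c []"
  by (simp_all add: word_def scalar_def monomial_def)

lemma free_algebra_carrier: "f \<in> carrier (free_algebra A) \<longleftrightarrow>
    finite {w. f w \<noteq> 0} \<and> (\<forall>w. f w \<noteq> 0 \<longrightarrow> set w \<subseteq> A)"
  and free_algebra_mult: "f \<otimes>\<^bsub>free_algebra A\<^esub> g = (\<lambda>w. \<Sum>i\<le>length w. f (take i w) * g (drop i w))"
  and free_algebra_add: "f \<oplus>\<^bsub>free_algebra A\<^esub> g = (\<lambda>w. f w + g w)"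
  and free_algebra_zero: "\<zero>\<^bsub>free_algebra A\<^esub> = (\<lambda>_. 0)"
  and free_algebra_one: "\<one>\<^bsub>free_algebra A\<^esub> = word []"
  by (simp_all add: free_algebra_def)

lemma monomial_closed [simp]: "set w \<subseteq> A \<Longrightarrow> monomial c w \<in> carrier (free_algebra A)"
  by (auto simp: free_algebra_carrier monomial_def)

lemma word_closed [simp]: "set w \<subseteq> A \<Longrightarrow> word w \<in> carrier (free_algebra A)"
  and scalar_closed [simp]: "scalar c \<in> carrier (free_algebra A)"
  by (simp_all add: word_eq_monomial scalar_eq_monomial)

lemma monomial_mult:
  "monomial c u \<otimes>\<^bsub>free_algebra A\<^esub> monomial d v = monomial (c * d) (u @ v)"
proof -
  have "(\<Sum>i\<le>length w. monomial c u (take i w) * monomial d v (drop i w)) = monomial (c * d) (u @ v) w" for w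
  proof -
    have "(\<Sum>i\<le>length w. monomial c u (take i w) * monomial d v (drop i w))
        = (\<Sum>i\<le>length w. if i = length u then monomial (c * d) (u @ v) w else 0)"
    proof (rule sum.cong)
      fix i assume "i \<in> {..length w}"
      then have *: "take i w = u \<and> drop i w = v \<longleftrightarrow> i = length u \<and> w = u @ v"
        by (metis append_eq_conv_conj append_take_drop_id atMost_iff length_take min.absorb2)
      have "monomial c u (take i w) * monomial d v (drop i w)
          = (if take i w = u \<and> drop i w = v then c * d else 0)"
        by (simp add: monomial_def)
      also have "\<dots> = (if i = length u then monomial (c * d) (u @ v) w else 0)"
        by (simp only: *) (simp add: monomial_def)
      finally show "monomial c u (take i w) * monomial d v (drop i w)
          = (if i = length u then monomial (c * d) (u @ v) w else 0)" .
    qed simp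
    also have "\<dots> = monomial (c * d) (u @ v) w"
      by (auto simp: monomial_def)
    finally show ?thesis .
  qed
  then show ?thesis by (simp add: free_algebra_mult)
qed

text \<open>Both sides sum over the ways to cut \<open>w\<close> into three pieces: \<open>i\<close> and \<open>j\<close> are the cut positions on the left,
  and \<open>l\<close> is the length of the middle piece on the right.\<close>

lemma free_algebra_assoc:
  fixes f g h :: "'a list \<Rightarrow> 'k::field"
  shows "(\<Sum>i\<le>length w. (\<Sum>j\<le>length (take i w). f (take j (take i w)) * g (drop j (take i w))) * h (drop i w))
   = (\<Sum>j\<le>length w. f (take j w) * (\<Sum>l\<le>length (drop j w). g (take l (drop j w)) * h (drop l (drop j w))))"
proof -
  have "(\<Sum>i\<le>length w. (\<Sum>j\<le>length (take i w). f (take j (take i w)) * g (drop j (take i w))) * h (drop i w))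
      = (\<Sum>(i,j)\<in>(SIGMA i:{..length w}. {..i}). f (take j w) * g (take (i - j) (drop j w)) * h (drop i w))"
    unfolding sum_distrib_right
    by (subst sum.Sigma[symmetric]) (auto simp: min_absorb1 min_absorb2 drop_take intro!: sum.cong)
  also have "\<dots> = (\<Sum>(j,l)\<in>(SIGMA j:{..length w}. {..length w - j}).
      f (take j w) * g (take l (drop j w)) * h (drop (j + l) w))"
    by (rule sum.reindex_bij_witness[where i = "\<lambda>(j,l). (j + l, j)" and j = "\<lambda>(i,j). (j, i - j)"]) auto
  also have "\<dots> = (\<Sum>j\<le>length w. f (take j w) * (\<Sum>l\<le>length (drop j w). g (take l (drop j w)) * h (drop l (drop j w))))"
    unfolding sum_distrib_left by (subst sum.Sigma[symmetric]) (auto simp: mult.assoc add.commute)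
  finally show ?thesis .
qed

lemma free_algebra_mult_closed:
  assumes "f \<in> carrier (free_algebra A)" "g \<in> carrier (free_algebra A)"
  shows "f \<otimes>\<^bsub>free_algebra A\<^esub> g \<in> carrier (free_algebra A)"
proof -
  have ex: "\<exists>u v. w = u @ v \<and> f u \<noteq> 0 \<and> g v \<noteq> 0" if w: "(f \<otimes>\<^bsub>free_algebra A\<^esub> g) w \<noteq> 0" for w
  proof -
    have "\<exists>i\<in>{..length w}. f (take i w) * g (drop i w) \<noteq> 0"
      using sum.not_neutral_contains_not_neutral[OF w[unfolded free_algebra_mult]] by blast
    then obtain i where "f (take i w) \<noteq> 0" "g (drop i w) \<noteq> 0" by auto
    then show ?thesis by (intro exI[of _ "take i w"] exI[of _ "drop i w"]) simp
  qed
  have "{w. (f \<otimes>\<^bsub>free_algebra A\<^esub> g) w \<noteq> 0} \<subseteq> (\<lambda>(u,v). u @ v) ` ({u. f u \<noteq> 0} \<times> {v. g v \<noteq> 0})"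
    using ex by fastforce
  moreover have "finite ((\<lambda>(u,v). u @ v) ` ({u. f u \<noteq> 0} \<times> {v. g v \<noteq> 0}))"
    using assms by (intro finite_imageI finite_cartesian_product) (auto simp: free_algebra_carrier)
  ultimately have "finite {w. (f \<otimes>\<^bsub>free_algebra A\<^esub> g) w \<noteq> 0}" by (rule finite_subset)
  moreover have "set w \<subseteq> A" if "(f \<otimes>\<^bsub>free_algebra A\<^esub> g) w \<noteq> 0" for w
    using ex[OF that] assms by (fastforce simp: free_algebra_carrier)
  ultimately show ?thesis by (simp add: free_algebra_carrier)
qed

lemma free_algebra_ring: "ring (free_algebra A :: ('a list \<Rightarrow> 'k::field) ring)"
proof (rule ringI)
  show "abelian_group (free_algebra A :: ('a list \<Rightarrow> 'k::field) ring)"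
  proof (rule abelian_groupI)
    fix f g :: "'a list \<Rightarrow> 'k"
    assume fg: "f \<in> carrier (free_algebra A)" "g \<in> carrier (free_algebra A)"
    have "{w. f w + g w \<noteq> 0} \<subseteq> {w. f w \<noteq> 0} \<union> {w. g w \<noteq> 0}" by auto
    then show "f \<oplus>\<^bsub>free_algebra A\<^esub> g \<in> carrier (free_algebra A)"
      using fg finite_subset[of "{w. f w + g w \<noteq> 0}"] 
      by (simp add: free_algebra_carrier free_algebra_add) (metis add.right_neutral)
  next
    fix f :: "'a list \<Rightarrow> 'k"
    assume "f \<in> carrier (free_algebra A)"
    then show "\<exists>g\<in>carrier (free_algebra A). g \<oplus>\<^bsub>free_algebra A\<^esub> f = \<zero>\<^bsub>free_algebra A\<^esub>"
      by (intro bexI[of _ "\<lambda>w. - f w"]) (auto simp: free_algebra_carrier free_algebra_add free_algebra_zero)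
  qed (auto simp: free_algebra_add free_algebra_zero free_algebra_carrier add_ac)
  show "Group.monoid (free_algebra A :: ('a list \<Rightarrow> 'k::field) ring)"
  proof (rule monoidI)
    fix f :: "'a list \<Rightarrow> 'k"
    have "(\<Sum>i\<le>length w. word [] (take i w) * f (drop i w)) = f w" for w
    proof -
      have "(\<Sum>i\<le>length w. word [] (take i w) * f (drop i w)) = (\<Sum>i\<le>length w. if i = 0 then f w else 0)"
        by (rule sum.cong) (auto simp: word_def)
      then show ?thesis by simp
    qed
    then show "\<one>\<^bsub>free_algebra A\<^esub> \<otimes>\<^bsub>free_algebra A\<^esub> f = f" by (simp add: free_algebra_mult free_algebra_one)
    have "(\<Sum>i\<le>length w. f (take i w) * word [] (drop i w)) = f w" for w
    proof -
      have "(\<Sum>i\<le>length w. f (take i w) * word [] (drop i w)) = (\<Sum>i\<le>length w. if i = length w then f w else 0)"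
        by (rule sum.cong) (auto simp: word_def)
      then show ?thesis by simp
    qed
    then show "f \<otimes>\<^bsub>free_algebra A\<^esub> \<one>\<^bsub>free_algebra A\<^esub> = f" by (simp add: free_algebra_mult free_algebra_one)
    show "f \<otimes>\<^bsub>free_algebra A\<^esub> g \<otimes>\<^bsub>free_algebra A\<^esub> h = f \<otimes>\<^bsub>free_algebra A\<^esub> (g \<otimes>\<^bsub>free_algebra A\<^esub> h)" for g h
      by (simp only: free_algebra_mult free_algebra_assoc)
  qed (auto simp: free_algebra_mult_closed free_algebra_one)
qed (auto simp: free_algebra_mult free_algebra_add algebra_simps sum.distrib)

lemma free_algebra_induct [consumes 1, case_names monomial add]:
  assumes f: "f \<in> carrier (free_algebra A)"
    and mono: "\<And>c w. set w \<subseteq> A \<Longrightarrow> P (monomial c w)"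
    and add: "\<And>f g. f \<in> carrier (free_algebra A) \<Longrightarrow> g \<in> carrier (free_algebra A) \<Longrightarrow> P f \<Longrightarrow> P g \<Longrightarrow>
      P (f \<oplus>\<^bsub>free_algebra A\<^esub> g)"
  shows "P f"
proof -
  interpret T: ring "free_algebra A :: ('a list \<Rightarrow> 'b) ring" by (rule free_algebra_ring)
  have "P f" if "finite S" "{w. f w \<noteq> 0} \<subseteq> S" "f \<in> carrier (free_algebra A)" for S f
    using that
  proof (induction S arbitrary: f rule: finite_induct)
    case empty
    then have "f = monomial 0 []" by (auto simp: monomial_def)
    then show ?case using mono by simp
  next
    case (insert v S)
    define g where "g = f(v := 0)"
    have "{w. g w \<noteq> 0} \<subseteq> {w. f w \<noteq> 0}" by (auto simp: g_def)
    then have "g \<in> carrier (free_algebra A)"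
      using insert.prems finite_subset[of "{w. g w \<noteq> 0}"] by (auto simp: free_algebra_carrier)
    moreover have "{w. g w \<noteq> 0} \<subseteq> S" using insert.prems(1) by (auto simp: g_def)
    ultimately have g: "P g" "g \<in> carrier (free_algebra A)" using insert.IH by auto
    show ?case
    proof (cases "f v = 0")
      case True
      then show ?thesis using g by (simp add: g_def fun_upd_idem)
    next
      case False
      then have "set v \<subseteq> A" using insert.prems by (auto simp: free_algebra_carrier)
      then have "P (monomial (f v) v \<oplus>\<^bsub>free_algebra A\<^esub> g)" using g by (intro add mono monomial_closed)
      moreover have "monomial (f v) v \<oplus>\<^bsub>free_algebra A\<^esub> g = f"
        by (auto simp: free_algebra_add monomial_def g_def)
      ultimately show ?thesis by simp
    qed
  qed
  from this[of "{w. f w \<noteq> 0}"] f show ?thesis by (auto simp: free_algebra_carrier)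
qed

lemma monomial_add: "monomial (c + d) w = monomial c w \<oplus>\<^bsub>free_algebra A\<^esub> monomial d w"
  by (auto simp: free_algebra_add monomial_def)

lemma monomial_eq_scalar_word: "monomial c w = scalar c \<otimes>\<^bsub>free_algebra A\<^esub> word w"
  by (simp add: word_eq_monomial scalar_eq_monomial monomial_mult)

lemma word_append: "word (u @ v) = word u \<otimes>\<^bsub>free_algebra A\<^esub> word v"
  by (simp add: word_eq_monomial monomial_mult)

lemma word_mult_scalar: "word w \<otimes>\<^bsub>free_algebra A\<^esub> scalar c = scalar c \<otimes>\<^bsub>free_algebra A\<^esub> word w"
  by (simp add: word_eq_monomial scalar_eq_monomial monomial_mult)

lemma scalar_mult: "scalar (c * d) = scalar c \<otimes>\<^bsub>free_algebra A\<^esub> scalar d"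
  by (simp add: scalar_eq_monomial monomial_mult)

lemma scalar_add: "scalar (c + d) = scalar c \<oplus>\<^bsub>free_algebra A\<^esub> scalar d"
  by (simp add: scalar_eq_monomial monomial_add)

lemma word_pow: "word [x] [^]\<^bsub>free_algebra A\<^esub> n = word (replicate n x)"
proof -
  have "word [x] [^]\<^bsub>free_algebra A\<^esub> n = (word (replicate n x) :: 'a list \<Rightarrow> 'b)" for n
  proof (induction n)
    case (Suc n)
    then show ?case by (simp add: nat_pow_def free_algebra_one word_append[symmetric] replicate_append_same)
  qed (simp add: nat_pow_def free_algebra_one)
  then show ?thesis .
qed

text \<open>The homomorphism of free algebras induced by a map of letters. Coefficients are added up because several
  words may have the same image.\<close>

definition relabel :: "('a \<Rightarrow> 'b) \<Rightarrow> ('a list \<Rightarrow> 'k::field) \<Rightarrow> 'b list \<Rightarrow> 'k" where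
  "relabel \<tau> f = (\<lambda>w. \<Sum>u | f u \<noteq> 0 \<and> map \<tau> u = w. f u)"

lemma relabel_superset:
  assumes "finite S" "{u. f u \<noteq> 0} \<subseteq> S"
  shows "relabel \<tau> f w = (\<Sum>u\<in>S. if map \<tau> u = w then f u else 0)"
proof -
  have "(\<Sum>u\<in>S. if map \<tau> u = w then f u else 0) = (\<Sum>u | f u \<noteq> 0 \<and> map \<tau> u = w. if map \<tau> u = w then f u else 0)"
    using assms by (intro sum.mono_neutral_right) auto
  then show ?thesis by (simp add: relabel_def)
qed

lemma relabel_monomial: "relabel \<tau> (monomial c u) = monomial c (map \<tau> u)"
  by (rule ext, subst relabel_superset[of "{u}"]) (auto simp: monomial_def)

lemma relabel_add:
  assumes "f \<in> carrier (free_algebra A)" "g \<in> carrier (free_algebra A)"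
  shows "relabel \<tau> (f \<oplus>\<^bsub>free_algebra A\<^esub> g) = relabel \<tau> f \<oplus>\<^bsub>free_algebra B\<^esub> relabel \<tau> g"
proof
  fix w
  define S where "S = {u. f u \<noteq> 0} \<union> {u. g u \<noteq> 0}"
  have S: "finite S" using assms by (auto simp: S_def free_algebra_carrier)
  show "relabel \<tau> (f \<oplus>\<^bsub>free_algebra A\<^esub> g) w = (relabel \<tau> f \<oplus>\<^bsub>free_algebra B\<^esub> relabel \<tau> g) w"
    unfolding free_algebra_add
    by (subst (1 2 3) relabel_superset[OF S]) (auto simp: S_def sum.distrib[symmetric] intro!: sum.cong)
qed

lemma relabel_closed:
  fixes f :: "'a list \<Rightarrow> 'k::field" and \<tau> :: "'a \<Rightarrow> 'b"
  assumes \<tau>: "\<tau> ` A \<subseteq> B" and f: "f \<in> carrier (free_algebra A)"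
  shows "relabel \<tau> f \<in> carrier (free_algebra B)"
proof -
  interpret ring "free_algebra B :: ('b list \<Rightarrow> 'k) ring" by (rule free_algebra_ring)
  from f show ?thesis
  proof (induction rule: free_algebra_induct)
    case (monomial c w)
    then show ?case using \<tau> by (auto simp: relabel_monomial image_subset_iff subset_iff intro!: monomial_closed)
  next
    case (add f g)
    then show ?case using relabel_add[of f A g \<tau> B] by auto
  qed
qed

lemma relabel_ring_hom:
  fixes \<tau> :: "'a \<Rightarrow> 'b"
  assumes \<tau>: "\<tau> ` A \<subseteq> B"
  shows "relabel \<tau> \<in> ring_hom (free_algebra A :: ('a list \<Rightarrow> 'k::field) ring) (free_algebra B)"
proof (rule ring_hom_memI)
  interpret A: ring "free_algebra A :: ('a list \<Rightarrow> 'k) ring" by (rule free_algebra_ring)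
  interpret B: ring "free_algebra B :: ('b list \<Rightarrow> 'k) ring" by (rule free_algebra_ring)
  note c = relabel_closed[OF \<tau>] and a = relabel_add[where A = A and B = B]
  show "relabel \<tau> (f \<otimes>\<^bsub>free_algebra A\<^esub> g) = relabel \<tau> f \<otimes>\<^bsub>free_algebra B\<^esub> relabel \<tau> g"
    if f: "f \<in> carrier (free_algebra A)" and g: "g \<in> carrier (free_algebra A)"
    for f g :: "'a list \<Rightarrow> 'k"
    using f
  proof (induction rule: free_algebra_induct)
    case (monomial c u)
    from g show ?case
    proof (induction rule: free_algebra_induct)
      case (monomial d v)
      then show ?case by (simp add: monomial_mult relabel_monomial)
    next
      case (add g h)
      then show ?case using monomial by (simp add: A.r_distr B.r_distr a c)
    qed
  next
    case (add f h)
    then show ?case using g by (simp add: A.l_distr B.l_distr a c)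
  qed
qed (auto simp: relabel_closed[OF \<tau>] relabel_add[where A = A and B = B] free_algebra_one word_eq_monomial relabel_monomial)

section \<open>Reduced enveloping algebras\<close>

locale restricted_lie_structure =
  fixes L :: "('k::field, 'a::ab_group_add) restricted_lie"
  assumes l_vector_space: "vector_space (lscale L)"
    and l_subspace: "module.subspace (lscale L) (lcarrier L)"
    and l_bracket: "x \<in> lcarrier L \<Longrightarrow> y \<in> lcarrier L \<Longrightarrow> lbracket L x y \<in> lcarrier L"
    and l_pmap: "x \<in> lcarrier L \<Longrightarrow> lpmap L x \<in> lcarrier L"
begin

sublocale vs: vector_space "lscale L" by (rule l_vector_space)

lemma l_zero: "0 \<in> lcarrier L"
  and l_add: "x \<in> lcarrier L \<Longrightarrow> y \<in> lcarrier L \<Longrightarrow> x + y \<in> lcarrier L"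
  and l_diff: "x \<in> lcarrier L \<Longrightarrow> y \<in> lcarrier L \<Longrightarrow> x - y \<in> lcarrier L"
  and l_scale: "x \<in> lcarrier L \<Longrightarrow> lscale L c x \<in> lcarrier L"
  using l_subspace by (auto intro: vs.subspace_0 vs.subspace_add vs.subspace_diff vs.subspace_scale)

abbreviation T where "T \<equiv> (free_algebra (lcarrier L) :: ('a list \<Rightarrow> 'k) ring)"

sublocale T: ring T by (rule free_algebra_ring)

definition env_relations :: "('a list \<Rightarrow> 'k) set" where
  "env_relations =
      {word [x + y] \<ominus>\<^bsub>T\<^esub> (word [x] \<oplus>\<^bsub>T\<^esub> word [y]) | x y. x \<in> lcarrier L \<and> y \<in> lcarrier L} \<union>
       {word [lscale L c x] \<ominus>\<^bsub>T\<^esub> (scalar c \<otimes>\<^bsub>T\<^esub> word [x]) | c x. x \<in> lcarrier L} \<union>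
       {(word [x] \<otimes>\<^bsub>T\<^esub> word [y] \<ominus>\<^bsub>T\<^esub> word [y] \<otimes>\<^bsub>T\<^esub> word [x]) \<ominus>\<^bsub>T\<^esub> word [lbracket L x y]
          | x y. x \<in> lcarrier L \<and> y \<in> lcarrier L}"

lemma env_relations_add: "x \<in> lcarrier L \<Longrightarrow> y \<in> lcarrier L \<Longrightarrow>
    word [x + y] \<ominus>\<^bsub>T\<^esub> (word [x] \<oplus>\<^bsub>T\<^esub> word [y]) \<in> env_relations"
  and env_relations_scale: "x \<in> lcarrier L \<Longrightarrow>
    word [lscale L c x] \<ominus>\<^bsub>T\<^esub> (scalar c \<otimes>\<^bsub>T\<^esub> word [x]) \<in> env_relations"
  and env_relations_bracket: "x \<in> lcarrier L \<Longrightarrow> y \<in> lcarrier L \<Longrightarrow>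
    (word [x] \<otimes>\<^bsub>T\<^esub> word [y] \<ominus>\<^bsub>T\<^esub> word [y] \<otimes>\<^bsub>T\<^esub> word [x]) \<ominus>\<^bsub>T\<^esub> word [lbracket L x y] \<in> env_relations"
  unfolding env_relations_def by blast+

definition p_relation :: "('a \<Rightarrow> 'k) \<Rightarrow> 'a \<Rightarrow> 'a list \<Rightarrow> 'k" where
  "p_relation f x = (word [x] [^]\<^bsub>T\<^esub> CHAR('k) \<ominus>\<^bsub>T\<^esub> word [lpmap L x]) \<ominus>\<^bsub>T\<^esub> scalar (f x ^ CHAR('k))"

lemma env_ideal_eq: "env_ideal L = Idl\<^bsub>T\<^esub> env_relations"
  by (simp add: env_ideal_def env_relations_def Let_def)

lemma env_relations_subset: "env_relations \<subseteq> carrier T"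
  unfolding env_relations_def by (auto simp: l_add l_scale l_bracket)

lemma p_relation_closed: "x \<in> lcarrier L \<Longrightarrow> p_relation f x \<in> carrier T"
  unfolding p_relation_def by (simp add: l_pmap)

lemma env_ideal_ideal: "ideal (env_ideal L) T"
  unfolding env_ideal_eq by (rule T.genideal_ideal[OF env_relations_subset])

sublocale U: ring "env L"
  unfolding env_def by (rule ideal.quotient_is_ring[OF env_ideal_ideal])

lemma env_class_ring_hom: "ring_hom_ring T (env L) (env_class L)"
proof -
  have "env_class L = (+>\<^bsub>T\<^esub>) (env_ideal L)" by (rule ext) (simp add: env_class_def)
  then show ?thesis using ideal.rcos_ring_hom_ring[OF env_ideal_ideal] by (simp add: env_def)
qed

sublocale UH: ring_hom_ring T "env L" "env_class L" by (rule env_class_ring_hom)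

lemma env_class_p_relation:
  assumes "x \<in> lcarrier L"
  shows "env_class L (p_relation f x) =
    (env_class L (word [x]) [^]\<^bsub>env L\<^esub> CHAR('k) \<ominus>\<^bsub>env L\<^esub> env_class L (word [lpmap L x]))
      \<ominus>\<^bsub>env L\<^esub> env_class L (scalar (f x ^ CHAR('k)))"
  using assms by (simp add: p_relation_def l_pmap a_minus_def UH.hom_nat_pow)

lemma red_ideal_eq: "red_ideal L f = Idl\<^bsub>env L\<^esub> (env_class L ` p_relation f ` lcarrier L)"
proof -
  have "env_class L ` p_relation f ` lcarrier L =
    {(env_class L (word [x]) [^]\<^bsub>env L\<^esub> CHAR('k) \<ominus>\<^bsub>env L\<^esub> env_class L (word [lpmap L x]))
      \<ominus>\<^bsub>env L\<^esub> env_class L (scalar (f x ^ CHAR('k))) | x. x \<in> lcarrier L}"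
    unfolding image_image Setcompr_eq_image by (rule image_cong) (simp_all add: env_class_p_relation)
  then show ?thesis by (simp add: red_ideal_def Let_def)
qed

lemma red_ideal_ideal: "ideal (red_ideal L f) (env L)"
  unfolding red_ideal_eq by (rule U.genideal_ideal) (auto simp: p_relation_closed)

lemma red_env_ring: "ring (red_env L f)"
  unfolding red_env_def by (rule ideal.quotient_is_ring[OF red_ideal_ideal])

lemma red_class_ring_hom: "ring_hom_ring T (red_env L f) (red_class L f)"
proof (rule ring_hom_ringI2[OF T.ring_axioms red_env_ring])
  have "red_class L f = (+>\<^bsub>env L\<^esub>) (red_ideal L f) \<circ> env_class L"
    by (rule ext) (simp add: red_class_def)
  then show "red_class L f \<in> ring_hom T (red_env L f)"
    using ring_hom_trans[OF UH.homh ideal.rcos_ring_hom[OF red_ideal_ideal]]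
    by (simp add: red_env_def comp_def)
qed

lemma red_class_surj: "b \<in> carrier (red_env L f) \<Longrightarrow> \<exists>a\<in>carrier T. red_class L f a = b"
proof -
  assume "b \<in> carrier (red_env L f)"
  then obtain c where c: "c \<in> carrier (env L)" "b = red_ideal L f +>\<^bsub>env L\<^esub> c"
    by (auto simp: red_env_def FactRing_def A_RCOSETS_def')
  then obtain a where "a \<in> carrier T" "c = env_class L a"
    by (auto simp: env_def FactRing_def A_RCOSETS_def' env_class_def)
  then show ?thesis using c by (auto simp: red_class_def)
qed

text \<open>The kernel of the projection from the free algebra is the smallest two-sided ideal containing
  the relations. Statements about \<open>U\<^sub>f(L)\<close> can therefore be checked on generators of the free algebra.\<close>

lemma red_class_eq_zero_imp_mem:
  assumes J: "ideal J T" and env: "env_relations \<subseteq> J"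
    and p: "\<And>x. x \<in> lcarrier L \<Longrightarrow> p_relation f x \<in> J"
    and a: "a \<in> carrier T" and zero: "red_class L f a = \<zero>\<^bsub>red_env L f\<^esub>"
  shows "a \<in> J"
proof -
  have envJ: "env_ideal L \<subseteq> J" unfolding env_ideal_eq using J env by (rule T.genideal_minimal)
  have "env_class L a \<in> red_ideal L f"
    using zero UH.hom_closed[OF a]
    by (intro ideal.rcos_const_imp_mem[OF red_ideal_ideal]) (auto simp: red_class_def red_env_def FactRing_def)
  moreover have "ideal (env_class L ` J) (env L)"
  proof -
    have "env_class L = (+>\<^bsub>T\<^esub>) (env_ideal L)" by (rule ext) (simp add: env_class_def)
    then show ?thesis using T.ring_ideal_imp_quot_ideal[OF env_ideal_ideal J] by (simp add: env_def)
  qed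
  then have "red_ideal L f \<subseteq> env_class L ` J"
    unfolding red_ideal_eq using p by (intro U.genideal_minimal) auto
  ultimately obtain j where j: "j \<in> J" "env_class L a = env_class L j" by auto
  have jT: "j \<in> carrier T" using j(1) ideal.Icarr[OF J] by blast
  have "a \<ominus>\<^bsub>T\<^esub> j \<in> env_ideal L"
    using j(2) T.quotient_eq_iff_same_a_r_cos[OF env_ideal_ideal a jT] by (simp add: env_class_def)
  then have "(a \<ominus>\<^bsub>T\<^esub> j) \<oplus>\<^bsub>T\<^esub> j \<in> J"
    using envJ j(1) additive_subgroup.a_closed[OF ideal.axioms(1)[OF J]] by blast
  also have "(a \<ominus>\<^bsub>T\<^esub> j) \<oplus>\<^bsub>T\<^esub> j = a" using a jT by (simp add: a_minus_def T.a_assoc T.l_neg)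
  finally show ?thesis .
qed

lemma red_class_env_relation:
  assumes "r \<in> env_relations"
  shows "red_class L f r = \<zero>\<^bsub>red_env L f\<^esub>"
proof -
  have "r \<in> env_ideal L"
    unfolding env_ideal_eq using assms T.genideal_self[OF env_relations_subset] by blast
  then have "env_class L r = \<zero>\<^bsub>env L\<^esub>"
    unfolding env_class_def env_def FactRing_def by (simp add: T.a_rcos_zero[OF env_ideal_ideal])
  moreover have "red_ideal L f +>\<^bsub>env L\<^esub> \<zero>\<^bsub>env L\<^esub> = red_ideal L f"
    by (intro U.a_rcos_zero[OF red_ideal_ideal] additive_subgroup.zero_closed ideal.axioms(1) red_ideal_ideal)
  ultimately show ?thesis by (simp add: red_class_def red_env_def FactRing_def)
qed

lemma red_class_p_relation:
  assumes "x \<in> lcarrier L"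
  shows "red_class L f (p_relation f x) = \<zero>\<^bsub>red_env L f\<^esub>"
proof -
  have "env_class L ` p_relation f ` lcarrier L \<subseteq> red_ideal L f"
    unfolding red_ideal_eq by (rule U.genideal_self) (auto simp: p_relation_closed)
  then have "env_class L (p_relation f x) \<in> red_ideal L f" using assms by auto
  then show ?thesis
    by (simp add: red_class_def red_env_def FactRing_def U.a_rcos_zero[OF red_ideal_ideal])
qed

end

text \<open>The value at \<open>b\<close> is computed at any preimage of \<open>b\<close> under \<open>q\<close>.\<close>

lemma ring_hom_factor:
  assumes q: "ring_hom_ring T R q" and h: "ring_hom_ring T S h"
    and surj: "\<And>b. b \<in> carrier R \<Longrightarrow> \<exists>a\<in>carrier T. q a = b"
    and ker: "\<And>a. a \<in> carrier T \<Longrightarrow> q a = \<zero>\<^bsub>R\<^esub> \<Longrightarrow> h a = \<zero>\<^bsub>S\<^esub>"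
  obtains \<phi> where "\<phi> \<in> ring_hom R S" "\<And>a. a \<in> carrier T \<Longrightarrow> \<phi> (q a) = h a"
proof -
  interpret q: ring_hom_ring T R q by fact
  interpret h: ring_hom_ring T S h by fact
  define \<phi> where "\<phi> b = h (SOME a. a \<in> carrier T \<and> q a = b)" for b
  have eq: "\<phi> (q a) = h a" if a: "a \<in> carrier T" for a
  proof -
    define a' where "a' = (SOME a'. a' \<in> carrier T \<and> q a' = q a)"
    have a': "a' \<in> carrier T" "q a' = q a"
      using someI[of "\<lambda>a'. a' \<in> carrier T \<and> q a' = q a" a] a by (auto simp: a'_def)
    then have "h (a' \<ominus>\<^bsub>T\<^esub> a) = \<zero>\<^bsub>S\<^esub>"
      using a by (intro ker) (auto simp: a_minus_def q.S.r_neg)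
    then have "h a' \<ominus>\<^bsub>S\<^esub> h a = \<zero>\<^bsub>S\<^esub>" using a a' by (simp add: a_minus_def)
    then have "h a' = h a" 
      using a a' h.S.minus_equality[of "h a'" "\<ominus>\<^bsub>S\<^esub> h a"] by (simp add: a_minus_def)
    then show ?thesis by (simp add: \<phi>_def a'_def)
  qed
  have "\<phi> \<in> ring_hom R S"
  proof (rule ring_hom_memI)
    show "\<phi> \<one>\<^bsub>R\<^esub> = \<one>\<^bsub>S\<^esub>" using eq[of "\<one>\<^bsub>T\<^esub>"] by simp
    fix x y assume "x \<in> carrier R" "y \<in> carrier R"
    then obtain a b where ab: "a \<in> carrier T" "b \<in> carrier T" "x = q a" "y = q b" using surj by metis
    show "\<phi> x \<in> carrier S" using ab by (simp add: eq)
    show "\<phi> (x \<otimes>\<^bsub>R\<^esub> y) = \<phi> x \<otimes>\<^bsub>S\<^esub> \<phi> y"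
      using ab eq[of "a \<otimes>\<^bsub>T\<^esub> b"] by (simp add: eq)
    show "\<phi> (x \<oplus>\<^bsub>R\<^esub> y) = \<phi> x \<oplus>\<^bsub>S\<^esub> \<phi> y"
      using ab eq[of "a \<oplus>\<^bsub>T\<^esub> b"] by (simp add: eq)
  qed
  then show ?thesis using eq that by blast
qed

section \<open>Modules over a quotient ring\<close>

text \<open>The category \<open>red_mod\<close> depends on the Lie algebra only through a ring and its scalars; categories are
  compared at this level.\<close>

definition fd_modules :: "'v itself \<Rightarrow> 'r ring \<Rightarrow> ('k \<Rightarrow> 'r) \<Rightarrow> (('r, 'v) module, 'v \<Rightarrow> 'v) category" where
  "fd_modules _ R \<iota> =
     \<lparr>obj = {M. left_module R M \<and> finite_dim_module \<iota> M},
      hom_set = left_module_homs R,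
      ident = (\<lambda>M. \<lambda>x\<in>carrier M. x),
      cat_comp = (\<lambda>M N P g h. compose (carrier M) g h)\<rparr>"

text \<open>The record is built anew, rather than updated, because the type of the acting elements changes.\<close>

definition with_action :: "('r, 'v) module \<Rightarrow> ('s \<Rightarrow> 'v \<Rightarrow> 'v) \<Rightarrow> ('s, 'v) module" where
  "with_action M s = \<lparr>carrier = carrier M, monoid.mult = monoid.mult M, one = one M,
     ring.zero = ring.zero M, ring.add = ring.add M, smult = s\<rparr>"

lemma with_action_simps [simp]:
  "carrier (with_action M s) = carrier M"
  "\<zero>\<^bsub>with_action M s\<^esub> = \<zero>\<^bsub>M\<^esub>"
  "x \<oplus>\<^bsub>with_action M s\<^esub> y = x \<oplus>\<^bsub>M\<^esub> y"
  "a \<odot>\<^bsub>with_action M s\<^esub> x = s a x"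
  "monoid.mult (with_action M s) = monoid.mult M"
  by (simp_all add: with_action_def)

lemma finsum_with_action: "finsum (with_action M s) f A = finsum M f A"
  by (simp add: finsum_def with_action_def finprod_def)

lemma abelian_group_with_action:
  assumes "abelian_group M"
  shows "abelian_group (with_action M s)"
proof -
  interpret abelian_group M by fact
  show ?thesis
    by (rule abelian_groupI) (auto simp: a_assoc a_comm a_lcomm l_neg intro: bexI[of _ "\<ominus>\<^bsub>M\<^esub> _"])
qed

text \<open>Additivity and multiplicativity of \<open>\<alpha>\<close> are required only as far as the module can see them. A section of a
  ring homomorphism satisfies this on the modules killed by the kernel.\<close>

lemma left_moduleI_with_action:
  assumes "left_module R M" "ring R'"
    and act: "\<And>a x. a \<in> carrier R' \<Longrightarrow> x \<in> carrier M \<Longrightarrow> s a x = \<alpha> a \<odot>\<^bsub>M\<^esub> x"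
    and closed: "\<And>a. a \<in> carrier R' \<Longrightarrow> \<alpha> a \<in> carrier R"
    and "\<And>a b x. a \<in> carrier R' \<Longrightarrow> b \<in> carrier R' \<Longrightarrow> x \<in> carrier M \<Longrightarrow>
       \<alpha> (a \<oplus>\<^bsub>R'\<^esub> b) \<odot>\<^bsub>M\<^esub> x = (\<alpha> a \<oplus>\<^bsub>R\<^esub> \<alpha> b) \<odot>\<^bsub>M\<^esub> x"
    and "\<And>a b x. a \<in> carrier R' \<Longrightarrow> b \<in> carrier R' \<Longrightarrow> x \<in> carrier M \<Longrightarrow>
       \<alpha> (a \<otimes>\<^bsub>R'\<^esub> b) \<odot>\<^bsub>M\<^esub> x = (\<alpha> a \<otimes>\<^bsub>R\<^esub> \<alpha> b) \<odot>\<^bsub>M\<^esub> x"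
    and "\<And>x. x \<in> carrier M \<Longrightarrow> \<alpha> \<one>\<^bsub>R'\<^esub> \<odot>\<^bsub>M\<^esub> x = \<one>\<^bsub>R\<^esub> \<odot>\<^bsub>M\<^esub> x"
  shows "left_module R' (with_action M s)"
proof -
  interpret left_module R M by fact
  interpret R': ring R' by fact
  show ?thesis
  proof (intro left_module.intro left_module_axioms.intro abelian_group_with_action)
    show "ring R'" "abelian_group M" by unfold_locales
  qed (simp_all add: assms lm_closed lm_add_left lm_add_right lm_mult lm_one)
qed

locale surjective_ring_hom = ring_hom_ring R S \<phi>
  for R :: "'r ring" and S :: "'s ring" and \<phi> :: "'r \<Rightarrow> 's" +
  fixes \<iota> :: "'k \<Rightarrow> 'r" and \<iota>' :: "'k \<Rightarrow> 's"
  assumes surj: "\<And>b. b \<in> carrier S \<Longrightarrow> \<exists>a\<in>carrier R. \<phi> a = b"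
    and scalars: "\<And>c. \<iota> c \<in> carrier R" "\<And>c. \<phi> (\<iota> c) = \<iota>' c"
begin

definition section_of :: "'s \<Rightarrow> 'r" where
  "section_of b = (SOME a. a \<in> carrier R \<and> \<phi> a = b)"

lemma section_of: "b \<in> carrier S \<Longrightarrow> section_of b \<in> carrier R" "b \<in> carrier S \<Longrightarrow> \<phi> (section_of b) = b"
  using someI_ex[of "\<lambda>a. a \<in> carrier R \<and> \<phi> a = b" for b] surj unfolding section_of_def by blast+

definition inflate :: "('s, 'v) module \<Rightarrow> ('r, 'v) module" where
  "inflate N = with_action N (\<lambda>a x. \<phi> a \<odot>\<^bsub>N\<^esub> x)"

definition deflate :: "('r, 'v) module \<Rightarrow> ('s, 'v) module" where
  "deflate M = with_action M (\<lambda>b x. section_of b \<odot>\<^bsub>M\<^esub> x)"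

definition killed :: "('r, 'v) module set" where
  "killed = {M. \<forall>a\<in>carrier R. \<phi> a = \<zero>\<^bsub>S\<^esub> \<longrightarrow> (\<forall>x\<in>carrier M. a \<odot>\<^bsub>M\<^esub> x = \<zero>\<^bsub>M\<^esub>)}"

lemma killed_act_cong:
  assumes M: "left_module R M" "M \<in> killed" and ab: "a \<in> carrier R" "b \<in> carrier R" "\<phi> a = \<phi> b"
    and x: "x \<in> carrier M"
  shows "a \<odot>\<^bsub>M\<^esub> x = b \<odot>\<^bsub>M\<^esub> x"
proof -
  interpret M: left_module R M by fact
  have "\<phi> (a \<ominus>\<^bsub>R\<^esub> b) = \<zero>\<^bsub>S\<^esub>" using ab by (simp add: a_minus_def S.r_neg)
  then have "(a \<ominus>\<^bsub>R\<^esub> b) \<odot>\<^bsub>M\<^esub> x = \<zero>\<^bsub>M\<^esub>" using M(2) ab x by (simp add: killed_def)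
  then have "((a \<ominus>\<^bsub>R\<^esub> b) \<oplus>\<^bsub>R\<^esub> b) \<odot>\<^bsub>M\<^esub> x = b \<odot>\<^bsub>M\<^esub> x"
    using ab x by (simp add: M.lm_add_left M.lm_closed)
  moreover have "(a \<ominus>\<^bsub>R\<^esub> b) \<oplus>\<^bsub>R\<^esub> b = a" using ab by (simp add: a_minus_def R.a_assoc R.l_neg)
  ultimately show ?thesis by simp
qed

lemma left_module_inflate: "left_module S N \<Longrightarrow> left_module R (inflate N)"
  unfolding inflate_def
  by (rule left_moduleI_with_action[where R = S and \<alpha> = \<phi>]) (simp_all add: R.ring_axioms)

lemma left_module_deflate:
  assumes M: "left_module R M" "M \<in> killed"
  shows "left_module S (deflate M)"
  unfolding deflate_def
  by (rule left_moduleI_with_action[where R = R and \<alpha> = section_of])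
    (auto simp: S.ring_axioms section_of M intro!: killed_act_cong[OF M])

end

lemma left_module_zero_act:
  assumes "left_module R M" "x \<in> carrier M"
  shows "\<zero>\<^bsub>R\<^esub> \<odot>\<^bsub>M\<^esub> x = \<zero>\<^bsub>M\<^esub>"
proof -
  interpret left_module R M by fact
  have "\<zero>\<^bsub>R\<^esub> \<odot>\<^bsub>M\<^esub> x \<oplus>\<^bsub>M\<^esub> \<zero>\<^bsub>R\<^esub> \<odot>\<^bsub>M\<^esub> x = \<zero>\<^bsub>R\<^esub> \<odot>\<^bsub>M\<^esub> x"
    using lm_add_left[of "\<zero>\<^bsub>R\<^esub>" "\<zero>\<^bsub>R\<^esub>" x] assms(2) by simp
  then show ?thesis using lm_closed[of "\<zero>\<^bsub>R\<^esub>" x] assms(2) by simp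
qed

context surjective_ring_hom
begin

lemma inflate_killed: "left_module S N \<Longrightarrow> inflate N \<in> killed"
  by (simp add: killed_def inflate_def left_module_zero_act)

lemma finite_dim_inflate: "finite_dim_module \<iota>' N \<Longrightarrow> finite_dim_module \<iota> (inflate N)"
  by (simp add: finite_dim_module_def inflate_def finsum_with_action scalars)

lemma finite_dim_deflate:
  assumes M: "left_module R M" "M \<in> killed" and fd: "finite_dim_module \<iota> M"
  shows "finite_dim_module \<iota>' (deflate M)"
proof -
  interpret M: left_module R M by fact
  obtain B where B: "finite B" "B \<subseteq> carrier M"
    "\<forall>v\<in>carrier M. \<exists>c. v = finsum M (\<lambda>b. \<iota> (c b) \<odot>\<^bsub>M\<^esub> b) B"
    using fd unfolding finite_dim_module_def by blast
  have "finsum M (\<lambda>b. section_of (\<iota>' (c b)) \<odot>\<^bsub>M\<^esub> b) B = finsum M (\<lambda>b. \<iota> (c b) \<odot>\<^bsub>M\<^esub> b) B" for c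
  proof (rule M.finsum_cong')
    fix b assume b: "b \<in> B"
    have c: "\<iota>' (c b) \<in> carrier S" using scalars(1)[of "c b"] hom_closed unfolding scalars(2)[symmetric] by blast
    show "section_of (\<iota>' (c b)) \<odot>\<^bsub>M\<^esub> b = \<iota> (c b) \<odot>\<^bsub>M\<^esub> b"
      using b B(2) by (intro killed_act_cong[OF M]) (auto simp: section_of[OF c] scalars)
  qed (use B(2) in \<open>auto intro!: M.lm_closed scalars\<close>)
  then show ?thesis
    using B by (auto simp: finite_dim_module_def deflate_def finsum_with_action)
qed

lemma inflate_homs:
  assumes "h \<in> left_module_homs S M N"
  shows "h \<in> left_module_homs R (inflate M) (inflate N)"
  using assms by (auto simp: left_module_homs_def inflate_def)

lemma deflate_homs:
  assumes "h \<in> left_module_homs R M N"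
  shows "h \<in> left_module_homs S (deflate M) (deflate N)"
  using assms by (auto simp: left_module_homs_def deflate_def section_of)

end

lemma identity_left_module_homs:
  assumes M: "left_module R M"
    and eq: "carrier N = carrier M" "\<And>x y. x \<in> carrier M \<Longrightarrow> y \<in> carrier M \<Longrightarrow> x \<oplus>\<^bsub>N\<^esub> y = x \<oplus>\<^bsub>M\<^esub> y"
      "\<And>a x. a \<in> carrier R \<Longrightarrow> x \<in> carrier M \<Longrightarrow> a \<odot>\<^bsub>N\<^esub> x = a \<odot>\<^bsub>M\<^esub> x"
  shows "(\<lambda>x\<in>carrier M. x) \<in> left_module_homs R M N" "(\<lambda>x\<in>carrier M. x) \<in> left_module_homs R N M"
proof -
  interpret left_module R M by fact
  show "(\<lambda>x\<in>carrier M. x) \<in> left_module_homs R M N" "(\<lambda>x\<in>carrier M. x) \<in> left_module_homs R N M"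
    by (auto simp: left_module_homs_def eq lm_closed)
qed

text \<open>The identity maps are module homomorphisms in both directions, although \<open>on_obj F M\<close> need not be equal to
  \<open>M\<close> as a record.\<close>

lemma naturally_isomorphic_id:
  assumes C: "C = full_subcategory (fd_modules TYPE('v) R \<iota>) A"
    and F: "on_hom F = (\<lambda>M N h. h)"
    and eq: "\<And>M. M \<in> obj C \<Longrightarrow> carrier (on_obj F M) = carrier M"
      "\<And>M x y. M \<in> obj C \<Longrightarrow> x \<in> carrier M \<Longrightarrow> y \<in> carrier M \<Longrightarrow> x \<oplus>\<^bsub>on_obj F M\<^esub> y = x \<oplus>\<^bsub>M\<^esub> y"
      "\<And>M a x. M \<in> obj C \<Longrightarrow> a \<in> carrier R \<Longrightarrow> x \<in> carrier M \<Longrightarrow> a \<odot>\<^bsub>on_obj F M\<^esub> x = a \<odot>\<^bsub>M\<^esub> x"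
  shows "naturally_isomorphic C C F id_functor"
  unfolding naturally_isomorphic_def
proof (intro exI[of _ "\<lambda>M. \<lambda>x\<in>carrier M. x"] conjI ballI)
  fix M assume M: "M \<in> obj C"
  then have lm: "left_module R M" by (simp add: C full_subcategory_def fd_modules_def)
  note homs = identity_left_module_homs[OF lm eq[OF M]]
  have comp: "compose (carrier M) (\<lambda>x\<in>carrier M. x) (\<lambda>x\<in>carrier M. x) = (\<lambda>x\<in>carrier M. x)"
    by (auto simp: compose_def)
  show "isomorphism C (on_obj F M) (on_obj id_functor M) (\<lambda>x\<in>carrier M. x)"
    unfolding isomorphism_def using homs comp eq(1)[OF M]
    by (auto simp: C full_subcategory_def fd_modules_def id_functor_def)
next
  fix M N f assume M: "M \<in> obj C" and N: "N \<in> obj C" and f: "f \<in> hom_set C M N"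
  then have "f \<in> carrier M \<rightarrow>\<^sub>E carrier N"
    by (auto simp: C full_subcategory_def fd_modules_def left_module_homs_def)
  then have "compose (carrier M) (\<lambda>x\<in>carrier N. x) f = f" "compose (carrier M) f (\<lambda>x\<in>carrier M. x) = f"
    by (auto simp: compose_def fun_eq_iff PiE_def extensional_def)
  then show "cat_comp C (on_obj F M) (on_obj F N) (on_obj id_functor N) (\<lambda>x\<in>carrier N. x) (on_hom F M N f) =
      cat_comp C (on_obj F M) (on_obj id_functor M) (on_obj id_functor N) (on_hom id_functor M N f) (\<lambda>x\<in>carrier M. x)"
    using eq(1)[OF M] by (simp add: C F full_subcategory_def fd_modules_def id_functor_def)
qed

lemma full_subcategory_UNIV: "full_subcategory C UNIV = C"
  by (simp add: full_subcategory_def)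

text \<open>Inflation and deflation change neither the underlying groups nor the maps. Their composites agree with the
  given modules except for the action of arguments outside the carrier of the ring, which is arbitrary.\<close>

theorem (in surjective_ring_hom) inflation_equivalence:
  assumes A: "\<And>M. M \<in> obj (fd_modules TYPE('v) R \<iota>) \<Longrightarrow> M \<in> A \<longleftrightarrow> M \<in> killed"
  shows "equivalent_categories (full_subcategory (fd_modules TYPE('v) R \<iota>) A) (fd_modules TYPE('v) S \<iota>')"
proof -
  define C where "C = full_subcategory (fd_modules TYPE('v) R \<iota>) A"
  define D where "D = fd_modules TYPE('v) S \<iota>'"
  define F :: "(('r, 'v) module, 'v \<Rightarrow> 'v, ('s, 'v) module, 'v \<Rightarrow> 'v) cat_functor"
    where "F = \<lparr>on_obj = deflate, on_hom = (\<lambda>M N h. h)\<rparr>"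
  define E :: "(('s, 'v) module, 'v \<Rightarrow> 'v, ('r, 'v) module, 'v \<Rightarrow> 'v) cat_functor"
    where "E = \<lparr>on_obj = inflate, on_hom = (\<lambda>M N h. h)\<rparr>"
  have objC: "M \<in> obj C \<longleftrightarrow> left_module R M \<and> finite_dim_module \<iota> M \<and> M \<in> killed" for M
    using A by (auto simp: C_def full_subcategory_def fd_modules_def)
  have objD: "N \<in> obj D \<longleftrightarrow> left_module S N \<and> finite_dim_module \<iota>' N" for N
    by (simp add: D_def fd_modules_def)
  have carr: "carrier (deflate M) = carrier M" "carrier (inflate N) = carrier N" for M :: "('r, 'v) module" and N :: "('s, 'v) module"
    by (simp_all add: deflate_def inflate_def)
  have F: "is_functor C D F"
    unfolding is_functor_def
    by (auto simp: objC objD F_def left_module_deflate finite_dim_deflate)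
      (auto simp: C_def D_def full_subcategory_def fd_modules_def carr deflate_homs)
  have E: "is_functor D C E"
    unfolding is_functor_def
    by (auto simp: objC objD E_def left_module_inflate finite_dim_inflate inflate_killed)
      (auto simp: C_def D_def full_subcategory_def fd_modules_def carr inflate_homs)
  have "naturally_isomorphic C C (comp_functor E F) id_functor"
  proof (rule naturally_isomorphic_id[OF C_def])
    fix M a x assume M: "M \<in> obj C" and a: "a \<in> carrier R" and x: "x \<in> carrier M"
    then have "section_of (\<phi> a) \<odot>\<^bsub>M\<^esub> x = a \<odot>\<^bsub>M\<^esub> x"
      by (intro killed_act_cong) (auto simp: objC section_of)
    then show "a \<odot>\<^bsub>on_obj (comp_functor E F) M\<^esub> x = a \<odot>\<^bsub>M\<^esub> x"
      by (simp add: comp_functor_def E_def F_def inflate_def deflate_def)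
  qed (simp_all add: comp_functor_def E_def F_def inflate_def deflate_def)
  moreover have "naturally_isomorphic D D (comp_functor F E) id_functor"
    by (rule naturally_isomorphic_id[where A = UNIV and R = S and \<iota> = \<iota>'])
      (simp_all add: D_def full_subcategory_UNIV comp_functor_def E_def F_def inflate_def deflate_def section_of)
  ultimately have "equivalent_categories C D"
    unfolding equivalent_categories_def using F E by blast
  then show ?thesis by (simp add: C_def D_def)
qed

section \<open>Homomorphisms of reduced enveloping algebras\<close>

lemma mem_a_kernel: "a \<in> a_kernel R S h \<longleftrightarrow> a \<in> carrier R \<and> h a = \<zero>\<^bsub>S\<^esub>"
  by (simp add: a_kernel_def')

lemma red_mod_eq_fd_modules: "red_mod TYPE('v) L f = fd_modules TYPE('v) (red_env L f) (red_scalar L f)"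
  by (simp add: red_mod_def fd_modules_def)

context restricted_lie_structure
begin

lemma annihilator_ideal:
  assumes M: "left_module (red_env L f) M"
  shows "ideal {a \<in> carrier T. \<forall>v\<in>carrier M. red_class L f a \<odot>\<^bsub>M\<^esub> v = \<zero>\<^bsub>M\<^esub>} T"
proof -
  interpret q: ring_hom_ring T "red_env L f" "red_class L f" by (rule red_class_ring_hom)
  interpret M: left_module "red_env L f" M by fact
  have zero: "a \<odot>\<^bsub>M\<^esub> \<zero>\<^bsub>M\<^esub> = \<zero>\<^bsub>M\<^esub>" if "a \<in> carrier (red_env L f)" for a
  proof -
    have "a \<odot>\<^bsub>M\<^esub> \<zero>\<^bsub>M\<^esub> \<oplus>\<^bsub>M\<^esub> a \<odot>\<^bsub>M\<^esub> \<zero>\<^bsub>M\<^esub> = a \<odot>\<^bsub>M\<^esub> \<zero>\<^bsub>M\<^esub>"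
      using M.lm_add_right[of a "\<zero>\<^bsub>M\<^esub>" "\<zero>\<^bsub>M\<^esub>"] that by simp
    then show ?thesis using M.lm_closed[of a "\<zero>\<^bsub>M\<^esub>"] that by simp
  qed
  have neg: "(\<ominus>\<^bsub>red_env L f\<^esub> a) \<odot>\<^bsub>M\<^esub> v = \<zero>\<^bsub>M\<^esub>"
    if "a \<in> carrier (red_env L f)" "v \<in> carrier M" "a \<odot>\<^bsub>M\<^esub> v = \<zero>\<^bsub>M\<^esub>" for a v
  proof -
    have "(\<ominus>\<^bsub>red_env L f\<^esub> a \<oplus>\<^bsub>red_env L f\<^esub> a) \<odot>\<^bsub>M\<^esub> v = \<zero>\<^bsub>M\<^esub>"
      using that left_module_zero_act[OF M] by (simp add: q.S.l_neg)
    then show ?thesis using that by (simp add: M.lm_add_left M.lm_closed)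
  qed
  show ?thesis
  proof (rule idealI[OF T.ring_axioms])
    show "subgroup {a \<in> carrier T. \<forall>v\<in>carrier M. red_class L f a \<odot>\<^bsub>M\<^esub> v = \<zero>\<^bsub>M\<^esub>} (add_monoid T)"
      by (rule T.add.subgroupI)
        (auto simp: M.lm_add_left left_module_zero_act[OF M] neg intro: exI[of _ "\<zero>\<^bsub>T\<^esub>"])
  qed (auto simp: M.lm_mult M.lm_closed zero)
qed

lemma red_class_word_zero: "red_class L f (word [0]) = \<zero>\<^bsub>red_env L f\<^esub>"
proof -
  interpret q: ring_hom_ring T "red_env L f" "red_class L f" by (rule red_class_ring_hom)
  have w: "word [0] \<in> carrier T" using l_zero by simp
  have "word [0 + 0] \<ominus>\<^bsub>T\<^esub> (word [0] \<oplus>\<^bsub>T\<^esub> word [0]) \<in> env_relations"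
    by (intro env_relations_add l_zero)
  from red_class_env_relation[OF this, of f] w
  have "red_class L f (word [0]) \<ominus>\<^bsub>red_env L f\<^esub> (red_class L f (word [0]) \<oplus>\<^bsub>red_env L f\<^esub> red_class L f (word [0]))
     = \<zero>\<^bsub>red_env L f\<^esub>" by (simp add: a_minus_def)
  then have "\<ominus>\<^bsub>red_env L f\<^esub> red_class L f (word [0]) = \<zero>\<^bsub>red_env L f\<^esub>"
    using w by (simp add: a_minus_def q.S.minus_add q.S.a_assoc[symmetric] q.S.r_neg)
  then show ?thesis using w by (metis q.S.minus_minus q.S.minus_zero q.hom_closed)
qed

end

locale restricted_lie_epi = L: restricted_lie_structure L + L': restricted_lie_structure L'
  for L :: "('k::field, 'a::ab_group_add) restricted_lie"
    and L' :: "('k, 'b::ab_group_add) restricted_lie" +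
  fixes \<tau> :: "'a \<Rightarrow> 'b" and f :: "'a \<Rightarrow> 'k" and f' :: "'b \<Rightarrow> 'k"
  assumes tau_image: "\<tau> ` lcarrier L = lcarrier L'"
    and tau_add: "x \<in> lcarrier L \<Longrightarrow> y \<in> lcarrier L \<Longrightarrow> \<tau> (x + y) = \<tau> x + \<tau> y"
    and tau_scale: "x \<in> lcarrier L \<Longrightarrow> \<tau> (lscale L c x) = lscale L' c (\<tau> x)"
    and tau_bracket: "x \<in> lcarrier L \<Longrightarrow> y \<in> lcarrier L \<Longrightarrow> \<tau> (lbracket L x y) = lbracket L' (\<tau> x) (\<tau> y)"
    and tau_pmap: "x \<in> lcarrier L \<Longrightarrow> \<tau> (lpmap L x) = lpmap L' (\<tau> x)"
    and tau_form: "x \<in> lcarrier L \<Longrightarrow> f' (\<tau> x) = f x"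
begin

lemma tau_closed [simp]: "x \<in> lcarrier L \<Longrightarrow> \<tau> x \<in> lcarrier L'"
  using tau_image by blast

lemma tau_diff: "x \<in> lcarrier L \<Longrightarrow> y \<in> lcarrier L \<Longrightarrow> \<tau> (x - y) = \<tau> x - \<tau> y"
  using tau_add[of "x - y" y] L.l_diff[of x y] by simp

sublocale q: ring_hom_ring L.T "red_env L f" "red_class L f" by (rule L.red_class_ring_hom)
sublocale q': ring_hom_ring L'.T "red_env L' f'" "red_class L' f'" by (rule L'.red_class_ring_hom)

lemma relabel_tau_hom: "ring_hom_ring L.T L'.T (relabel \<tau>)"
  by (intro ring_hom_ringI2 L.T.ring_axioms L'.T.ring_axioms relabel_ring_hom) (simp add: tau_image)

sublocale t: ring_hom_ring L.T L'.T "relabel \<tau>" by (rule relabel_tau_hom)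

lemma relabel_word: "relabel \<tau> (word w) = word (map \<tau> w)"
  and relabel_scalar: "relabel \<tau> (scalar c) = scalar c"
  by (simp_all add: word_eq_monomial scalar_eq_monomial relabel_monomial)

lemma relabel_env_relations:
  assumes "r \<in> L.env_relations"
  shows "relabel \<tau> r \<in> L'.env_relations"
  using assms unfolding L.env_relations_def
proof (elim UnE)
  assume "r \<in> {word [x + y] \<ominus>\<^bsub>L.T\<^esub> (word [x] \<oplus>\<^bsub>L.T\<^esub> word [y]) |x y. x \<in> lcarrier L \<and> y \<in> lcarrier L}"
  then obtain x y where xy: "x \<in> lcarrier L" "y \<in> lcarrier L"
    and r: "r = word [x + y] \<ominus>\<^bsub>L.T\<^esub> (word [x] \<oplus>\<^bsub>L.T\<^esub> word [y])" by blast
  then have "relabel \<tau> r = word [\<tau> x + \<tau> y] \<ominus>\<^bsub>L'.T\<^esub> (word [\<tau> x] \<oplus>\<^bsub>L'.T\<^esub> word [\<tau> y])"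
    by (simp add: a_minus_def relabel_word L.l_add tau_add)
  then show ?thesis using xy by (simp add: L'.env_relations_add)
next
  assume "r \<in> {word [lscale L c x] \<ominus>\<^bsub>L.T\<^esub> scalar c \<otimes>\<^bsub>L.T\<^esub> word [x] |c x. x \<in> lcarrier L}"
  then obtain c x where x: "x \<in> lcarrier L"
    and r: "r = word [lscale L c x] \<ominus>\<^bsub>L.T\<^esub> scalar c \<otimes>\<^bsub>L.T\<^esub> word [x]" by blast
  then have "relabel \<tau> r = word [lscale L' c (\<tau> x)] \<ominus>\<^bsub>L'.T\<^esub> scalar c \<otimes>\<^bsub>L'.T\<^esub> word [\<tau> x]"
    by (simp add: a_minus_def relabel_word relabel_scalar L.l_scale tau_scale)
  then show ?thesis using x by (simp add: L'.env_relations_scale)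
next
  assume "r \<in> {word [x] \<otimes>\<^bsub>L.T\<^esub> word [y] \<ominus>\<^bsub>L.T\<^esub> word [y] \<otimes>\<^bsub>L.T\<^esub> word [x] \<ominus>\<^bsub>L.T\<^esub> word [lbracket L x y] |x y.
       x \<in> lcarrier L \<and> y \<in> lcarrier L}"
  then obtain x y where xy: "x \<in> lcarrier L" "y \<in> lcarrier L"
    and r: "r = word [x] \<otimes>\<^bsub>L.T\<^esub> word [y] \<ominus>\<^bsub>L.T\<^esub> word [y] \<otimes>\<^bsub>L.T\<^esub> word [x] \<ominus>\<^bsub>L.T\<^esub> word [lbracket L x y]" by blast
  then have "relabel \<tau> r = word [\<tau> x] \<otimes>\<^bsub>L'.T\<^esub> word [\<tau> y] \<ominus>\<^bsub>L'.T\<^esub> word [\<tau> y] \<otimes>\<^bsub>L'.T\<^esub> word [\<tau> x]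
      \<ominus>\<^bsub>L'.T\<^esub> word [lbracket L' (\<tau> x) (\<tau> y)]"
    by (simp add: a_minus_def relabel_word L.l_bracket tau_bracket)
  then show ?thesis using xy by (simp add: L'.env_relations_bracket)
qed

lemma relabel_p_relation: "x \<in> lcarrier L \<Longrightarrow> relabel \<tau> (L.p_relation f x) = L'.p_relation f' (\<tau> x)"
  by (simp add: L.p_relation_def L'.p_relation_def a_minus_def relabel_word relabel_scalar L.l_pmap
    tau_pmap tau_form t.hom_nat_pow)

lemma projection_exists:
  obtains \<phi> where "\<phi> \<in> ring_hom (red_env L f) (red_env L' f')"
    "\<And>a. a \<in> carrier L.T \<Longrightarrow> \<phi> (red_class L f a) = red_class L' f' (relabel \<tau> a)"
proof (rule ring_hom_factor[OF L.red_class_ring_hom])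
  let ?h = "\<lambda>a. red_class L' f' (relabel \<tau> a)"
  show h: "ring_hom_ring L.T (red_env L' f') ?h"
    by (rule ring_hom_ringI2[OF L.T.ring_axioms L'.red_env_ring
        ring_hom_trans[OF t.homh q'.homh, unfolded comp_def]])
  show "?h a = \<zero>\<^bsub>red_env L' f'\<^esub>" if a: "a \<in> carrier L.T" "red_class L f a = \<zero>\<^bsub>red_env L f\<^esub>" for a
  proof -
    have "a \<in> a_kernel L.T (red_env L' f') ?h"
    proof (rule L.red_class_eq_zero_imp_mem[OF ring_hom_ring.kernel_is_ideal[OF h] _ _ a])
      show "L.env_relations \<subseteq> a_kernel L.T (red_env L' f') ?h"
      proof
        fix r assume r: "r \<in> L.env_relations"
        then have "r \<in> carrier L.T" using L.env_relations_subset by (rule rev_subsetD)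
        moreover have "?h r = \<zero>\<^bsub>red_env L' f'\<^esub>"
          by (rule L'.red_class_env_relation[OF relabel_env_relations[OF r]])
        ultimately show "r \<in> a_kernel L.T (red_env L' f') ?h" unfolding mem_a_kernel ..
      qed
      show "L.p_relation f x \<in> a_kernel L.T (red_env L' f') ?h" if "x \<in> lcarrier L" for x
        unfolding mem_a_kernel relabel_p_relation[OF that]
        using L.p_relation_closed[OF that] L'.red_class_p_relation[OF tau_closed[OF that]] ..
    qed
    then show ?thesis unfolding mem_a_kernel by (rule conjunct2)
  qed
qed (use L.red_class_surj in blast)+

text \<open>Choose a set-theoretic section \<open>\<sigma>\<close> of \<open>\<tau>\<close>. Modulo the annihilator of the module, the letters \<open>\<sigma> y\<close>
  satisfy the relations of \<open>U\<^sub>f\<^sub>'(L')\<close>, because \<open>\<sigma>\<close> respects the operations up to elements of the kernel of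
  \<open>\<tau>\<close>; and each letter \<open>x\<close> agrees with \<open>\<sigma> (\<tau> x)\<close>. So the free algebra maps to its quotient by the annihilator
  through the reduced enveloping algebra of \<open>L'\<close>.\<close>

lemma kernel_annihilates:
  assumes M: "left_module (red_env L f) M"
    and ann: "\<And>x v. x \<in> lcarrier L \<Longrightarrow> \<tau> x = 0 \<Longrightarrow> v \<in> carrier M \<Longrightarrow> red_incl L f x \<odot>\<^bsub>M\<^esub> v = \<zero>\<^bsub>M\<^esub>"
    and a: "a \<in> carrier L.T" and zero: "red_class L' f' (relabel \<tau> a) = \<zero>\<^bsub>red_env L' f'\<^esub>"
    and v: "v \<in> carrier M"
  shows "red_class L f a \<odot>\<^bsub>M\<^esub> v = \<zero>\<^bsub>M\<^esub>"
proof -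
  define J where "J = {a \<in> carrier L.T. \<forall>v\<in>carrier M. red_class L f a \<odot>\<^bsub>M\<^esub> v = \<zero>\<^bsub>M\<^esub>}"
  have J: "ideal J L.T" unfolding J_def by (rule L.annihilator_ideal[OF M])
  interpret J: ideal J L.T by (rule J)
  interpret Q: ring "L.T Quot J" by (rule J.quotient_is_ring)
  define \<pi> where "\<pi> = (+>\<^bsub>L.T\<^esub>) J"
  interpret p: ring_hom_ring L.T "L.T Quot J" \<pi> unfolding \<pi>_def by (rule J.rcos_ring_hom_ring)
  have mem: "a \<in> J \<longleftrightarrow> \<pi> a = \<zero>\<^bsub>L.T Quot J\<^esub>" if "a \<in> carrier L.T" for a
    unfolding \<pi>_def FactRing_def using J.rcos_const_imp_mem[OF that] L.T.a_rcos_zero[OF J, of a] by auto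
  have rel: "\<pi> r = \<zero>\<^bsub>L.T Quot J\<^esub>" if "red_class L f r = \<zero>\<^bsub>red_env L f\<^esub>" "r \<in> carrier L.T" for r
  proof -
    have "r \<in> J" unfolding J_def using that(2) left_module_zero_act[OF M]
      by (intro CollectI conjI ballI) (simp_all only: that(1))
    then show ?thesis using mem[OF that(2)] by (rule rev_iffD1)
  qed
  have move: "\<pi> a = \<pi> b" if "\<pi> (a \<ominus>\<^bsub>L.T\<^esub> b) = \<zero>\<^bsub>L.T Quot J\<^esub>" "a \<in> carrier L.T" "b \<in> carrier L.T" for a b
    using that Q.minus_equality[of "\<pi> a" "\<ominus>\<^bsub>L.T Quot J\<^esub> \<pi> b"] by (simp add: a_minus_def)
  have padd: "\<pi> (word [x + y]) = \<pi> (word [x]) \<oplus>\<^bsub>L.T Quot J\<^esub> \<pi> (word [y])"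
    if "x \<in> lcarrier L" "y \<in> lcarrier L" for x y
  proof -
    have r: "word [x + y] \<ominus>\<^bsub>L.T\<^esub> (word [x] \<oplus>\<^bsub>L.T\<^esub> word [y]) \<in> L.env_relations"
      by (intro L.env_relations_add that)
    have "\<pi> (word [x + y] \<ominus>\<^bsub>L.T\<^esub> (word [x] \<oplus>\<^bsub>L.T\<^esub> word [y])) = \<zero>\<^bsub>L.T Quot J\<^esub>"
      using L.red_class_env_relation[OF r] L.env_relations_subset r by (intro rel) auto
    then have "\<pi> (word [x + y]) = \<pi> (word [x] \<oplus>\<^bsub>L.T\<^esub> word [y])"
      using that by (intro move) (auto simp: L.l_add)
    then show ?thesis using that by simp
  qed
  have pscale: "\<pi> (word [lscale L c x]) = \<pi> (scalar c) \<otimes>\<^bsub>L.T Quot J\<^esub> \<pi> (word [x])" if "x \<in> lcarrier L" for c x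
  proof -
    have r: "word [lscale L c x] \<ominus>\<^bsub>L.T\<^esub> (scalar c \<otimes>\<^bsub>L.T\<^esub> word [x]) \<in> L.env_relations"
      by (intro L.env_relations_scale that)
    have "\<pi> (word [lscale L c x] \<ominus>\<^bsub>L.T\<^esub> (scalar c \<otimes>\<^bsub>L.T\<^esub> word [x])) = \<zero>\<^bsub>L.T Quot J\<^esub>"
      using L.red_class_env_relation[OF r] L.env_relations_subset r by (intro rel) auto
    then have "\<pi> (word [lscale L c x]) = \<pi> (scalar c \<otimes>\<^bsub>L.T\<^esub> word [x])"
      using that by (intro move) (auto simp: L.l_scale)
    then show ?thesis using that by simp
  qed
  have pbracket: "\<pi> (word [lbracket L x y]) = \<pi> (word [x]) \<otimes>\<^bsub>L.T Quot J\<^esub> \<pi> (word [y])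
      \<ominus>\<^bsub>L.T Quot J\<^esub> \<pi> (word [y]) \<otimes>\<^bsub>L.T Quot J\<^esub> \<pi> (word [x])"
    if "x \<in> lcarrier L" "y \<in> lcarrier L" for x y
  proof -
    have r: "(word [x] \<otimes>\<^bsub>L.T\<^esub> word [y] \<ominus>\<^bsub>L.T\<^esub> word [y] \<otimes>\<^bsub>L.T\<^esub> word [x]) \<ominus>\<^bsub>L.T\<^esub> word [lbracket L x y] \<in> L.env_relations"
      by (intro L.env_relations_bracket that)
    have "\<pi> ((word [x] \<otimes>\<^bsub>L.T\<^esub> word [y] \<ominus>\<^bsub>L.T\<^esub> word [y] \<otimes>\<^bsub>L.T\<^esub> word [x]) \<ominus>\<^bsub>L.T\<^esub> word [lbracket L x y]) = \<zero>\<^bsub>L.T Quot J\<^esub>"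
      using L.red_class_env_relation[OF r] L.env_relations_subset r by (intro rel) auto
    then have "\<pi> (word [x] \<otimes>\<^bsub>L.T\<^esub> word [y] \<ominus>\<^bsub>L.T\<^esub> word [y] \<otimes>\<^bsub>L.T\<^esub> word [x]) = \<pi> (word [lbracket L x y])"
      using that by (intro move) (auto simp: L.l_bracket)
    then show ?thesis using that by (simp add: a_minus_def)
  qed
  have ppmap: "(\<pi> (word [x]) [^]\<^bsub>L.T Quot J\<^esub> CHAR('k) \<ominus>\<^bsub>L.T Quot J\<^esub> \<pi> (word [lpmap L x]))
      \<ominus>\<^bsub>L.T Quot J\<^esub> \<pi> (scalar (f x ^ CHAR('k))) = \<zero>\<^bsub>L.T Quot J\<^esub>"
    if "x \<in> lcarrier L" for x
    using rel[OF L.red_class_p_relation[OF that] L.p_relation_closed[OF that]] that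
    by (simp add: L.p_relation_def a_minus_def L.l_pmap p.hom_nat_pow)
  \<comment> \<open>Letters with the same image under \<open>\<tau>\<close> differ by a letter that kills the module.\<close>
  have ker: "\<pi> (word [x]) = \<pi> (word [y])" if "x \<in> lcarrier L" "y \<in> lcarrier L" "\<tau> x = \<tau> y" for x y
  proof -
    have d: "x - y \<in> lcarrier L" "\<tau> (x - y) = 0" using that by (simp_all add: L.l_diff tau_diff)
    then have "word [x - y] \<in> J"
      unfolding J_def using ann[unfolded red_incl_def] by (intro CollectI conjI ballI) (simp_all only: word_closed, simp)
    then have "\<pi> (word [x - y]) = \<zero>\<^bsub>L.T Quot J\<^esub>" using mem d by simp
    then show ?thesis using padd[OF d(1) that(2)] that by simp
  qed
  define \<sigma> where "\<sigma> y = (SOME x. x \<in> lcarrier L \<and> \<tau> x = y)" for y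
  have \<sigma>: "\<sigma> y \<in> lcarrier L" "\<tau> (\<sigma> y) = y" if "y \<in> lcarrier L'" for y
  proof -
    have "\<exists>x. x \<in> lcarrier L \<and> \<tau> x = y" using that unfolding tau_image[symmetric] by blast
    from someI_ex[OF this] show "\<sigma> y \<in> lcarrier L" "\<tau> (\<sigma> y) = y" by (auto simp: \<sigma>_def)
  qed
  interpret s: ring_hom_ring L'.T L.T "relabel \<sigma>"
    by (intro ring_hom_ringI2 L.T.ring_axioms L'.T.ring_axioms relabel_ring_hom) (auto simp: \<sigma>)
  have sw: "relabel \<sigma> (word [y]) = word [\<sigma> y]" "relabel \<sigma> (scalar c) = scalar c" for y c
    by (simp_all add: word_eq_monomial scalar_eq_monomial relabel_monomial)
  have h: "ring_hom_ring L'.T (L.T Quot J) (\<lambda>a. \<pi> (relabel \<sigma> a))"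
    by (rule ring_hom_ringI2[OF L'.T.ring_axioms Q.ring_axioms
        ring_hom_trans[OF s.homh p.homh, unfolded comp_def]])
  have "relabel \<tau> a \<in> a_kernel L'.T (L.T Quot J) (\<lambda>a. \<pi> (relabel \<sigma> a))"
  proof (rule L'.red_class_eq_zero_imp_mem[OF ring_hom_ring.kernel_is_ideal[OF h] _ _ t.hom_closed[OF a] zero])
    show "L'.env_relations \<subseteq> a_kernel L'.T (L.T Quot J) (\<lambda>a. \<pi> (relabel \<sigma> a))"
    proof
      fix r assume r: "r \<in> L'.env_relations"
      have "\<pi> (relabel \<sigma> r) = \<zero>\<^bsub>L.T Quot J\<^esub>"
        using r unfolding L'.env_relations_def
      proof (elim UnE CollectE exE conjE)
        fix x y assume xy: "x \<in> lcarrier L'" "y \<in> lcarrier L'" 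
          and r: "r = word [x + y] \<ominus>\<^bsub>L'.T\<^esub> (word [x] \<oplus>\<^bsub>L'.T\<^esub> word [y])"
        have "\<pi> (word [\<sigma> (x + y)]) = \<pi> (word [\<sigma> x + \<sigma> y])"
          by (rule ker) (simp_all add: \<sigma> xy L.l_add L'.l_add tau_add)
        then show ?thesis using xy
          by (simp add: r a_minus_def sw \<sigma> L'.l_add padd Q.r_neg)
      next
        fix c x assume x: "x \<in> lcarrier L'" and r: "r = word [lscale L' c x] \<ominus>\<^bsub>L'.T\<^esub> scalar c \<otimes>\<^bsub>L'.T\<^esub> word [x]"
        have "\<pi> (word [\<sigma> (lscale L' c x)]) = \<pi> (word [lscale L c (\<sigma> x)])"
          by (rule ker) (simp_all add: \<sigma> x L.l_scale L'.l_scale tau_scale)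
        then show ?thesis using x
          by (simp add: r a_minus_def sw \<sigma> L'.l_scale pscale Q.r_neg)
      next
        fix x y assume xy: "x \<in> lcarrier L'" "y \<in> lcarrier L'" 
          and r: "r = word [x] \<otimes>\<^bsub>L'.T\<^esub> word [y] \<ominus>\<^bsub>L'.T\<^esub> word [y] \<otimes>\<^bsub>L'.T\<^esub> word [x] \<ominus>\<^bsub>L'.T\<^esub> word [lbracket L' x y]"
        have "\<pi> (word [\<sigma> (lbracket L' x y)]) = \<pi> (word [lbracket L (\<sigma> x) (\<sigma> y)])"
          by (rule ker) (simp_all add: \<sigma> xy L.l_bracket L'.l_bracket tau_bracket)
        then show ?thesis using xy
          by (simp add: r a_minus_def sw \<sigma> L'.l_bracket pbracket Q.r_neg)
      qed
      then show "r \<in> a_kernel L'.T (L.T Quot J) (\<lambda>a. \<pi> (relabel \<sigma> a))"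
        unfolding mem_a_kernel using r L'.env_relations_subset by blast
    qed
  next
    fix x assume x: "x \<in> lcarrier L'"
    have "\<pi> (word [\<sigma> (lpmap L' x)]) = \<pi> (word [lpmap L (\<sigma> x)])"
      by (rule ker) (simp_all add: \<sigma> x L.l_pmap L'.l_pmap tau_pmap)
    moreover have "f (\<sigma> x) = f' x" using tau_form[of "\<sigma> x"] \<sigma>[OF x] by simp
    ultimately have "\<pi> (relabel \<sigma> (L'.p_relation f' x)) = \<zero>\<^bsub>L.T Quot J\<^esub>"
      using ppmap[OF \<sigma>(1)[OF x]] x
      by (simp add: L'.p_relation_def a_minus_def sw \<sigma> L'.l_pmap p.hom_nat_pow s.hom_nat_pow)
    then show "L'.p_relation f' x \<in> a_kernel L'.T (L.T Quot J) (\<lambda>a. \<pi> (relabel \<sigma> a))"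
      unfolding mem_a_kernel using L'.p_relation_closed[OF x] by blast
  qed
  then have st: "\<pi> (relabel \<sigma> (relabel \<tau> a)) = \<zero>\<^bsub>L.T Quot J\<^esub>" unfolding mem_a_kernel by (rule conjunct2)
  \<comment> \<open>Applying \<open>\<sigma> \<circ> \<tau>\<close> to all letters does not change an element modulo the annihilator.\<close>
  have "\<pi> (relabel \<sigma> (relabel \<tau> a)) = \<pi> a"
    using a
  proof (induction rule: free_algebra_induct)
    case (monomial c w)
    have "\<pi> (word (map (\<lambda>x. \<sigma> (\<tau> x)) w)) = \<pi> (word w)"
      using monomial
    proof (induction w)
      case (Cons x w)
      have c1: "set (map (\<lambda>x. \<sigma> (\<tau> x)) w) \<subseteq> lcarrier L" using Cons.prems by (auto simp: \<sigma>)
      have "word (map (\<lambda>x. \<sigma> (\<tau> x)) (x # w)) = word [\<sigma> (\<tau> x)] \<otimes>\<^bsub>L.T\<^esub> word (map (\<lambda>x. \<sigma> (\<tau> x)) w)"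
        by (simp add: word_append[symmetric])
      moreover have "word (x # w) = word [x] \<otimes>\<^bsub>L.T\<^esub> word w"
        by (simp add: word_append[symmetric])
      moreover have "\<pi> (word [\<sigma> (\<tau> x)]) = \<pi> (word [x])"
        using Cons.prems by (intro ker) (auto simp: \<sigma>)
      ultimately show ?case using Cons c1 by (simp add: \<sigma>)
    qed simp
    moreover have "set (map (\<lambda>x. \<sigma> (\<tau> x)) w) \<subseteq> lcarrier L" using monomial by (auto simp: \<sigma>)
    ultimately have "\<pi> (scalar c \<otimes>\<^bsub>L.T\<^esub> word (map (\<lambda>x. \<sigma> (\<tau> x)) w)) = \<pi> (scalar c \<otimes>\<^bsub>L.T\<^esub> word w)"
      using monomial by (simp del: set_map)
    then show ?case by (simp add: relabel_monomial monomial_eq_scalar_word[symmetric] comp_def)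
  qed simp
  then have "a \<in> J" using st mem a by simp
  then show ?thesis using v unfolding J_def by blast
qed

theorem restriction_equivalence:
  "equivalent_categories
    (full_subcategory (red_mod TYPE('v) L f) (annihilated_by L f {x \<in> lcarrier L. \<tau> x = 0}))
    (red_mod TYPE('v) L' f')"
proof -
  obtain \<phi> where \<phi>: "\<phi> \<in> ring_hom (red_env L f) (red_env L' f')"
    "\<And>a. a \<in> carrier L.T \<Longrightarrow> \<phi> (red_class L f a) = red_class L' f' (relabel \<tau> a)"
    using projection_exists by blast
  interpret phi: surjective_ring_hom "red_env L f" "red_env L' f'" \<phi> "red_scalar L f" "red_scalar L' f'"
  proof (intro surjective_ring_hom.intro surjective_ring_hom_axioms.intro ring_hom_ringI2
      L.red_env_ring L'.red_env_ring \<phi>(1))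
    show "red_scalar L f c \<in> carrier (red_env L f)" for c by (simp add: red_scalar_def)
    show "\<phi> (red_scalar L f c) = red_scalar L' f' c" for c
      by (simp add: red_scalar_def \<phi>(2) relabel_scalar)
    fix b assume "b \<in> carrier (red_env L' f')"
    then obtain a' where a': "a' \<in> carrier L'.T" "red_class L' f' a' = b" using L'.red_class_surj by blast
    have "\<exists>a\<in>carrier L.T. relabel \<tau> a = a'"
      using a'(1)
    proof (induction rule: free_algebra_induct)
      case (monomial c w)
      then have "w \<in> map \<tau> ` lists (lcarrier L)" unfolding lists_image[symmetric] tau_image by auto
      then obtain u where "set u \<subseteq> lcarrier L" "w = map \<tau> u" by (auto simp: in_lists_conv_set)
      then show ?case by (intro bexI[of _ "monomial c u"]) (auto simp: relabel_monomial)
    next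
      case (add g h)
      then obtain a b where "a \<in> carrier L.T" "relabel \<tau> a = g" "b \<in> carrier L.T" "relabel \<tau> b = h" by blast
      then show ?case by (intro bexI[of _ "a \<oplus>\<^bsub>L.T\<^esub> b"]) auto
    qed
    then obtain a where "a \<in> carrier L.T" "relabel \<tau> a = a'" by blast
    then show "\<exists>a\<in>carrier (red_env L f). \<phi> a = b"
      using a' \<phi>(2) by (intro bexI[of _ "red_class L f a"]) auto
  qed
  show ?thesis
    unfolding red_mod_eq_fd_modules
  proof (rule phi.inflation_equivalence)
    fix M :: "(('a list \<Rightarrow> 'k) set set, 'v) module"
    assume "M \<in> obj (fd_modules TYPE('v) (red_env L f) (red_scalar L f))"
    then have M: "left_module (red_env L f) M" by (simp add: fd_modules_def)
    show "M \<in> annihilated_by L f {x \<in> lcarrier L. \<tau> x = 0} \<longleftrightarrow> M \<in> phi.killed"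
    proof
      assume A: "M \<in> annihilated_by L f {x \<in> lcarrier L. \<tau> x = 0}"
      show "M \<in> phi.killed"
        unfolding phi.killed_def
      proof (intro CollectI ballI impI)
        fix b v assume b: "b \<in> carrier (red_env L f)" "\<phi> b = \<zero>\<^bsub>red_env L' f'\<^esub>" and v: "v \<in> carrier M"
        obtain a where a: "a \<in> carrier L.T" "red_class L f a = b" using b(1) L.red_class_surj by blast
        show "b \<odot>\<^bsub>M\<^esub> v = \<zero>\<^bsub>M\<^esub>"
          using kernel_annihilates[OF M _ a(1) _ v] A a b(2) \<phi>(2)[OF a(1)]
          by (auto simp: annihilated_by_def)
      qed
    next
      assume K: "M \<in> phi.killed"
      have "\<phi> (red_incl L f x) = \<zero>\<^bsub>red_env L' f'\<^esub>" if "x \<in> lcarrier L" "\<tau> x = 0" for x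
        using that by (simp add: red_incl_def \<phi>(2) relabel_word L'.red_class_word_zero)
      then show "M \<in> annihilated_by L f {x \<in> lcarrier L. \<tau> x = 0}"
        using K by (auto simp: annihilated_by_def phi.killed_def) (simp add: red_incl_def)
    qed
  qed
qed

end

section \<open>Modules over a reduced enveloping algebra\<close>

lemma (in abelian_group) eq_add_if_diff_eq:
  assumes "a \<in> carrier G" "b \<in> carrier G" "a \<oplus> \<ominus> b = c"
  shows "a = b \<oplus> c"
proof -
  have "b \<oplus> (a \<oplus> \<ominus> b) = a \<oplus> (b \<oplus> \<ominus> b)" using assms(1,2) by (simp add: a_lcomm)
  then show ?thesis using assms by (simp add: r_neg)
qed

locale restricted_lie_module = restricted_lie_structure L + V: left_module "red_env L f" V
  for L :: "('k::field, 'a::ab_group_add) restricted_lie" and f :: "'a \<Rightarrow> 'k"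
    and V :: "(('a list \<Rightarrow> 'k) set set, 'v) module"
begin

sublocale q: ring_hom_ring T "red_env L f" "red_class L f" by (rule red_class_ring_hom)

definition act :: "'a \<Rightarrow> 'v \<Rightarrow> 'v" where "act x v = red_incl L f x \<odot>\<^bsub>V\<^esub> v"
definition sc :: "'k \<Rightarrow> 'v \<Rightarrow> 'v" where "sc c v = red_scalar L f c \<odot>\<^bsub>V\<^esub> v"

lemma act_eq: "act x v = red_class L f (word [x]) \<odot>\<^bsub>V\<^esub> v"
  and sc_eq: "sc c v = red_class L f (scalar c) \<odot>\<^bsub>V\<^esub> v"
  by (simp_all add: act_def sc_def red_incl_def red_scalar_def)

lemma rc_closed: "a \<in> carrier T \<Longrightarrow> red_class L f a \<in> carrier (red_env L f)"
  by (rule q.hom_closed)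

lemma word1_closed: "x \<in> lcarrier L \<Longrightarrow> word [x] \<in> carrier T"
  by simp

lemma act_closed [simp]: "x \<in> lcarrier L \<Longrightarrow> v \<in> carrier V \<Longrightarrow> act x v \<in> carrier V"
  unfolding act_eq by (intro V.lm_closed rc_closed word1_closed)

lemma sc_closed [simp]: "v \<in> carrier V \<Longrightarrow> sc c v \<in> carrier V"
  unfolding sc_eq by (intro V.lm_closed rc_closed scalar_closed)

lemma act_add_right: "x \<in> lcarrier L \<Longrightarrow> v \<in> carrier V \<Longrightarrow> w \<in> carrier V \<Longrightarrow>
    act x (v \<oplus>\<^bsub>V\<^esub> w) = act x v \<oplus>\<^bsub>V\<^esub> act x w"
  unfolding act_eq by (intro V.lm_add_right rc_closed word1_closed)

lemma sc_add_right: "v \<in> carrier V \<Longrightarrow> w \<in> carrier V \<Longrightarrow> sc c (v \<oplus>\<^bsub>V\<^esub> w) = sc c v \<oplus>\<^bsub>V\<^esub> sc c w"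
  unfolding sc_eq by (intro V.lm_add_right rc_closed scalar_closed)

lemma act_zero_right [simp]:
  assumes "x \<in> lcarrier L"
  shows "act x \<zero>\<^bsub>V\<^esub> = \<zero>\<^bsub>V\<^esub>"
proof -
  have "act x \<zero>\<^bsub>V\<^esub> \<oplus>\<^bsub>V\<^esub> act x \<zero>\<^bsub>V\<^esub> = act x \<zero>\<^bsub>V\<^esub>"
    using act_add_right[OF assms, of "\<zero>\<^bsub>V\<^esub>" "\<zero>\<^bsub>V\<^esub>"] by simp
  then show ?thesis using act_closed[OF assms, of "\<zero>\<^bsub>V\<^esub>"] by simp
qed

lemma sc_zero_right [simp]: "sc c \<zero>\<^bsub>V\<^esub> = \<zero>\<^bsub>V\<^esub>"
proof -
  have "sc c \<zero>\<^bsub>V\<^esub> \<oplus>\<^bsub>V\<^esub> sc c \<zero>\<^bsub>V\<^esub> = sc c \<zero>\<^bsub>V\<^esub>"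
    using sc_add_right[of "\<zero>\<^bsub>V\<^esub>" "\<zero>\<^bsub>V\<^esub>" c] by simp
  then show ?thesis using sc_closed[of "\<zero>\<^bsub>V\<^esub>" c] by simp
qed

lemma sc_one [simp]: "v \<in> carrier V \<Longrightarrow> sc 1 v = v"
  using V.lm_one q.hom_one unfolding sc_eq free_algebra_one word_eq_monomial scalar_eq_monomial by metis

lemma sc_sc: "v \<in> carrier V \<Longrightarrow> sc c (sc d v) = sc (c * d) v"
  unfolding sc_eq scalar_mult[where A = "lcarrier L"] q.hom_mult[OF scalar_closed scalar_closed]
  by (rule V.lm_mult[symmetric]) (intro rc_closed scalar_closed | assumption)+

lemma sc_add: "v \<in> carrier V \<Longrightarrow> sc (c + d) v = sc c v \<oplus>\<^bsub>V\<^esub> sc d v"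
  unfolding sc_eq scalar_add[where A = "lcarrier L"] q.hom_add[OF scalar_closed scalar_closed]
  by (rule V.lm_add_left) (intro rc_closed scalar_closed | assumption)+

lemma sc_zero [simp]:
  assumes "v \<in> carrier V"
  shows "sc 0 v = \<zero>\<^bsub>V\<^esub>"
proof -
  have "sc 0 v \<oplus>\<^bsub>V\<^esub> sc 0 v = sc 0 v"
    using sc_add[OF assms, of 0 0] by simp
  then show ?thesis using sc_closed[OF assms, of 0] by simp
qed

lemma sc_minus_one: "v \<in> carrier V \<Longrightarrow> sc (- 1) v = \<ominus>\<^bsub>V\<^esub> v"
  using sc_add[of v "-1" 1] V.minus_equality[of "sc (-1) v" v] by simp

lemma act_word: "set w \<subseteq> lcarrier L \<Longrightarrow> v \<in> carrier V \<Longrightarrow> red_class L f (word w) \<odot>\<^bsub>V\<^esub> v = foldr act w v"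
proof (induction w)
  case Nil
  then show ?case using V.lm_one q.hom_one unfolding free_algebra_one by simp
next
  case (Cons x w)
  have x: "x \<in> lcarrier L" and w: "set w \<subseteq> lcarrier L" using Cons.prems by auto
  have "red_class L f (word (x # w)) \<odot>\<^bsub>V\<^esub> v = (red_class L f (word [x]) \<otimes>\<^bsub>red_env L f\<^esub> red_class L f (word w)) \<odot>\<^bsub>V\<^esub> v"
    unfolding q.hom_mult[OF word1_closed[OF x] word_closed[OF w], symmetric] word_append[symmetric] by simp
  also have "\<dots> = act x (red_class L f (word w) \<odot>\<^bsub>V\<^esub> v)"
    unfolding act_eq by (intro V.lm_mult rc_closed word1_closed word_closed x w Cons.prems)
  finally show ?case using Cons.IH[OF w Cons.prems(2)] by simp
qed

lemma act_sc: assumes x: "x \<in> lcarrier L" and v: "v \<in> carrier V" shows "act x (sc c v) = sc c (act x v)"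
proof -
  have "act x (sc c v) = red_class L f (word [x] \<otimes>\<^bsub>T\<^esub> scalar c) \<odot>\<^bsub>V\<^esub> v"
    unfolding act_eq sc_eq q.hom_mult[OF word1_closed[OF x] scalar_closed]
    by (intro V.lm_mult[symmetric] rc_closed word1_closed scalar_closed x v)
  also have "\<dots> = sc c (act x v)"
    unfolding act_eq sc_eq word_mult_scalar q.hom_mult[OF scalar_closed word1_closed[OF x]]
    by (intro V.lm_mult rc_closed word1_closed scalar_closed x v)
  finally show ?thesis .
qed

lemma relation_act:
  assumes a: "a \<in> carrier T" and b: "b \<in> carrier T"
    and "red_class L f (a \<ominus>\<^bsub>T\<^esub> b) = \<zero>\<^bsub>red_env L f\<^esub>"
  shows "red_class L f a = red_class L f b"
proof -
  have "red_class L f a \<oplus>\<^bsub>red_env L f\<^esub> \<ominus>\<^bsub>red_env L f\<^esub> red_class L f b = \<zero>\<^bsub>red_env L f\<^esub>"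
    using assms(3) a b by (simp add: a_minus_def)
  then have "\<ominus>\<^bsub>red_env L f\<^esub> (\<ominus>\<^bsub>red_env L f\<^esub> red_class L f b) = red_class L f a"
    using rc_closed[OF a] rc_closed[OF b] by (intro V.R.minus_equality) auto
  then show ?thesis using rc_closed[OF b] by simp
qed

lemma act_add:
  assumes x: "x \<in> lcarrier L" and y: "y \<in> lcarrier L" and v: "v \<in> carrier V"
  shows "act (x + y) v = act x v \<oplus>\<^bsub>V\<^esub> act y v"
proof -
  note c = word1_closed[OF x] word1_closed[OF y]
  have "red_class L f (word [x + y]) = red_class L f (word [x] \<oplus>\<^bsub>T\<^esub> word [y])"
    by (rule relation_act[OF word1_closed[OF l_add[OF x y]] _ red_class_env_relation[OF env_relations_add[OF x y]]])
      (intro T.a_closed c)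
  then show ?thesis
    unfolding act_eq q.hom_add[OF c] using V.lm_add_left[OF rc_closed[OF c(1)] rc_closed[OF c(2)] v] by simp
qed

lemma act_scale:
  assumes x: "x \<in> lcarrier L" and v: "v \<in> carrier V"
  shows "act (lscale L c x) v = sc c (act x v)"
proof -
  have "red_class L f (word [lscale L c x]) = red_class L f (scalar c \<otimes>\<^bsub>T\<^esub> word [x])"
    by (rule relation_act[OF word1_closed[OF l_scale[OF x]] _ red_class_env_relation[OF env_relations_scale[OF x]]])
      (intro T.m_closed scalar_closed word1_closed x)
  then show ?thesis
    unfolding act_eq sc_eq q.hom_mult[OF scalar_closed word1_closed[OF x]]
    using V.lm_mult[OF rc_closed[OF scalar_closed] rc_closed[OF word1_closed[OF x]] v] by simp
qed

lemma act_zero: "v \<in> carrier V \<Longrightarrow> act 0 v = \<zero>\<^bsub>V\<^esub>"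
  using act_scale[OF l_zero, of v 0] l_zero by simp

lemma act_act:
  assumes x: "x \<in> lcarrier L" and y: "y \<in> lcarrier L" and v: "v \<in> carrier V"
  shows "act x (act y v) = act y (act x v) \<oplus>\<^bsub>V\<^esub> act (lbracket L x y) v"
proof -
  note c = word1_closed[OF x] word1_closed[OF y]
  note r = rc_closed[OF c(1)] rc_closed[OF c(2)] rc_closed[OF word1_closed[OF l_bracket[OF x y]]]
  have "red_class L f (word [x] \<otimes>\<^bsub>T\<^esub> word [y] \<ominus>\<^bsub>T\<^esub> word [y] \<otimes>\<^bsub>T\<^esub> word [x]) = red_class L f (word [lbracket L x y])"
    by (rule relation_act[OF _ word1_closed[OF l_bracket[OF x y]] red_class_env_relation[OF env_relations_bracket[OF x y]]])
      (intro T.minus_closed T.m_closed c)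
  then have "red_class L f (word [x]) \<otimes>\<^bsub>red_env L f\<^esub> red_class L f (word [y])
      \<oplus>\<^bsub>red_env L f\<^esub> \<ominus>\<^bsub>red_env L f\<^esub> (red_class L f (word [y]) \<otimes>\<^bsub>red_env L f\<^esub> red_class L f (word [x]))
      = red_class L f (word [lbracket L x y])"
    using c by (simp add: a_minus_def)
  then have "red_class L f (word [x]) \<otimes>\<^bsub>red_env L f\<^esub> red_class L f (word [y])
      = red_class L f (word [y]) \<otimes>\<^bsub>red_env L f\<^esub> red_class L f (word [x]) \<oplus>\<^bsub>red_env L f\<^esub> red_class L f (word [lbracket L x y])"
    using r by (intro V.R.eq_add_if_diff_eq V.R.m_closed)
  then have "(red_class L f (word [x]) \<otimes>\<^bsub>red_env L f\<^esub> red_class L f (word [y])) \<odot>\<^bsub>V\<^esub> v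
      = (red_class L f (word [y]) \<otimes>\<^bsub>red_env L f\<^esub> red_class L f (word [x]) \<oplus>\<^bsub>red_env L f\<^esub> red_class L f (word [lbracket L x y])) \<odot>\<^bsub>V\<^esub> v"
    by simp
  then show ?thesis
    using r v by (simp add: act_eq V.lm_mult V.lm_add_left)
qed

lemma act_funpow_closed [simp]: "x \<in> lcarrier L \<Longrightarrow> v \<in> carrier V \<Longrightarrow> (act x ^^ n) v \<in> carrier V"
  by (induction n) auto

lemma act_pmap:
  assumes x: "x \<in> lcarrier L" and v: "v \<in> carrier V"
  shows "(act x ^^ CHAR('k)) v = act (lpmap L x) v \<oplus>\<^bsub>V\<^esub> sc (f x ^ CHAR('k)) v"
proof -
  define p where "p = CHAR('k)"
  have w: "set (replicate p x) \<subseteq> lcarrier L" using x by auto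
  have c1: "word (replicate p x) \<in> carrier T" by (rule word_closed[OF w])
  note c = c1 word1_closed[OF l_pmap[OF x]] scalar_closed[of "f x ^ p" "lcarrier L"]
  note r = rc_closed[OF c(1)] rc_closed[OF c(2)] rc_closed[OF c(3)]
  have "red_class L f (word (replicate p x) \<ominus>\<^bsub>T\<^esub> word [lpmap L x]) = red_class L f (scalar (f x ^ p))"
    using red_class_p_relation[OF x, of f]
    by (intro relation_act T.minus_closed c) (simp add: p_relation_def word_pow p_def)
  then have "red_class L f (word (replicate p x)) \<oplus>\<^bsub>red_env L f\<^esub> \<ominus>\<^bsub>red_env L f\<^esub> red_class L f (word [lpmap L x])
     = red_class L f (scalar (f x ^ p))"
    using c by (simp add: a_minus_def)
  then have "red_class L f (word (replicate p x)) = red_class L f (word [lpmap L x]) \<oplus>\<^bsub>red_env L f\<^esub> red_class L f (scalar (f x ^ p))"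
    using r by (intro V.R.eq_add_if_diff_eq)
  then have "red_class L f (word (replicate p x)) \<odot>\<^bsub>V\<^esub> v = act (lpmap L x) v \<oplus>\<^bsub>V\<^esub> sc (f x ^ p) v"
    using r v by (simp add: act_eq sc_eq V.lm_add_left)
  moreover have "foldr act (replicate p x) v = (act x ^^ p) v" by (induction p) auto
  ultimately show ?thesis using act_word[OF w v] by (simp add: p_def)
qed

text \<open>Letters and scalars generate the reduced enveloping algebra.\<close>

lemma submodule_criterion:
  assumes sub: "N \<subseteq> carrier V" "\<zero>\<^bsub>V\<^esub> \<in> N" "\<And>v w. v \<in> N \<Longrightarrow> w \<in> N \<Longrightarrow> v \<oplus>\<^bsub>V\<^esub> w \<in> N"
    and sc: "\<And>c v. v \<in> N \<Longrightarrow> sc c v \<in> N"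
    and act: "\<And>x v. x \<in> lcarrier L \<Longrightarrow> v \<in> N \<Longrightarrow> act x v \<in> N"
  shows "submodule N (red_env L f) V"
proof -
  have neg: "\<ominus>\<^bsub>V\<^esub> v \<in> N" if "v \<in> N" for v
    using that sc[of v "-1"] sub(1) sc_minus_one[of v] by auto
  have "b \<odot>\<^bsub>V\<^esub> v \<in> N" if b: "b \<in> carrier (red_env L f)" and v: "v \<in> N" for b v
  proof -
    obtain a where a: "a \<in> carrier T" "red_class L f a = b" using red_class_surj[OF b] by blast
    have vV: "v \<in> carrier V" using v sub(1) by blast
    have "red_class L f a \<odot>\<^bsub>V\<^esub> v \<in> N"
      using a(1)
    proof (induction rule: free_algebra_induct)
      case (monomial c w)
      have "foldr act w v \<in> N" using monomial by (induction w) (auto simp: v intro: act)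
      moreover have "red_class L f (monomial c w) \<odot>\<^bsub>V\<^esub> v = sc c (foldr act w v)"
        unfolding monomial_eq_scalar_word[of c w "lcarrier L"] q.hom_mult[OF scalar_closed word_closed[OF monomial]]
          act_word[OF monomial vV, symmetric] sc_eq
        by (intro V.lm_mult rc_closed scalar_closed word_closed monomial vV)
      ultimately show ?case using sc by simp
    next
      case (add g h)
      then show ?case
        unfolding q.hom_add[OF add(1,2)] V.lm_add_left[OF rc_closed[OF add(1)] rc_closed[OF add(2)] vV]
        by (intro sub(3))
    qed
    then show ?thesis using a(2) by simp
  qed
  moreover have "subgroup N (add_monoid V)"
    using sub neg by (intro V.add.subgroupI) auto
  ultimately show ?thesis by (simp add: submodule_def submodule_axioms_def)
qed

subsection \<open>Linear spans\<close>

inductive_set lin_span :: "'v set \<Rightarrow> 'v set" for X where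
  zero: "\<zero>\<^bsub>V\<^esub> \<in> lin_span X"
| base: "v \<in> X \<Longrightarrow> v \<in> lin_span X"
| add: "v \<in> lin_span X \<Longrightarrow> w \<in> lin_span X \<Longrightarrow> v \<oplus>\<^bsub>V\<^esub> w \<in> lin_span X"
| scale: "v \<in> lin_span X \<Longrightarrow> sc c v \<in> lin_span X"

lemma lin_span_least: "X \<subseteq> lin_span Y \<Longrightarrow> lin_span X \<subseteq> lin_span Y"
proof
  fix v assume "v \<in> lin_span X" "X \<subseteq> lin_span Y"
  then show "v \<in> lin_span Y" by induction (auto intro: lin_span.intros)
qed

lemma lin_span_mono: "X \<subseteq> Y \<Longrightarrow> lin_span X \<subseteq> lin_span Y"
  by (rule lin_span_least) (auto intro: lin_span.base)

lemma lin_span_closed: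
  assumes "X \<subseteq> carrier V"
  shows "lin_span X \<subseteq> carrier V"
proof
  fix v assume "v \<in> lin_span X"
  then show "v \<in> carrier V" using assms by induction auto
qed

lemma act_lin_span:
  assumes "v \<in> lin_span X" "X \<subseteq> carrier V" "x \<in> lcarrier L" "act x ` X \<subseteq> lin_span Y"
  shows "act x v \<in> lin_span Y"
  using assms(1)
proof induction
  case (add v w)
  then show ?case using assms lin_span_closed[OF assms(2)]
    by (auto simp: act_add_right subset_iff intro!: lin_span.add)
next
  case (scale v c)
  then show ?case using assms lin_span_closed[OF assms(2)]
    by (auto simp: act_sc subset_iff intro!: lin_span.scale)
qed (use assms in \<open>auto intro: lin_span.zero\<close>)

lemma act_span:
  assumes x: "x \<in> vs.span B" and B: "B \<subseteq> lcarrier L" and v: "v \<in> carrier V"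
  shows "act x v \<in> lin_span ((\<lambda>b. act b v) ` B)"
proof -
  have "x \<in> lcarrier L \<and> act x v \<in> lin_span ((\<lambda>b. act b v) ` B)"
    using x
  proof (induction rule: vs.span_induct_alt)
    case base
    then show ?case using l_zero v by (auto simp: act_zero intro: lin_span.zero)
  next
    case (step c b y)
    then show ?case using B v
      by (auto simp: l_add l_scale act_add act_scale subset_iff intro!: lin_span.add lin_span.scale intro: lin_span.base)
  qed
  then show ?thesis by blast
qed

lemma finsum_of_lin_span:
  assumes fin: "finite X" and X: "X \<subseteq> carrier V" and v: "v \<in> lin_span X"
  shows "\<exists>c. v = finsum V (\<lambda>b. sc (c b) b) X"
  using v
proof induction
  case zero
  have "finsum V (\<lambda>b. sc 0 b) X = \<zero>\<^bsub>V\<^esub>" by (rule V.M.add.finprod_one_eqI) (use X in auto)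
  then show ?case by (intro exI[of _ "\<lambda>_. 0"]) simp
next
  case (base v)
  have "finsum V (\<lambda>b. sc (if v = b then 1 else 0) b) X = finsum V (\<lambda>b. if v = b then b else \<zero>\<^bsub>V\<^esub>) X"
    by (rule V.M.finsum_cong') (use X in auto)
  also have "\<dots> = v" using V.M.add.finprod_singleton[OF base fin, of "\<lambda>b. b"] X by auto
  finally show ?case by (intro exI[of _ "\<lambda>b. if v = b then 1 else 0"]) simp
next
  case (add v w)
  then obtain c d where "v = finsum V (\<lambda>b. sc (c b) b) X" "w = finsum V (\<lambda>b. sc (d b) b) X" by blast
  then have "v \<oplus>\<^bsub>V\<^esub> w = finsum V (\<lambda>b. sc (c b) b \<oplus>\<^bsub>V\<^esub> sc (d b) b) X"
    using X by (subst V.M.finsum_addf) auto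
  also have "\<dots> = finsum V (\<lambda>b. sc (c b + d b) b) X"
    by (rule V.M.finsum_cong') (use X in \<open>auto simp: sc_add\<close>)
  finally show ?case by (intro exI[of _ "\<lambda>b. c b + d b"]) simp
next
  case (scale v a)
  then obtain c where c: "v = finsum V (\<lambda>b. sc (c b) b) X" by blast
  have "sc a (finsum V (\<lambda>b. sc (c b) b) X) = finsum V (\<lambda>b. sc (a * c b) b) X"
    using fin X
  proof (induction X rule: finite_induct)
    case (insert x F)
    then have m: "(\<lambda>b. sc (c b) b) \<in> F \<rightarrow> carrier V" "(\<lambda>b. sc (a * c b) b) \<in> F \<rightarrow> carrier V" by auto
    then show ?case using insert
      by (simp add: V.M.finsum_insert sc_add_right V.M.finsum_closed sc_sc)
  qed simp
  then show ?case unfolding c by (rule exI[of _ "\<lambda>b. a * c b"])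
qed

lemma finite_dim_if_lin_span:
  assumes "finite X" "X \<subseteq> carrier V" "carrier V \<subseteq> lin_span X"
  shows "finite_dim_module (red_scalar L f) V"
  unfolding finite_dim_module_def sc_def[symmetric]
  using finsum_of_lin_span[OF assms(1,2)] assms by blast

end

section \<open>Simple modules\<close>

context restricted_lie_module
begin

text \<open>Inside the common kernel of the earlier operators, take the last nonzero iterate of the next one; it stays
  in that common kernel because the operators commute.\<close>

lemma common_kernel:
  assumes "finite B" "B \<subseteq> lcarrier L" and nz: "\<exists>v\<in>carrier V. v \<noteq> \<zero>\<^bsub>V\<^esub>"
    and comm: "\<And>x y v. x \<in> B \<Longrightarrow> y \<in> B \<Longrightarrow> v \<in> carrier V \<Longrightarrow> act x (act y v) = act y (act x v)"
    and nil: "\<And>x v. x \<in> B \<Longrightarrow> v \<in> carrier V \<Longrightarrow> (act x ^^ p) v = \<zero>\<^bsub>V\<^esub>"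
  shows "\<exists>v\<in>carrier V. v \<noteq> \<zero>\<^bsub>V\<^esub> \<and> (\<forall>b\<in>B. act b v = \<zero>\<^bsub>V\<^esub>)"
  using assms(1,2) comm nil
proof (induction B rule: finite_induct)
  case empty
  then show ?case using nz by blast
next
  case (insert x B)
  then obtain v where v: "v \<in> carrier V" "v \<noteq> \<zero>\<^bsub>V\<^esub>" "\<forall>b\<in>B. act b v = \<zero>\<^bsub>V\<^esub>"
    by (metis insert_iff insert_subset)
  have x: "x \<in> lcarrier L" using insert.prems by blast
  define n where "n = (LEAST n. (act x ^^ n) v = \<zero>\<^bsub>V\<^esub>)"
  have ex: "(act x ^^ p) v = \<zero>\<^bsub>V\<^esub>" using insert.prems(3)[of x v] v by blast
  have n0: "(act x ^^ n) v = \<zero>\<^bsub>V\<^esub>" unfolding n_def by (rule LeastI[of _ p]) (rule ex)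
  then have "n \<noteq> 0" using v by (intro notI) simp
  then obtain n' where n': "n = Suc n'" using not0_implies_Suc by blast
  define u where "u = (act x ^^ n') v"
  have "u \<noteq> \<zero>\<^bsub>V\<^esub>"
    unfolding u_def using not_less_Least[of n' "\<lambda>n. (act x ^^ n) v = \<zero>\<^bsub>V\<^esub>"] n' n_def by simp
  moreover have "u \<in> carrier V" using v x by (simp add: u_def)
  moreover have "act x u = \<zero>\<^bsub>V\<^esub>" using n0 by (simp add: u_def n')
  moreover have "act b u = \<zero>\<^bsub>V\<^esub>" if b: "b \<in> B" for b
  proof -
    have "act b ((act x ^^ j) v) = \<zero>\<^bsub>V\<^esub>" for j
    proof (induction j)
      case (Suc j)
      have "act b (act x ((act x ^^ j) v)) = act x (act b ((act x ^^ j) v))"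
        using insert.prems(2)[of b x] b v x by simp
      then show ?case using Suc x by simp
    qed (use v b in simp)
    then show ?thesis by (simp add: u_def)
  qed
  ultimately show ?case by blast
qed

text \<open>By the assumptions on brackets and \<open>p\<close>-th powers, \<open>U\<close> acts by commuting nilpotent operators. Their common
  kernel is nonzero, and it is a submodule because \<open>U\<close> is an ideal.\<close>

lemma simple_killed_step:
  assumes simple: "simple_left_module (red_env L f) V"
    and B: "finite B" "B \<subseteq> U" "U \<subseteq> vs.span B" and UL: "U \<subseteq> lcarrier L"
    and ideal: "\<And>x u. x \<in> lcarrier L \<Longrightarrow> u \<in> U \<Longrightarrow> lbracket L u x \<in> U"
    and bracket: "\<And>x y v. x \<in> U \<Longrightarrow> y \<in> U \<Longrightarrow> v \<in> carrier V \<Longrightarrow> act (lbracket L x y) v = \<zero>\<^bsub>V\<^esub>"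
    and pmap: "\<And>x v. x \<in> U \<Longrightarrow> v \<in> carrier V \<Longrightarrow> act (lpmap L x) v = \<zero>\<^bsub>V\<^esub>"
    and form: "\<And>x. x \<in> U \<Longrightarrow> f x = 0" and p: "CHAR('k) > 0"
    and x: "x \<in> U" and v: "v \<in> carrier V"
  shows "act x v = \<zero>\<^bsub>V\<^esub>"
proof -
  define W where "W = {v \<in> carrier V. \<forall>u\<in>U. act u v = \<zero>\<^bsub>V\<^esub>}"
  have "\<exists>v\<in>carrier V. v \<noteq> \<zero>\<^bsub>V\<^esub>" using simple V.M.zero_closed unfolding simple_left_module_def by blast
  moreover have "act x (act y v) = act y (act x v)" if "x \<in> B" "y \<in> B" "v \<in> carrier V" for x y v
  proof -
    have xy: "x \<in> U" "y \<in> U" "x \<in> lcarrier L" "y \<in> lcarrier L" using that B(2) UL by auto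
    show ?thesis using act_act[OF xy(3,4) that(3)] bracket[OF xy(1,2) that(3)] xy that by simp
  qed
  moreover have "(act x ^^ CHAR('k)) v = \<zero>\<^bsub>V\<^esub>" if "x \<in> B" "v \<in> carrier V" for x v
  proof -
    have xU: "x \<in> U" using that B(2) by blast
    show ?thesis
      using act_pmap[of x v] pmap[OF xU that(2)] form[OF xU] xU UL that(2) p by (simp add: subset_iff zero_power)
  qed
  ultimately obtain v0 where v0: "v0 \<in> carrier V" "v0 \<noteq> \<zero>\<^bsub>V\<^esub>" "\<forall>b\<in>B. act b v0 = \<zero>\<^bsub>V\<^esub>"
    using common_kernel[OF B(1), of "CHAR('k)"] B(2) UL by blast
  have "act u v0 = \<zero>\<^bsub>V\<^esub>" if "u \<in> U" for u
  proof -
    have "act u v0 \<in> lin_span ((\<lambda>b. act b v0) ` B)"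
      using that B UL v0 by (intro act_span) auto
    moreover have "w = \<zero>\<^bsub>V\<^esub>" if "w \<in> lin_span ((\<lambda>b. act b v0) ` B)" for w
      using that by induction (use v0 in auto)
    ultimately show ?thesis by blast
  qed
  then have "v0 \<in> W" using v0 by (simp add: W_def)
  moreover have "submodule W (red_env L f) V"
  proof (rule submodule_criterion)
    fix y w assume y: "y \<in> lcarrier L" and w: "w \<in> W"
    have "act u (act y w) = \<zero>\<^bsub>V\<^esub>" if u: "u \<in> U" for u
    proof -
      have uL: "u \<in> lcarrier L" using u UL by blast
      have "act u (act y w) = act y (act u w) \<oplus>\<^bsub>V\<^esub> act (lbracket L u y) w"
        using w by (intro act_act[OF uL y]) (simp add: W_def)
      then show ?thesis using w u y ideal[OF y u] by (simp add: W_def)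
    qed
    then show "act y w \<in> W" using y w by (simp add: W_def)
  qed (use UL in \<open>auto simp: W_def act_add_right act_sc subset_iff\<close>)
  ultimately have "W = carrier V" using simple v0(2) unfolding simple_left_module_def by blast
  then show ?thesis using x v by (auto simp: W_def)
qed

subsection \<open>Finite dimension\<close>

text \<open>The bound is strict, so that the corrections arising from a word of length \<open>n\<close> lie in the span of
  \<open>words B v n\<close> also for \<open>n = 0\<close>.\<close>

definition words :: "'a set \<Rightarrow> 'v \<Rightarrow> nat \<Rightarrow> 'v set" where
  "words B v n = {foldr act w v | w. set w \<subseteq> B \<and> length w < n}"

lemma foldr_act_closed [simp]: "set w \<subseteq> lcarrier L \<Longrightarrow> v \<in> carrier V \<Longrightarrow> foldr act w v \<in> carrier V"
  by (induction w) auto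

lemma words_closed: "B \<subseteq> lcarrier L \<Longrightarrow> v \<in> carrier V \<Longrightarrow> words B v n \<subseteq> carrier V"
  by (auto simp: words_def)

lemma words_mono: "B \<subseteq> B' \<Longrightarrow> n \<le> n' \<Longrightarrow> words B v n \<subseteq> words B' v n'"
  unfolding words_def by force

lemma act_words:
  assumes "u \<in> lin_span (words (lcarrier L) v n)" "v \<in> carrier V" "x \<in> lcarrier L"
  shows "act x u \<in> lin_span (words (lcarrier L) v (Suc n))"
proof (rule act_lin_span[OF assms(1) words_closed assms(3)])
  show "act x ` words (lcarrier L) v n \<subseteq> lin_span (words (lcarrier L) v (Suc n))"
  proof
    fix y assume "y \<in> act x ` words (lcarrier L) v n"
    then obtain w where "set w \<subseteq> lcarrier L" "length w < n" "y = foldr act (x # w) v"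
      by (auto simp: words_def)
    then show "y \<in> lin_span (words (lcarrier L) v (Suc n))"
      using assms(3) by (intro lin_span.base) (unfold words_def, intro CollectI exI[of _ "x # w"], simp)
  qed
qed (use assms in auto)

text \<open>Each transposition of neighbouring letters costs one word in which the two letters are replaced by their
  bracket. The words on both sides have length \<open>length w + c + 1\<close>, and the corrections are shorter.\<close>

lemma move_past_power:
  assumes v: "v \<in> carrier V" and x: "x \<in> lcarrier L" and b: "b \<in> lcarrier L" and w: "set w \<subseteq> lcarrier L"
  shows "\<exists>s \<in> lin_span (words (lcarrier L) v (Suc (length w + c))).
    act x ((act b ^^ c) (foldr act w v)) = (act b ^^ c) (act x (foldr act w v)) \<oplus>\<^bsub>V\<^esub> s"
proof (induction c)
  case 0
  then show ?case using v x w by (intro bexI[of _ "\<zero>\<^bsub>V\<^esub>"]) (auto intro: lin_span.zero)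
next
  case (Suc c)
  define u where "u = foldr act w v"
  have u: "u \<in> carrier V" using w v by (simp add: u_def)
  obtain s where s: "s \<in> lin_span (words (lcarrier L) v (Suc (length w + c)))"
    and eq: "act x ((act b ^^ c) u) = (act b ^^ c) (act x u) \<oplus>\<^bsub>V\<^esub> s" using Suc by (auto simp: u_def)
  have sV: "s \<in> carrier V" using s lin_span_closed[OF words_closed[OF order_refl v]] by blast
  define r where "r = act (lbracket L x b) ((act b ^^ c) u)"
  have "(act b ^^ c) u = foldr act (replicate c b @ w) v" by (induction c) (simp_all add: u_def)
  then have r: "r \<in> lin_span (words (lcarrier L) v (Suc (length w + Suc c)))"
    using w b x l_bracket unfolding r_def
    by (intro lin_span.base) (unfold words_def, intro CollectI exI[of _ "lbracket L x b # replicate c b @ w"], auto)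
  have rV: "r \<in> carrier V" using u x b l_bracket by (simp add: r_def)
  have "act x ((act b ^^ Suc c) u) = act b (act x ((act b ^^ c) u)) \<oplus>\<^bsub>V\<^esub> r"
    unfolding r_def using act_act[OF x b, of "(act b ^^ c) u"] b u by simp
  also have "\<dots> = ((act b ^^ Suc c) (act x u) \<oplus>\<^bsub>V\<^esub> act b s) \<oplus>\<^bsub>V\<^esub> r"
    unfolding eq using b u x sV by (simp add: act_add_right)
  also have "\<dots> = (act b ^^ Suc c) (act x u) \<oplus>\<^bsub>V\<^esub> (act b s \<oplus>\<^bsub>V\<^esub> r)"
    using b u x sV rV by (intro V.M.a_assoc act_funpow_closed act_closed)
  finally show ?case
    using r act_words[OF s v b] unfolding u_def[symmetric]
    by (intro bexI[of _ "act b s \<oplus>\<^bsub>V\<^esub> r"] lin_span.add) auto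
qed

text \<open>This brings all occurrences of \<open>b\<close> together, so that its \<open>p\<close>-th power can be rewritten.\<close>

lemma gather_letter:
  assumes v: "v \<in> carrier V" and b: "b \<in> lcarrier L" and w: "set w \<subseteq> lcarrier L"
  shows "\<exists>s \<in> lin_span (words (lcarrier L) v (length w)).
    foldr act w v = (act b ^^ count_list w b) (foldr act (filter (\<lambda>x. x \<noteq> b) w) v) \<oplus>\<^bsub>V\<^esub> s"
  using w
proof (induction w)
  case Nil
  then show ?case using v by (intro bexI[of _ "\<zero>\<^bsub>V\<^esub>"]) (auto intro: lin_span.zero)
next
  case (Cons x w)
  define w' where "w' = filter (\<lambda>x. x \<noteq> b) w"
  define c where "c = count_list w b"
  have x: "x \<in> lcarrier L" and w: "set w \<subseteq> lcarrier L" and w': "set w' \<subseteq> lcarrier L"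
    using Cons.prems by (auto simp: w'_def)
  have len: "length w' + c = length w"
    unfolding w'_def c_def by (induction w) auto
  obtain s where s: "s \<in> lin_span (words (lcarrier L) v (length w))"
    and eq: "foldr act w v = (act b ^^ c) (foldr act w' v) \<oplus>\<^bsub>V\<^esub> s"
    using Cons.IH[OF w] by (auto simp: w'_def c_def)
  have sV: "s \<in> carrier V" using s lin_span_closed[OF words_closed[OF order_refl v]] by blast
  have xs: "act x s \<in> lin_span (words (lcarrier L) v (Suc (length w)))" by (rule act_words[OF s v x])
  have eq': "foldr act (x # w) v = act x ((act b ^^ c) (foldr act w' v)) \<oplus>\<^bsub>V\<^esub> act x s"
    unfolding foldr.simps comp_apply eq using x b v w' sV by (simp add: act_add_right)
  show ?case
  proof (cases "x = b")
    case True
    then show ?thesis using eq' xs by (intro bexI[of _ "act x s"]) (simp_all add: w'_def c_def)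
  next
    case False
    obtain r where r: "r \<in> lin_span (words (lcarrier L) v (Suc (length w' + c)))"
      and r_eq: "act x ((act b ^^ c) (foldr act w' v)) = (act b ^^ c) (act x (foldr act w' v)) \<oplus>\<^bsub>V\<^esub> r"
      using move_past_power[OF v x b w'] by blast
    have rV: "r \<in> carrier V" using r lin_span_closed[OF words_closed[OF order_refl v]] by blast
    have "foldr act (x # w) v = (act b ^^ c) (act x (foldr act w' v)) \<oplus>\<^bsub>V\<^esub> (r \<oplus>\<^bsub>V\<^esub> act x s)"
      unfolding eq' r_eq using x b v w' sV rV by (intro V.M.a_assoc act_funpow_closed act_closed foldr_act_closed)
    moreover have "r \<oplus>\<^bsub>V\<^esub> act x s \<in> lin_span (words (lcarrier L) v (length (x # w)))"
      using r xs len by (intro lin_span.add) simp_all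
    ultimately show ?thesis using False by (intro bexI[of _ "r \<oplus>\<^bsub>V\<^esub> act x s"]) (simp_all add: w'_def c_def)
  qed
qed

text \<open>After gathering, \<open>p\<close> of the occurrences of \<open>b\<close> are replaced by one letter plus a scalar.\<close>

lemma shorten_word:
  assumes v: "v \<in> carrier V" and b: "b \<in> lcarrier L" and w: "set w \<subseteq> lcarrier L"
    and count: "count_list w b \<ge> CHAR('k)" and p: "CHAR('k) > 1"
  shows "foldr act w v \<in> lin_span (words (lcarrier L) v (length w))"
proof -
  define w' where "w' = filter (\<lambda>x. x \<noteq> b) w"
  define d where "d = count_list w b - CHAR('k)"
  have w': "set w' \<subseteq> lcarrier L" using w by (auto simp: w'_def)
  have len: "length w' + (CHAR('k) + d) = length w"
  proof -
    have "length w' + count_list w b = length w" unfolding w'_def by (induction w) auto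
    then show ?thesis using count by (simp add: d_def)
  qed
  have cnt: "count_list w b = CHAR('k) + d" using count by (simp add: d_def)
  define u where "u = (act b ^^ d) (foldr act w' v)"
  have u: "u = foldr act (replicate d b @ w') v" unfolding u_def by (induction d) simp_all
  have uV: "u \<in> carrier V" using b w' v by (simp add: u_def)
  have "(act b ^^ count_list w b) (foldr act w' v) = (act b ^^ CHAR('k)) u"
    unfolding cnt funpow_add u_def by simp
  also have "\<dots> = act (lpmap L b) u \<oplus>\<^bsub>V\<^esub> sc (f b ^ CHAR('k)) u" by (rule act_pmap[OF b uV])
  also have "\<dots> \<in> lin_span (words (lcarrier L) v (length w))"
  proof (intro lin_span.add lin_span.scale lin_span.base)
    show "act (lpmap L b) u \<in> words (lcarrier L) v (length w)"
      unfolding words_def u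
      by (intro CollectI exI[of _ "lpmap L b # replicate d b @ w'"]) (use b w' len p l_pmap in auto)
    show "u \<in> words (lcarrier L) v (length w)"
      unfolding words_def u
      by (intro CollectI exI[of _ "replicate d b @ w'"]) (use b w' len p in auto)
  qed
  finally have "(act b ^^ count_list w b) (foldr act w' v) \<in> lin_span (words (lcarrier L) v (length w))" .
  then show ?thesis using gather_letter[OF v b w] unfolding w'_def by (auto intro: lin_span.add)
qed

text \<open>Words depend linearly on each of their letters.\<close>

lemma words_of_spanning_set:
  assumes B: "B \<subseteq> lcarrier L" "lcarrier L \<subseteq> vs.span B" and v: "v \<in> carrier V"
  shows "words (lcarrier L) v n \<subseteq> lin_span (words B v n)"
proof
  have gen: "foldr act w v \<in> lin_span {foldr act w' v | w'. set w' \<subseteq> B \<and> length w' = length w}"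
    if "set w \<subseteq> lcarrier L" for w
    using that
  proof (induction w)
    case Nil
    then show ?case by (intro lin_span.base) simp
  next
    case (Cons x w)
    let ?X = "{foldr act w' v | w'. set w' \<subseteq> B \<and> length w' = length w}"
    let ?Y = "{foldr act w' v | w'. set w' \<subseteq> B \<and> length w' = length (x # w)}"
    have X: "?X \<subseteq> carrier V" using B(1) v by auto
    have x: "x \<in> lcarrier L" using Cons.prems by simp
    have "act x ` ?X \<subseteq> lin_span ?Y"
    proof
      fix y assume "y \<in> act x ` ?X"
      then obtain w' where w': "set w' \<subseteq> B" "length w' = length w" "y = act x (foldr act w' v)" by blast
      have "y \<in> lin_span ((\<lambda>b. act b (foldr act w' v)) ` B)"
        unfolding w'(3) using B w'(1) v x by (intro act_span) auto
      moreover have "(\<lambda>b. act b (foldr act w' v)) ` B \<subseteq> ?Y"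
      proof
        fix z assume "z \<in> (\<lambda>b. act b (foldr act w' v)) ` B"
        then obtain b where "b \<in> B" "z = foldr act (b # w') v" by auto
        then show "z \<in> ?Y" using w' by (intro CollectI exI[of _ "b # w'"]) auto
      qed
      ultimately show "y \<in> lin_span ?Y" using lin_span_mono by blast
    qed
    with Cons show ?case using act_lin_span[OF _ X x] by simp
  qed
  fix y assume "y \<in> words (lcarrier L) v n"
  then obtain w where w: "set w \<subseteq> lcarrier L" "length w < n" "y = foldr act w v" by (auto simp: words_def)
  have "{foldr act w' v | w'. set w' \<subseteq> B \<and> length w' = length w} \<subseteq> words B v n"
    using w(2) by (auto simp: words_def)
  then show "y \<in> lin_span (words B v n)" using gen[OF w(1)] lin_span_mono w(3) by blast
qed

text \<open>By the pigeonhole principle, in a word with more than \<open>(p - 1) |B|\<close> letters some letter occurs \<open>p\<close> times.\<close>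

lemma bounded_words_suffice:
  assumes B: "finite B" "B \<subseteq> lcarrier L" "lcarrier L \<subseteq> vs.span B" and v: "v \<in> carrier V" and p: "CHAR('k) > 1"
  shows "words B v n \<subseteq> lin_span (words B v (Suc (card B * (CHAR('k) - 1))))"
proof (induction n rule: less_induct)
  case (less n)
  let ?N = "card B * (CHAR('k) - 1)"
  show ?case
  proof
    fix y assume "y \<in> words B v n"
    then obtain w where w: "set w \<subseteq> B" "length w < n" "y = foldr act w v" by (auto simp: words_def)
    show "y \<in> lin_span (words B v (Suc ?N))"
    proof (cases "length w \<le> ?N")
      case True
      then show ?thesis using w by (intro lin_span.base) (auto simp: words_def)
    next
      case False
      have "\<exists>b\<in>B. count_list w b \<ge> CHAR('k)"
      proof (rule ccontr)
        assume "\<not> ?thesis"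
        then have "sum (count_list w) B \<le> of_nat (card B) * (CHAR('k) - 1)"
          using p by (intro sum_bounded_above) force
        then show False using False sum_count_set[OF w(1) B(1)] by simp
      qed
      then obtain b where "b \<in> B" "count_list w b \<ge> CHAR('k)" by blast
      then have "y \<in> lin_span (words (lcarrier L) v (length w))"
        unfolding w(3) using w(1) B(2) by (intro shorten_word[OF v _ _ _ p, of b]) auto
      also have "\<dots> \<subseteq> lin_span (words B v (length w))"
        by (rule lin_span_least[OF words_of_spanning_set[OF B(2,3) v]])
      also have "\<dots> \<subseteq> lin_span (words B v (Suc ?N))"
        by (rule lin_span_least[OF less.IH[OF w(2)]])
      finally show ?thesis .
    qed
  qed
qed

text \<open>A simple module is generated by any nonzero vector \<open>v\<close>, that is, spanned by the words applied to \<open>v\<close>.\<close>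

lemma simple_finite_dim:
  assumes simple: "simple_left_module (red_env L f) V"
    and B: "finite B" "B \<subseteq> lcarrier L" "lcarrier L \<subseteq> vs.span B" and p: "CHAR('k) > 1"
  shows "finite_dim_module (red_scalar L f) V"
proof -
  obtain v where v: "v \<in> carrier V" "v \<noteq> \<zero>\<^bsub>V\<^esub>"
    using simple V.M.zero_closed unfolding simple_left_module_def by blast
  define N where "N = Suc (card B * (CHAR('k) - 1))"
  define X where "X = words B v N"
  have all: "lin_span (words (lcarrier L) v n) \<subseteq> lin_span X" for n
    unfolding X_def N_def
    using lin_span_least[OF words_of_spanning_set[OF B(2,3) v(1)]] lin_span_least[OF bounded_words_suffice[OF B v(1) p]]
    by blast
  have XV: "X \<subseteq> carrier V" unfolding X_def by (rule words_closed[OF B(2) v(1)])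
  have "X \<subseteq> (\<lambda>w. foldr act w v) ` {w. set w \<subseteq> B \<and> length w \<le> N}" by (auto simp: X_def words_def)
  then have fin: "finite X" using finite_lists_length_le[OF B(1)] by (meson finite_imageI finite_subset)
  have "submodule (lin_span X) (red_env L f) V"
  proof (rule submodule_criterion[OF lin_span_closed[OF XV]])
    fix x u assume x: "x \<in> lcarrier L" and u: "u \<in> lin_span X"
    have "u \<in> lin_span (words (lcarrier L) v N)"
      using u lin_span_mono[OF words_mono[OF B(2) order_refl]] unfolding X_def by blast
    then show "act x u \<in> lin_span X" using act_words[OF _ v(1) x] all by blast
  qed (auto intro: lin_span.intros)
  moreover have "v \<in> lin_span X"
    unfolding X_def N_def words_def by (intro lin_span.base CollectI exI[of _ "[]"]) simp
  ultimately have "lin_span X = carrier V" using simple v(2) unfolding simple_left_module_def by blast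
  then show ?thesis using finite_dim_if_lin_span[OF fin XV] by simp
qed

end

section \<open>Dimensions\<close>

lemma (in vector_space) finite_spanning_subset:
  assumes "S \<subseteq> span F" "finite F"
  obtains B where "finite B" "B \<subseteq> S" "independent B" "S \<subseteq> span B"
proof -
  obtain B where B: "B \<subseteq> S" "independent B" "S \<subseteq> span B" using maximal_independent_subset by blast
  moreover have "finite B" using independent_span_bound[OF assms(2) B(2)] B(1) assms(1) by blast
  ultimately show ?thesis using that by blast
qed

lemma (in vector_space) dim_direct_sum:
  assumes S: "subspace S" and N: "subspace N" and int: "S \<inter> N \<subseteq> {0}"
    and fin: "finite F" "S \<subseteq> span F" "N \<subseteq> span F"
  shows "dim {x + y | x y. x \<in> S \<and> y \<in> N} = dim S + dim N"
proof -
  obtain B where B: "finite B" "B \<subseteq> S" "independent B" "S \<subseteq> span B"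
    by (rule finite_spanning_subset[OF fin(2,1)])
  obtain C where C: "finite C" "C \<subseteq> N" "independent C" "N \<subseteq> span C"
    by (rule finite_spanning_subset[OF fin(3,1)])
  have disj: "B \<inter> C = {}" using B(2,3) C(2) int dependent_zero by blast
  have "independent (B \<union> C)"
  proof (rule independent_if_scalars_zero)
    fix c x assume sum: "(\<Sum>x\<in>B \<union> C. scale (c x) x) = 0" and x: "x \<in> B \<union> C"
    have split: "(\<Sum>x\<in>B. scale (c x) x) + (\<Sum>x\<in>C. scale (c x) x) = 0"
      using sum unfolding sum.union_disjoint[OF B(1) C(1) disj] .
    have inS: "(\<Sum>x\<in>B. scale (c x) x) \<in> S" using B(2) by (intro subspace_sum[OF S] subspace_scale[OF S]) auto
    have inN: "(\<Sum>x\<in>C. scale (c x) x) \<in> N" using C(2) by (intro subspace_sum[OF N] subspace_scale[OF N]) auto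
    have "(\<Sum>x\<in>B. scale (c x) x) = - (\<Sum>x\<in>C. scale (c x) x)" using split by (simp add: eq_neg_iff_add_eq_0)
    then have "(\<Sum>x\<in>B. scale (c x) x) \<in> S \<inter> N" using inS subspace_neg[OF N inN] by simp
    then have zero: "(\<Sum>x\<in>B. scale (c x) x) = 0" "(\<Sum>x\<in>C. scale (c x) x) = 0" using int split by auto
    show "c x = 0" using x independentD[OF B(3,1) order_refl zero(1)] independentD[OF C(3,1) order_refl zero(2)] by blast
  qed (use B C in auto)
  moreover have "B \<union> C \<subseteq> {x + y | x y. x \<in> S \<and> y \<in> N}"
    using B(2) C(2) subspace_0[OF S] subspace_0[OF N] by force
  moreover have "{x + y | x y. x \<in> S \<and> y \<in> N} \<subseteq> span (B \<union> C)"
    using B(4) C(4) span_mono[of B "B \<union> C"] span_mono[of C "B \<union> C"] by (auto intro!: span_add)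
  ultimately have "dim {x + y | x y. x \<in> S \<and> y \<in> N} = card (B \<union> C)"
    using basis_card_eq_dim[of "B \<union> C" "{x + y | x y. x \<in> S \<and> y \<in> N}"] by simp
  also have "\<dots> = card B + card C" using card_Un_disjoint[OF B(1) C(1) disj] .
  also have "card B = dim S" using basis_card_eq_dim[OF B(2,4,3)] .
  also have "card C = dim N" using basis_card_eq_dim[OF C(2,4,3)] .
  finally show ?thesis .
qed

context matrix_restricted_lie
begin

lemma above_ideal:
  assumes "x \<in> current_above \<gg> m k" "y \<in> lcarrier (cur m)"
  shows "lbracket (cur m) x y \<in> current_above \<gg> m k"
proof -
  have "lbracket (cur m) x y r = 0" if "r \<le> k" for r
    using that assms by (auto simp: current_lie_def tmult_def current_above_def)
  then show ?thesis using assms cur_bracket by (auto simp: current_above_def)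
qed

lemma cur_subspace: "module.subspace (lscale (cur m)) (lcarrier (cur m))"
proof -
  interpret vs: vector_space "lscale (cur m)" by (rule cur_vector_space)
  show ?thesis by (auto simp: vs.subspace_def cur_zero cur_add cur_scale)
qed

lemma cur_structure: "restricted_lie_structure (cur m)"
  using cur_vector_space cur_subspace cur_bracket cur_pmap by (intro restricted_lie_structure.intro)

lemma form_trunc:
  assumes h: "h \<in> lie_dual (cur m)" and zero: "\<forall>x\<in>current_above \<gg> m k. h x = 0" and km: "k \<le> m"
    and x: "x \<in> lcarrier (cur m)"
  shows "h (trunc k x) = h x"
proof -
  have t: "trunc k x \<in> lcarrier (cur m)" using trunc_mem[OF km x] cur_mono[OF km] by blast
  have "x - trunc k x \<in> current_above \<gg> m k"
    unfolding above_iff_trunc using cur_diff[OF x t] by (simp add: trunc_diff trunc_trunc)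
  moreover from this have "h ((x - trunc k x) + trunc k x) = h (x - trunc k x) + h (trunc k x)"
    using h t by (simp only: lie_dual_def mem_Collect_eq above_iff_trunc)
  ultimately show ?thesis using zero by simp
qed

lemma truncation_epi:
  assumes "h \<in> lie_dual (cur m)" "\<forall>x\<in>current_above \<gg> m k. h x = 0" and km: "k \<le> m"
  shows "restricted_lie_epi (cur m) (cur k) (trunc k) h (restrict h (lcarrier (cur k)))"
proof (intro restricted_lie_epi.intro restricted_lie_epi_axioms.intro cur_structure)
  show "trunc k ` lcarrier (cur m) = lcarrier (cur k)"
  proof (intro equalityI image_subsetI trunc_mem[OF km] subsetI)
    fix y assume y: "y \<in> lcarrier (cur k)"
    show "y \<in> trunc k ` lcarrier (cur m)"
    proof (rule image_eqI)
      show "y = trunc k y" by (rule trunc_id[OF y, symmetric])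
    qed (rule subsetD[OF cur_mono[OF km] y])
  qed
  show "restrict h (lcarrier (cur k)) (trunc k x) = h x" if "x \<in> lcarrier (cur m)" for x
    using form_trunc[OF assms that] trunc_mem[OF km that] by simp
qed (simp_all add: trunc_add trunc_scale trunc_bracket trunc_pmap km)

text \<open>Descending induction on the degree: once the part of degree above \<open>j + 1\<close> acts by zero, so does the part of
  degree above \<open>j\<close>.\<close>

lemma simple_killed_by_above:
  fixes V :: "(((nat \<Rightarrow> 'k^'n^'n) list \<Rightarrow> 'k) set set, 'v) module"
  assumes vanish: "\<forall>x\<in>current_above \<gg> m k. h x = 0" and km: "k \<le> m"
    and simple: "simple_left_module (red_env (cur m) h) V"
    and x: "x \<in> current_above \<gg> m k" and v: "v \<in> carrier V"
  shows "red_incl (cur m) h x \<odot>\<^bsub>V\<^esub> v = \<zero>\<^bsub>V\<^esub>"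
proof -
  interpret restricted_lie_module "cur m" h V
    using simple by (intro restricted_lie_module.intro cur_structure) (simp add: simple_left_module_def)
  have sub: "current_above \<gg> m j \<subseteq> lcarrier (cur m)" for j by (auto simp: current_above_def)
  obtain F where F: "finite F" "lcarrier (cur m) \<subseteq> vs.span F" using cur_finitely_spanned by blast
  from km have "\<forall>x\<in>current_above \<gg> m k. \<forall>v\<in>carrier V. act x v = \<zero>\<^bsub>V\<^esub>"
  proof (induction rule: inc_induct)
    case base
    have "x = 0" if "x \<in> current_above \<gg> m m" for x
    proof
      fix i show "x i = 0 i"
        using that by (cases "i \<le> m") (auto simp: current_above_def cur_mem_iff)
    qed
    then show ?case using act_zero by blast
  next
    case (step j)
    have "current_above \<gg> m j \<subseteq> vs.span F" using sub F(2) by blast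
    then obtain B where B: "finite B" "B \<subseteq> current_above \<gg> m j" "\<not> vs.dependent B"
        "current_above \<gg> m j \<subseteq> vs.span B"
      by (rule vs.finite_spanning_subset[OF _ F(1)])
    have "current_above \<gg> m j \<subseteq> current_above \<gg> m k" using step(1) by (auto simp: current_above_def)
    then have form: "h x = 0" if "x \<in> current_above \<gg> m j" for x using vanish that by blast
    show ?case
    proof (intro ballI, rule simple_killed_step[OF simple B(1,2,4) sub _ _ _ _ CHAR_pos])
      show "lbracket (cur m) u x \<in> current_above \<gg> m j"
        if "x \<in> lcarrier (cur m)" "u \<in> current_above \<gg> m j" for x u
        using that by (intro above_ideal)
      show "act (lbracket (cur m) x y) v = \<zero>\<^bsub>V\<^esub>"
        if "x \<in> current_above \<gg> m j" "y \<in> current_above \<gg> m j" "v \<in> carrier V" for x y v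
        using step.IH bracket_above[OF that(1,2)] that(3) by blast
      show "act (lpmap (cur m) x) v = \<zero>\<^bsub>V\<^esub>"
        if "x \<in> current_above \<gg> m j" "v \<in> carrier V" for x v
        using step.IH pmap_above[OF that(1)] that(2) by blast
    qed (use form in blast)
  qed
  then show ?thesis using x v by (simp add: act_def)
qed

lemma simple_cur_finite_dim:
  fixes V :: "(((nat \<Rightarrow> 'k^'n^'n) list \<Rightarrow> 'k) set set, 'v) module"
  assumes simple: "simple_left_module (red_env (cur m) h) V"
  shows "finite_dim_module (red_scalar (cur m) h) V"
proof -
  interpret restricted_lie_module "cur m" h V
    using simple by (intro restricted_lie_module.intro cur_structure) (simp add: simple_left_module_def)
  obtain F where F: "finite F" "lcarrier (cur m) \<subseteq> vs.span F" using cur_finitely_spanned by blast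
  obtain B where B: "finite B" "B \<subseteq> lcarrier (cur m)" "\<not> vs.dependent B" "lcarrier (cur m) \<subseteq> vs.span B"
    by (rule vs.finite_spanning_subset[OF F(2,1)])
  have "CHAR('k) > 1" using CHAR_pos prime_CHAR_semidom prime_gt_1_nat by blast
  then show ?thesis by (rule simple_finite_dim[OF simple B(1,2,4)])
qed

text \<open>The value \<open>h [x, y]\<close> involves only the components of \<open>x\<close> and \<open>y\<close> of degree at most \<open>k\<close>.\<close>

lemma stabilizer_trunc:
  assumes "h \<in> lie_dual (cur m)" "\<forall>x\<in>current_above \<gg> m k. h x = 0" and km: "k \<le> m"
    and x: "x \<in> lcarrier (cur m)"
  shows "x \<in> lie_stabilizer (cur m) h \<longleftrightarrow>
    trunc k x \<in> lie_stabilizer (cur k) (restrict h (lcarrier (cur k)))"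
proof -
  have eq: "h (lbracket (cur m) x y) = restrict h (lcarrier (cur k)) (lbracket (cur k) (trunc k x) (trunc k y))"
    if y: "y \<in> lcarrier (cur m)" for y
    using form_trunc[OF assms(1-3) cur_bracket[OF x y]] cur_bracket[OF trunc_mem[OF km x] trunc_mem[OF km y]]
    by (simp add: trunc_bracket[OF km])
  show ?thesis
    unfolding lie_stabilizer_def mem_Collect_eq
  proof (intro iffI conjI ballI)
    fix y assume "x \<in> lcarrier (cur m) \<and> (\<forall>y\<in>lcarrier (cur m). h (lbracket (cur m) x y) = 0)"
      and y: "y \<in> lcarrier (cur k)"
    then have "h (lbracket (cur m) x y) = 0" using cur_mono[OF km] by blast
    then show "restrict h (lcarrier (cur k)) (lbracket (cur k) (trunc k x) y) = 0"
      using eq[OF subsetD[OF cur_mono[OF km] y]] by (simp only: trunc_id[OF y])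
  next
    fix y assume "trunc k x \<in> lcarrier (cur k) \<and>
        (\<forall>y\<in>lcarrier (cur k). restrict h (lcarrier (cur k)) (lbracket (cur k) (trunc k x) y) = 0)"
      and y: "y \<in> lcarrier (cur m)"
    then show "h (lbracket (cur m) x y) = 0" using eq[OF y] trunc_mem[OF km y] by (simp only:)
  qed (use x trunc_mem[OF km x] in simp_all)
qed

lemma stabilizer_subspace:
  assumes h: "\<And>x y. x \<in> lcarrier (cur m) \<Longrightarrow> y \<in> lcarrier (cur m) \<Longrightarrow> h (x + y) = h x + h y"
      "\<And>c x. x \<in> lcarrier (cur m) \<Longrightarrow> h (lscale (cur m) c x) = c * h x"
  shows "module.subspace (lscale (cur m)) (lie_stabilizer (cur m) h)"
proof -
  interpret vs: vector_space "lscale (cur m)" by (rule cur_vector_space)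
  have add: "lbracket (cur m) (x + x') y = lbracket (cur m) x y + lbracket (cur m) x' y" for x x' y
    by (auto simp: current_lie_def tmult_def fun_eq_iff matrix_add_ldistrib matrix_add_rdistrib sum.distrib)
  have scale: "lbracket (cur m) (lscale (cur m) c x) y = lscale (cur m) c (lbracket (cur m) x y)" for c x y
    by (auto simp: current_lie_def tmult_def fun_eq_iff mscale_sum[symmetric])
      (auto simp: mscale_def vec_eq_iff algebra_simps)
  have "h 0 = 0" using h(2)[OF cur_zero, of 0] by simp
  then have "h (lbracket (cur m) 0 y) = 0" for y
    using scale[of 0 0 y] by simp
  then show ?thesis
    by (auto simp: vs.subspace_def lie_stabilizer_def cur_zero cur_add cur_scale add scale h cur_bracket)
qed

text \<open>Both spaces on the left are preimages under truncation of the spaces on the right, and the kernel of the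
  truncation contributes the same dimension to both.\<close>

lemma dim_stabilizer:
  assumes h: "h \<in> lie_dual (cur m)" "\<forall>x\<in>current_above \<gg> m k. h x = 0" and km: "k \<le> m"
  shows "int (ldim (cur m) (lcarrier (cur m))) - int (ldim (cur m) (lie_stabilizer (cur m) h))
    = int (ldim (cur k) (lcarrier (cur k)))
      - int (ldim (cur k) (lie_stabilizer (cur k) (restrict h (lcarrier (cur k)))))"
proof -
  interpret vs: vector_space "lscale (cur m)" by (rule cur_vector_space)
  define h0 where "h0 = restrict h (lcarrier (cur k))"
  define N where "N = current_above \<gg> m k"
  have sc: "lscale (cur k) = lscale (cur m)" by (simp add: current_lie_def)
  obtain F where F: "finite F" "lcarrier (cur m) \<subseteq> vs.span F" using cur_finitely_spanned by blast
  have N: "vs.subspace N"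
    unfolding N_def vs.subspace_def
    by (auto simp: above_iff_trunc cur_zero cur_add cur_scale trunc_add trunc_scale) 
      (auto simp: trunc_def fun_eq_iff current_lie_def)
  have split: "ldim (cur m) {x \<in> lcarrier (cur m). trunc k x \<in> S} = vs.dim S + vs.dim N"
    if S: "vs.subspace S" "S \<subseteq> lcarrier (cur k)" for S
  proof -
    have "{x \<in> lcarrier (cur m). trunc k x \<in> S} = {x + y | x y. x \<in> S \<and> y \<in> N}"
    proof (intro equalityI subsetI)
      fix x assume "x \<in> {x \<in> lcarrier (cur m). trunc k x \<in> S}"
      then have x: "x \<in> lcarrier (cur m)" "trunc k x \<in> S" by auto
      have "x - trunc k x \<in> N"
        unfolding N_def above_iff_trunc using x S(2) cur_mono[OF km]
        by (auto simp: trunc_diff trunc_trunc intro!: cur_diff)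
      then show "x \<in> {x + y | x y. x \<in> S \<and> y \<in> N}"
        using x(2) by (intro CollectI exI[of _ "trunc k x"] exI[of _ "x - trunc k x"]) simp
    next
      fix z assume "z \<in> {x + y | x y. x \<in> S \<and> y \<in> N}"
      then obtain x y where xy: "x \<in> S" "y \<in> N" "z = x + y" by blast
      have "trunc k z = x" using xy S(2) trunc_id by (auto simp: trunc_add N_def above_iff_trunc)
      moreover have "z \<in> lcarrier (cur m)"
        using xy S(2) cur_mono[OF km] by (auto simp: N_def above_iff_trunc intro!: cur_add)
      ultimately show "z \<in> {x \<in> lcarrier (cur m). trunc k x \<in> S}" using xy(1) by simp
    qed
    moreover have "S \<inter> N \<subseteq> {0}"
      using S(2) trunc_id by (auto simp: N_def above_iff_trunc)
    moreover have "S \<subseteq> vs.span F" "N \<subseteq> vs.span F"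
      using S(2) cur_mono[OF km] F(2) by (auto simp: N_def current_above_def)
    ultimately show ?thesis using vs.dim_direct_sum[OF S(1) N _ F(1)] by (simp add: ldim_def)
  qed
  have "{x \<in> lcarrier (cur m). trunc k x \<in> lcarrier (cur k)} = lcarrier (cur m)" using trunc_mem[OF km] by blast
  then have 1: "ldim (cur m) (lcarrier (cur m)) = vs.dim (lcarrier (cur k)) + vs.dim N"
    using split[OF cur_subspace[of k, unfolded sc] order_refl] by simp
  have sub: "vs.subspace (lie_stabilizer (cur k) h0)"
  proof (rule stabilizer_subspace[of k h0, unfolded sc])
    show "h0 (x + y) = h0 x + h0 y" if "x \<in> lcarrier (cur k)" "y \<in> lcarrier (cur k)" for x y
      using that cur_add[OF that] cur_mono[OF km] h(1) by (auto simp: h0_def lie_dual_def)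
    show "h0 (lscale (cur m) c x) = c * h0 x" if "x \<in> lcarrier (cur k)" for c x
      using that cur_scale[OF that, of c, unfolded sc] cur_mono[OF km] h(1) by (auto simp: h0_def lie_dual_def cur_zero)
  qed
  have "lie_stabilizer (cur m) h \<subseteq> lcarrier (cur m)" by (auto simp: lie_stabilizer_def)
  then have "{x \<in> lcarrier (cur m). trunc k x \<in> lie_stabilizer (cur k) h0} = lie_stabilizer (cur m) h"
    using stabilizer_trunc[OF assms] unfolding h0_def by blast
  then have 2: "ldim (cur m) (lie_stabilizer (cur m) h) = vs.dim (lie_stabilizer (cur k) h0) + vs.dim N"
    using split[OF sub] by (simp add: lie_stabilizer_def)
  show ?thesis using 1 2 by (simp add: ldim_def sc h0_def)
qed

end

section \<open>The comparison theorem\<close>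

theorem proposition4p1:
  fixes G :: "('k::alg_closed_field^'n^'n) set"
    and m k :: nat
    and chi psi :: "(nat \<Rightarrow> 'k^'n^'n) \<Rightarrow> 'k"
  assumes "CHAR('k) > 0"
    and "standard_reductive G"
    and "m > 0" and "k \<le> m"
    and "chi \<in> lie_dual (current_lie (lie_of G) m)"
    and "\<forall>x\<in>current_above (lie_of G) m k. chi x = 0"
    and "psi = restrict chi (lcarrier (current_lie (lie_of G) k))"
  shows
    "equivalent_categories
       (full_subcategory (red_mod TYPE('v) (current_lie (lie_of G) m) chi)
          (annihilated_by (current_lie (lie_of G) m) chi (current_above (lie_of G) m k)))
       (red_mod TYPE('v) (current_lie (lie_of G) k) psi)
     \<and>
     (\<forall>V :: (((nat \<Rightarrow> 'k^'n^'n) list \<Rightarrow> 'k) set set, 'v) module.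
        simple_left_module (red_env (current_lie (lie_of G) m) chi) V \<longrightarrow>
        V \<in> obj (full_subcategory (red_mod TYPE('v) (current_lie (lie_of G) m) chi)
              (annihilated_by (current_lie (lie_of G) m) chi (current_above (lie_of G) m k))))
     \<and>
     int (ldim (current_lie (lie_of G) m) (lcarrier (current_lie (lie_of G) m)))
       - int (ldim (current_lie (lie_of G) m) (lie_stabilizer (current_lie (lie_of G) m) chi))
     = int (ldim (current_lie (lie_of G) k) (lcarrier (current_lie (lie_of G) k)))
       - int (ldim (current_lie (lie_of G) k) (lie_stabilizer (current_lie (lie_of G) k) psi))"
proof -
  have "subgroup G GL"
    using assms(2) by (simp add: standard_reductive_def connected_reductive_def closed_subgroup_def)
  then interpret matrix_restricted_lie "lie_of G" using assms(1) by (rule matrix_restricted_lie_lie_of)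
  interpret restricted_lie_epi "cur m" "cur k" "trunc k" chi psi
    unfolding assms(7) using assms(5,6,4) by (rule truncation_epi)
  have above: "{x \<in> lcarrier (cur m). trunc k x = 0} = current_above (lie_of G) m k"
    using above_iff_trunc by blast
  show ?thesis
  proof (intro conjI allI impI)
    show "equivalent_categories
       (full_subcategory (red_mod TYPE('v) (cur m) chi) (annihilated_by (cur m) chi (current_above (lie_of G) m k)))
       (red_mod TYPE('v) (cur k) psi)"
      using restriction_equivalence by (simp only: above)
  next
    fix V :: "(((nat \<Rightarrow> 'k^'n^'n) list \<Rightarrow> 'k) set set, 'v) module"
    assume simple: "simple_left_module (red_env (cur m) chi) V"
    then show "V \<in> obj (full_subcategory (red_mod TYPE('v) (cur m) chi)
        (annihilated_by (cur m) chi (current_above (lie_of G) m k)))"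
      using simple_cur_finite_dim[OF simple] simple_killed_by_above[OF assms(6,4) simple]
      by (simp add: full_subcategory_def red_mod_def annihilated_by_def simple_left_module_def)
  next
    show "int (ldim (cur m) (lcarrier (cur m))) - int (ldim (cur m) (lie_stabilizer (cur m) chi))
     = int (ldim (cur k) (lcarrier (cur k))) - int (ldim (cur k) (lie_stabilizer (cur k) psi))"
      unfolding assms(7) by (rule dim_stabilizer[OF assms(5,6,4)])
  qed
qed

end
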